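(* Let $d\in\mathbb N$, $1<q\le2<p<\infty$, and $b\in\mathbb R$. Then, for the smoothness parameter $a=1/q$, $$ \sigma_m(\mathbf W^{1/q,b}_q)_p\asymp m^{-1/2}(\log m)^{(d-1)(b+1-1/q)+1} . $$ The upper bounds are achieved by a constructive greedy-type algorithm.
   Context: All functions are complex-valued, $2\pi$-periodic in each of $d$ variables, i.e. defined on $\mathbb T^d$; $\|\cdot\|_p$ is the $L_p(\mathbb T^d)$ norm with respect to the normalized measure $(2\pi)^{-d}d\mathbf x$, and $\hat f(\mathbf k):=(2\pi)^{-d}\int_{\mathbb T^d}f(\mathbf x)e^{-i(\mathbf k,\mathbf x)}d\mathbf x$. For a function $f$, the best $m$-term trigonometric approximation is $$\sigma_m(f)_p:=\inf\Big\|f-\sum_{j=1}^m c_je^{i(\mathbf k_j,\mathbf x)}\Big\|_p,$$ the infimum over all $\mathbf k_1,\dots,\mathbf k_m\in\mathbb Z^d$ and complex coefficients $c_1,\dots,c_m$; for a class $\mathbf W$ of functions, $\sigma_m(\mathbf W)_p:=\sup_{f\in\mathbf W}\sigma_m(f)_p$. For $\mathbf s=(s_1,\dots,s_d)$ with nonnegative integer coordinates, let $\rho(\mathbf s):=\{\mathbf k\in\mathbb Z^d:[2^{s_j-1}]\le|k_j|<2^{s_j},\ j=1,\dots,d\}$ ($[\cdot]$ is the integer part), $\|\mathbf s\|_1:=s_1+\dots+s_d$, and for $f\in L_1(\mathbb T^d)$ let $\delta_{\mathbf s}(f):=\sum_{\mathbf k\in\rho(\mathbf s)}\hat f(\mathbf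 k)e^{i(\mathbf k,\mathbf x)}$ and $f_l:=\sum_{\|\mathbf s\|_1=l}\delta_{\mathbf s}(f)$ for $l\in\mathbb N_0=\mathbb N\cup\{0\}$. With $\bar l:=\max(l,1)$, $$\mathbf W^{a,b}_q:=\{f\in L_1(\mathbb T^d):\ \|f_l\|_q\le2^{-al}(\bar l)^{(d-1)b}\ \text{ for all } l\in\mathbb N_0\}.$$ $A_m\asymp B_m$ means $c\,B_m\le A_m\le C\,B_m$ for all sufficiently large $m$, with constants $0<c\le C$ independent of $m$ (they may depend on the fixed parameters $d,q,p,b$). "Constructive greedy-type algorithm" is meant in the following sense: an explicit procedure assigns to each $f$ in the class a trigonometric polynomial with at most $m$ terms that attains the upper bound up to a constant; the procedure is assembled from Fourier partial sums, selection of dyadic Fourier blocks with largest norms, and constructive greedy-type methods $G^p_m$ producing $m$-term trigonometric polynomials with $\|g-G^p_m(g)\|_p\le C_1(d)(\max(m,1))^{-1/2}p^{1/2}\|g\|_A$ and $\|G^p_m(g)\|_A\le C_2(d)\|g\|_A$ for $2\le p<\infty$, where $\|g\|_A:=\sum_{\mathbf k}|\hat g(\mathbf k)|$. *)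

theory Defs
  imports "HOL-Analysis.Analysis"
begin

text \<open>
  A function on the \<open>d\<close>-dimensional torus is a function on \<open>real^'d\<close>, \<open>d = CARD('d)\<close>,
  that is \<open>2\<pi>\<close>-periodic in each variable; the torus measure is normalized
  Lebesgue measure on the period cell.
\<close>

type_synonym 'd tfun = "real^'d \<Rightarrow> complex"

definition torus :: "(real^'d::finite) measure" where
  "torus = uniform_measure lebesgue (cbox 0 (\<chi> j. 2 * pi))"

definition periodic :: "'d::finite tfun \<Rightarrow> bool" where
  "periodic f \<longleftrightarrow> (\<forall>x j. f (x + axis j (2 * pi)) = f x)"

definition L1_torus :: "'d::finite tfun set" where
  "L1_torus = {f. periodic f \<and> integrable torus f}"

text \<open>The norm is \<open>\<infinity>\<close> outside \<open>L\<^sub>p\<close>, hence the values in \<^typ>\<open>ennreal\<close>.\<close>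

definition Lp_norm :: "real \<Rightarrow> 'd::finite tfun \<Rightarrow> ennreal" where
  "Lp_norm p f =
     (let I = (\<integral>\<^sup>+x. ennreal (cmod (f x) powr p) \<partial>torus)
      in if I = \<infinity> then \<infinity> else ennreal (enn2real I powr (1 / p)))"

definition phase :: "int^'d::finite \<Rightarrow> real^'d \<Rightarrow> real" where
  "phase k x = (\<Sum>j\<in>UNIV. of_int (k $ j) * x $ j)"

definition expo :: "int^'d::finite \<Rightarrow> 'd tfun" where
  "expo k x = exp (\<i> * of_real (phase k x))"

definition fourier :: "'d::finite tfun \<Rightarrow> int^'d \<Rightarrow> complex" where
  "fourier f k = (LINT x|torus. f x * exp (- (\<i> * of_real (phase k x))))"

definition A_norm :: "'d::finite tfun \<Rightarrow> ennreal" where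
  "A_norm g = (\<Sum>\<^sub>\<infinity>k\<in>UNIV. ennreal (cmod (fourier g k)))"

text \<open>The frequencies are not required to be distinct.\<close>

definition trig_polys :: "nat \<Rightarrow> 'd::finite tfun set" where
  "trig_polys m = {t. \<exists>(k :: nat \<Rightarrow> int^'d) (c :: nat \<Rightarrow> complex).
                        t = (\<lambda>x. \<Sum>j=1..m. c j * expo (k j) x)}"

definition sigma :: "nat \<Rightarrow> 'd::finite tfun \<Rightarrow> real \<Rightarrow> ennreal" where
  "sigma m f p = (INF t\<in>trig_polys m. Lp_norm p (\<lambda>x. f x - t x))"

definition sigma_class :: "nat \<Rightarrow> 'd::finite tfun set \<Rightarrow> real \<Rightarrow> ennreal" where
  "sigma_class m W p = (SUP f\<in>W. sigma m f p)"

definition rho :: "nat^'d::finite \<Rightarrow> (int^'d) set" where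
  "rho s = {k. \<forall>j. \<lfloor>2 powr (real (s $ j) - 1)\<rfloor> \<le> \<bar>k $ j\<bar> \<and> \<bar>k $ j\<bar> < 2 ^ (s $ j)}"

definition levels :: "nat \<Rightarrow> (nat^'d::finite) set" where
  "levels l = {s. (\<Sum>j\<in>UNIV. s $ j) = l}"

definition delta :: "nat^'d::finite \<Rightarrow> 'd tfun \<Rightarrow> 'd tfun" where
  "delta s f = (\<lambda>x. \<Sum>k\<in>rho s. fourier f k * expo k x)"

definition layer :: "nat \<Rightarrow> 'd::finite tfun \<Rightarrow> 'd tfun" where
  "layer l f = (\<lambda>x. \<Sum>s\<in>levels l. delta s f x)"

definition W_class :: "real \<Rightarrow> real \<Rightarrow> real \<Rightarrow> 'd::finite tfun set" where
  "W_class a b q =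
     {f \<in> L1_torus. \<forall>l. Lp_norm q (layer l f) \<le>
        ennreal (2 powr (- a * real l) * real (max l 1) powr ((real CARD('d) - 1) * b))}"

text \<open>\<open>G p m\<close> is the \<open>m\<close>-term method for approximation in \<open>L\<^sub>p\<close>; the constants do not
  depend on \<open>p\<close>, \<open>m\<close> or the function.\<close>

definition greedy_methods ::
  "real \<Rightarrow> real \<Rightarrow> (real \<Rightarrow> nat \<Rightarrow> 'd::finite tfun \<Rightarrow> 'd tfun) \<Rightarrow> bool" where
  "greedy_methods C1 C2 G \<longleftrightarrow>
     (\<forall>p\<ge>2. \<forall>m. \<forall>g\<in>L1_torus.
        G p m g \<in> trig_polys m \<and>
        Lp_norm p (\<lambda>x. g x - G p m g x)
          \<le> ennreal (C1 * real (max m 1) powr (- 1 / 2) * p powr (1 / 2)) * A_norm g \<and>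
        A_norm (G p m g) \<le> ennreal C2 * A_norm g)"

text \<open>
  Syntax of the constructive procedures. A procedure is a finite expression that mentions
  neither the function it is applied to nor the particular family \<open>G\<close> it calls:
  \<^item> \<open>Partial_Sum n\<close>: the hyperbolic cross Fourier sum \<open>\<Sum>l<n. f\<^sub>l\<close>;
  \<^item> \<open>Largest_Blocks l u r\<close>: the sum of \<open>u\<close> blocks \<open>\<delta>\<^sub>s(f)\<close>, \<open>\<parallel>s\<parallel>\<^sub>1 = l\<close>, of largest
    \<open>L\<^sub>r\<close> norm (all blocks if there are fewer than \<open>u\<close>);
  \<^item> \<open>Greedy p m A\<close>: \<open>G p m\<close> applied to the output of \<open>A\<close>;
  \<^item> sums and differences of outputs.
\<close>

datatype procedure =
    Partial_Sum nat
  | Largest_Blocks nat nat real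
  | Greedy real nat procedure
  | Plus procedure procedure
  | Minus procedure procedure

definition largest_blocks ::
  "nat \<Rightarrow> nat \<Rightarrow> real \<Rightarrow> 'd::finite tfun \<Rightarrow> (nat^'d) set \<Rightarrow> bool" where
  "largest_blocks l u r f S \<longleftrightarrow>
     S \<subseteq> levels l \<and> card S = min u (card (levels l :: (nat^'d) set)) \<and>
     (\<forall>s\<in>S. \<forall>t\<in>levels l - S. Lp_norm r (delta t f) \<le> Lp_norm r (delta s f))"

text \<open>\<open>produces G f P g\<close>: \<open>g\<close> is the output of \<open>P\<close> on \<open>f\<close>. It is a relation only because
  ties between blocks of equal norm may be broken arbitrarily.\<close>

inductive produces ::
  "(real \<Rightarrow> nat \<Rightarrow> 'd::finite tfun \<Rightarrow> 'd tfun) \<Rightarrow> 'd tfun \<Rightarrow> procedure \<Rightarrow> 'd tfun \<Rightarrow> bool"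
  for G f where
  "produces G f (Partial_Sum n) (\<lambda>x. \<Sum>l<n. layer l f x)"
| "largest_blocks l u r f S \<Longrightarrow>
     produces G f (Largest_Blocks l u r) (\<lambda>x. \<Sum>s\<in>S. delta s f x)"
| "produces G f A g \<Longrightarrow> produces G f (Greedy p m A) (G p m g)"
| "produces G f A g \<Longrightarrow> produces G f B h \<Longrightarrow> produces G f (Plus A B) (\<lambda>x. g x + h x)"
| "produces G f A g \<Longrightarrow> produces G f B h \<Longrightarrow> produces G f (Minus A B) (\<lambda>x. g x - h x)"

lemma finite_vec_set:
  fixes F :: "'d::finite \<Rightarrow> 'a set"
  assumes "\<And>j. finite (F j)"
  shows "finite {v :: 'a^'d. \<forall>j. v $ j \<in> F j}"
proof (rule finite_subset)
  show "{v :: 'a^'d. \<forall>j. v $ j \<in> F j} \<subseteq> vec_lambda ` (PiE UNIV F)"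
  proof
    fix v :: "'a^'d" assume "v \<in> {v. \<forall>j. v $ j \<in> F j}"
    hence "vec_nth v \<in> PiE UNIV F" by auto
    moreover have "v = vec_lambda (vec_nth v)" by simp
    ultimately show "v \<in> vec_lambda ` (PiE UNIV F)" by blast
  qed
  show "finite (vec_lambda ` (PiE UNIV F))"
    using assms by (intro finite_imageI finite_PiE) auto
qed

lemma finite_rho: "finite (rho s)"
proof (rule finite_subset)
  show "rho s \<subseteq> {k. \<forall>j. k $ j \<in> {- (2 ^ (s $ j)) .. 2 ^ (s $ j)}}"
    unfolding rho_def
  proof clarify
    fix k j
    assume "\<forall>j. \<lfloor>2 powr (real (s $ j) - 1)\<rfloor> \<le> \<bar>k $ j\<bar> \<and> \<bar>k $ j\<bar> < 2 ^ (s $ j)"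
    hence "\<bar>k $ j\<bar> < 2 ^ (s $ j)" by blast
    thus "k $ j \<in> {- (2 ^ (s $ j)) .. 2 ^ (s $ j)}" by auto
  qed
qed (rule finite_vec_set, simp)

lemma finite_levels: "finite (levels l :: (nat^'d::finite) set)"
proof (rule finite_subset)
  show "levels l \<subseteq> {s :: nat^'d. \<forall>j. s $ j \<in> {..l}}"
    unfolding levels_def by (auto intro: member_le_sum)
qed (rule finite_vec_set, simp)

lemma ex_largest:
  fixes w :: "'a \<Rightarrow> 'b::linorder"
  assumes "finite L" "u \<le> card L"
  shows "\<exists>S\<subseteq>L. card S = u \<and> (\<forall>s\<in>S. \<forall>t\<in>L - S. w t \<le> w s)"
  using assms(2)
proof (induction u)
  case 0
  show ?case by (rule exI[of _ "{}"]) auto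
next
  case (Suc u)
  then obtain S where S: "S \<subseteq> L" "card S = u" "\<forall>s\<in>S. \<forall>t\<in>L - S. w t \<le> w s" by auto
  have fin: "finite S" using S(1) assms(1) finite_subset by blast
  have ne: "L - S \<noteq> {}"
    using S Suc.prems fin by (metis Diff_eq_empty_iff Suc_n_not_le_n subset_antisym)
  define M where "M = Max (w ` (L - S))"
  have "M \<in> w ` (L - S)" unfolding M_def using ne assms(1) by (intro Max_in) auto
  then obtain z where z: "z \<in> L - S" "w z = M" by auto
  have "\<forall>t\<in>L - S. w t \<le> w z" unfolding z(2) M_def using assms(1) by auto
  hence "\<forall>s\<in>insert z S. \<forall>t\<in>L - insert z S. w t \<le> w s" using S(3) by auto
  moreover have "card (insert z S) = Suc u" using z fin S(2) by simp
  moreover have "insert z S \<subseteq> L" using z S(1) by auto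
  ultimately show ?case by blast
qed

text \<open>Every procedure has an output on every function.\<close>

lemma produces_total:
  fixes f :: "'d::finite tfun"
  shows "\<exists>g. produces G f P g"
proof (induction P)
  case (Largest_Blocks l u r)
  have "\<exists>S. largest_blocks l u r f S"
    unfolding largest_blocks_def
    using ex_largest[OF finite_levels, of "min u (card (levels l :: (nat^'d) set))" l "\<lambda>s. Lp_norm r (delta s f)"]
    by auto
  thus ?case by (blast intro: produces.intros)
qed (blast intro: produces.intros)+

end

theory Submission
  imports Defs "HOL-Real_Asymp.Real_Asymp" "HOL-Probability.Probability_Measure"
begin

text \<open>
  Put \<open>E = (d - 1)(b + 1 - 1/q)\<close>. The number \<open>m^(-1/2)\<close> is what a sparse approximation of a
  function of bounded \<open>A\<close>-norm achieves; \<open>(log m)^E\<close> is the order of the \<open>A\<close>-norm of one layer \<open>f\<^sub>l\<close>,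
  \<open>l \<approx> log m\<close>; and the extra logarithm counts the layers that matter, which is proportional to
  \<open>log m\<close> because for smoothness \<open>1/q\<close> the exponential factors in \<open>l\<close> cancel and because \<open>p > 2\<close>.

  Upper bound. Let \<open>f\<close> be in the class and let \<open>Q\<^sub>l\<close> be the set of frequencies of the layer \<open>l\<close>. By
  duality \<open>\<parallel>f\<^sub>l\<parallel>\<^sub>A\<close> is at most \<open>\<parallel>f\<^sub>l\<parallel>\<^sub>q\<close> times the \<open>L\<^sub>r\<close> norm, \<open>1/q + 1/r = 1\<close>, of a polynomial on \<open>Q\<^sub>l\<close> with
  coefficients of modulus at most 1. Since \<open>r \<ge> 2\<close>, that norm is found by interpolation between
  \<open>L\<^sub>2\<close>, which is Parseval, and \<open>L\<^sub>R\<close> for an even \<open>R\<close>, which is a count of the tuples in \<open>Q\<^sub>l\<close> with sum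
  zero (\<open>card_zero_sum_layer_freqs\<close>). The result is \<open>\<parallel>f\<^sub>l\<parallel>\<^sub>A \<le> C l^E\<close> (\<open>W_layer_A\<close>). The layers below
  \<open>(log\<^sub>2 m)/2\<close> have at most \<open>m/2\<close> frequencies together, if \<open>m\<close> is large, and are kept. Pointwise
  \<open>|f\<^sub>l| \<le> \<parallel>f\<^sub>l\<parallel>\<^sub>A\<close>, so \<open>\<parallel>f\<^sub>l\<parallel>\<^sub>p^p \<le> \<parallel>f\<^sub>l\<parallel>\<^sub>A^(p-q) \<parallel>f\<^sub>l\<parallel>\<^sub>q^q\<close> decays like \<open>2^(-l)\<close> up to powers of \<open>l\<close>, and the
  layers above \<open>p log\<^sub>2 m\<close> are negligible (\<open>W_tail\<close>); that \<open>f\<close> is the sum of its layers is the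
  uniqueness theorem for Fourier series (\<open>fourier_uniqueness\<close>, through Stone--Weierstrass). The
  band in between has \<open>A\<close>-norm at most \<open>C (log m)^(E+1)\<close>, and one call of the greedy method
  finishes (\<open>layered_greedy_upper_bound\<close>).

  Greedy methods exist (\<open>greedy_methods_exist\<close>): \<open>g\<close> is the mean of the random function
  \<open>\<parallel>g\<parallel>\<^sub>A sgn(a\<^sub>k) e^(i(k,x))\<close>, where \<open>a\<^sub>k\<close> is the Fourier coefficient of \<open>g\<close> at \<open>k\<close> and \<open>k\<close> is drawn with
  probability \<open>|a\<^sub>k| / \<parallel>g\<parallel>\<^sub>A\<close>. The average of \<open>m\<close> samples is close to \<open>g\<close>, and good samples are found
  one at a time by keeping the integral of an exponential potential small (\<open>greedy_selection\<close>);
  exponential moments give the factor \<open>p^(1/2)\<close> for all \<open>p\<close>.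

  Lower bound. The extremal function is \<open>\<Sum> c\<^sub>l D\<^sub>l\<close> over \<open>\<gamma> log\<^sub>2 m \<le> l < \<kappa> log\<^sub>2 m\<close> with
  \<open>1 < \<gamma> < \<kappa> < p/2\<close>. Here \<open>D\<^sub>l\<close> is the sum of one Fejer kernel for each block \<open>s\<close> of the layer with
  all \<open>s\<^sub>j \<ge> 2\<close>; its \<open>L\<^sub>1\<close> norm is at most the number of blocks, its \<open>L\<^sub>2\<close> norm is bounded by
  Parseval's identity, and interpolation gives the correct bound for its \<open>L\<^sub>q\<close> norm
  (\<open>pint_layer_kernel_le\<close>). An approximant \<open>t\<close> with \<open>m\<close> terms is tested against \<open>h = \<Sum> D\<^sub>l\<close> with
  the frequencies of \<open>t\<close> removed (\<open>duality_lower_bound\<close>). As the levels stay below \<open>(p/2) log\<^sub>2 m\<close>,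
  the norm of \<open>h\<close> in the dual of \<open>L\<^sub>p\<close> is at most \<open>2 m^(1/2)\<close>; as they exceed \<open>log\<^sub>2 m\<close>, the removal of
  \<open>m\<close> frequencies spoils no layer, and each contributes at least a multiple of \<open>(log m)^E\<close> to the
  pairing.
\<close>

section \<open>The torus and its characters\<close>

lemma emeasure_cell:
  "emeasure lebesgue (cbox 0 (\<chi> j. 2 * pi) :: (real^'d::finite) set) = ennreal ((2 * pi) ^ CARD('d))"
proof -
  have "emeasure lborel (cbox 0 (\<chi> j. 2 * pi) :: (real^'d) set) = ennreal (\<Prod>b\<in>Basis. ((\<chi> j. 2 * pi) - 0 :: real^'d) \<bullet> b)"
    by (rule emeasure_lborel_cbox) (auto simp: Basis_vec_def inner_axis)
  also have "(\<Prod>b\<in>Basis. ((\<chi> j. 2 * pi) - 0 :: real^'d) \<bullet> b) = (\<Prod>b\<in>(Basis :: (real^'d) set). 2 * pi)"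
    by (intro prod.cong) (auto simp: Basis_vec_def inner_axis)
  finally show ?thesis by simp
qed

lemma
  shows sets_torus [simp, measurable_cong]: "sets (torus :: (real^'d::finite) measure) = sets lebesgue"
    and space_torus [simp]: "space (torus :: (real^'d::finite) measure) = UNIV"
  by (simp_all add: torus_def)

lemma prob_space_torus: "prob_space (torus :: (real^'d::finite) measure)"
  unfolding torus_def by (rule prob_space_uniform_measure) (simp_all add: emeasure_cell)

global_interpretation torus: prob_space "torus :: (real^'d::finite) measure"
  by (rule prob_space_torus)

lemma torus_density:
  "torus = density lebesgue (\<lambda>x::real^'d::finite. ennreal (indicator (cbox 0 (\<chi> j. 2 * pi)) x / (2 * pi) ^ CARD('d)))"
proof -
  have "(\<lambda>x::real^'d. indicator (cbox 0 (\<chi> j. 2 * pi)) x / ennreal ((2 * pi) ^ CARD('d))) =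
      (\<lambda>x. ennreal (indicator (cbox 0 (\<chi> j. 2 * pi)) x / (2 * pi) ^ CARD('d)))"
  proof
    fix x :: "real^'d"
    have "ennreal (indicator (cbox 0 (\<chi> j. 2 * pi)) x) / ennreal ((2 * pi) ^ CARD('d)) =
        ennreal (indicator (cbox 0 (\<chi> j. 2 * pi)) x / (2 * pi) ^ CARD('d))"
      by (rule divide_ennreal) auto
    thus "indicator (cbox 0 (\<chi> j. 2 * pi)) x / ennreal ((2 * pi) ^ CARD('d)) =
        ennreal (indicator (cbox 0 (\<chi> j. 2 * pi)) x / (2 * pi) ^ CARD('d))"
      by (simp add: ennreal_indicator)
  qed
  thus ?thesis unfolding torus_def uniform_measure_def emeasure_cell by (rule arg_cong)
qed

lemma AE_torus: "(AE x in torus. P x) \<longleftrightarrow> (AE x::real^'d::finite in lebesgue. x \<in> cbox 0 (\<chi> j. 2 * pi) \<longrightarrow> P x)"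
  unfolding torus_def by (rule AE_uniform_measure) (simp_all add: emeasure_cell)

lemma emeasure_torus_UNIV [simp]: "emeasure (torus :: (real^'d::finite) measure) UNIV = 1"
  using torus.emeasure_space_1[where 'd='d] by simp

lemma continuous_measurable_torus [measurable]:
  fixes f :: "real^'d::finite \<Rightarrow> 'b::topological_space"
  assumes "continuous_on UNIV f" shows "f \<in> borel_measurable torus"
proof -
  have "f \<in> borel_measurable borel" by (rule borel_measurable_continuous_onI[OF assms])
  hence "f \<in> borel_measurable lborel" by simp
  hence "f \<in> borel_measurable lebesgue" by (rule measurable_completion)
  thus ?thesis by simp
qed

lemma continuous_expo [continuous_intros]: "continuous_on S (expo k)"
  unfolding expo_def phase_def by (intro continuous_intros)

lemma expo_0 [simp]: "expo 0 x = 1"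
  by (simp add: expo_def phase_def)

lemma phase_add: "phase (k + l) x = phase k x + phase l x"
  by (simp add: phase_def algebra_simps sum.distrib)

lemma phase_uminus: "phase (- k) x = - phase k x"
  by (simp add: phase_def sum_negf)

lemma expo_add: "expo (k + l) x = expo k x * expo l x"
  by (simp add: expo_def phase_add ring_distribs exp_add)

lemma cnj_expo: "cnj (expo k x) = expo (- k) x"
  by (simp add: expo_def phase_uminus exp_cnj)

lemma cmod_expo [simp]: "cmod (expo k x) = 1"
  by (simp add: expo_def norm_exp_i_times)

lemma expo_diff: "expo (k - l) x = expo k x * cnj (expo l x)"
  using expo_add[of k "- l" x] by (simp add: cnj_expo)

lemma expo_sum: "expo (\<Sum>i\<in>I. k i) x = (\<Prod>i\<in>I. expo (k i) x)"
  by (induction I rule: infinite_finite_induct) (simp_all add: expo_add)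

lemma fourier_eq: "fourier f k = (LINT x|torus. f x * cnj (expo k x))"
  by (simp add: fourier_def expo_def exp_cnj)

lemma integrable_expo: "integrable torus (expo k)"
  by (rule torus.integrable_const_bound[where B=1]) (auto intro: continuous_intros continuous_measurable_torus)

lemma integral_circle:
  fixes k :: int
  shows "(LBINT t. indicator {0..2*pi} t *\<^sub>R exp (\<i> * of_real (of_int k * t))) = (if k = 0 then 2 * pi else 0)"
proof -
  define F where "F = (\<lambda>t::real. if k = 0 then complex_of_real t else exp (\<i> * of_real (of_int k * t)) / (\<i> * of_int k))"
  have "(LBINT t. indicator {0..2*pi} t *\<^sub>R exp (\<i> * of_real (of_int k * t))) = F (2*pi) - F 0"
  proof (rule integral_FTC_Icc)
    fix t :: real assume "0 \<le> t" "t \<le> 2 * pi"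
    show "(F has_vector_derivative exp (\<i> * of_real (of_int k * t))) (at t within {0..2*pi})"
    proof (cases "k = 0")
      case True
      thus ?thesis unfolding F_def
        by (auto intro!: derivative_eq_intros simp: has_vector_derivative_def scaleR_conv_of_real)
    next
      case False
      have "((\<lambda>z. exp (\<i> * (of_int k * z)) / (\<i> * of_int k)) has_field_derivative
          exp (\<i> * (of_int k * of_real t))) (at (of_real t))"
        using False by (auto intro!: derivative_eq_intros simp: mult_ac)
      from has_vector_derivative_real_field[OF this] False show ?thesis
        unfolding F_def by simp
    qed
  qed (auto intro!: continuous_intros)
  also have "\<dots> = (if k = 0 then 2 * pi else 0)"
  proof (cases "k = 0")
    case False
    have "exp (\<i> * of_real (of_int k * (2*pi))) = 1"
      by (auto simp: exp_eq_1)
    thus ?thesis using False by (simp add: F_def)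
  qed (simp add: F_def)
  finally show ?thesis .
qed

lemma Basis_cart_real: "(Basis :: (real^'d::finite) set) = range (\<lambda>j. axis j 1)"
  by (auto simp: Basis_vec_def)

lemma inj_axis_one: "inj (\<lambda>j::'d::finite. axis j (1::real))"
  by (auto simp: inj_def axis_eq_axis)

text \<open>
  Lebesgue measure is the image of a product measure indexed by the basis vectors, so the
  integral is a product of integrals over the circle.
\<close>

lemma integral_expo: "(LINT x|torus. expo k x) = (if k = 0 then 1 else 0)"
  for k :: "int^'d::finite"
proof -
  let ?C = "cbox 0 (\<chi> j. 2 * pi) :: (real^'d) set"
  let ?V = "(2 * pi) ^ CARD('d)"
  define \<kappa> where "\<kappa> = (\<lambda>b::real^'d. \<lfloor>(\<chi> j. real_of_int (k $ j)) \<bullet> b\<rfloor>)"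
  have \<kappa>: "\<kappa> (axis j 1) = k $ j" for j
    by (simp add: \<kappa>_def inner_axis)
  define g where "g = (\<lambda>b t. indicator {0..2*pi} t *\<^sub>R exp (\<i> * of_real (of_int (\<kappa> b) * t)))"
  have expo_eq: "expo k x = (\<Prod>b\<in>Basis. exp (\<i> * of_real (of_int (\<kappa> b) * (x \<bullet> b))))" for x
  proof -
    have "phase k x = (\<Sum>b\<in>Basis. of_int (\<kappa> b) * (x \<bullet> b))"
      unfolding phase_def Basis_cart_real sum.reindex[OF inj_axis_one]
      by (simp add: \<kappa> inner_axis)
    thus ?thesis by (simp add: expo_def sum_distrib_left exp_sum)
  qed
  have ind_eq: "indicator ?C x = (\<Prod>b\<in>Basis. indicator {0..2*pi} (x \<bullet> b) :: real)" for x
  proof -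
    have "x \<in> ?C \<longleftrightarrow> (\<forall>b\<in>Basis. x \<bullet> b \<in> {0..2*pi})"
      by (auto simp: mem_box Basis_cart_real inner_axis)
    thus ?thesis by (auto simp: indicator_def prod_zero_iff intro!: prod.neutral)
  qed
  have int1: "integrable lborel (g b)" for b
  proof -
    have "set_integrable lborel {0..2*pi} (\<lambda>t. exp (\<i> * of_real (of_int (\<kappa> b) * t)))"
      by (rule borel_integrable_atLeastAtMost') (intro continuous_intros)
    thus ?thesis by (simp add: g_def set_integrable_def)
  qed
  interpret P: product_sigma_finite "\<lambda>b::real^'d. lborel :: real measure"
    by standard
  have meas: "(\<lambda>x. (indicator ?C x) *\<^sub>R expo k x) \<in> borel_measurable borel"
    by (rule borel_measurable_scaleR[OF borel_measurable_indicator borel_measurable_continuous_onI[OF continuous_expo]]) simp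
  have "(LINT x|torus. expo k x) = (LINT x|lebesgue. (indicator ?C x / ?V) *\<^sub>R expo k x)"
    unfolding torus_density
  proof (rule integral_density)
    show "expo k \<in> borel_measurable lebesgue"
      using continuous_measurable_torus[OF continuous_expo[of UNIV k]] by simp
    show "(\<lambda>x. indicator ?C x / ?V) \<in> borel_measurable lebesgue"
      by (rule borel_measurable_divide[OF borel_measurable_indicator]) simp_all
  qed simp
  also have "\<dots> = (1 / ?V) *\<^sub>R (LINT x|lebesgue. indicator ?C x *\<^sub>R expo k x)"
    by (subst integral_scaleR_right[symmetric]) (simp add: field_simps)
  also have "(LINT x|lebesgue. indicator ?C x *\<^sub>R expo k x) = (LINT x|lborel. indicator ?C x *\<^sub>R expo k x)"
    using meas by (intro integral_completion) simp
  also have "\<dots> = (LINT f|Pi\<^sub>M Basis (\<lambda>b. lborel). (indicator ?C (\<Sum>b\<in>Basis. f b *\<^sub>R b)) *\<^sub>R expo k (\<Sum>b\<in>Basis. f b *\<^sub>R b))"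
  proof -
    let ?P = "Pi\<^sub>M Basis (\<lambda>b::real^'d. lborel :: real measure)"
    let ?S = "\<lambda>f. \<Sum>b\<in>(Basis :: (real^'d) set). f b *\<^sub>R b"
    let ?h = "\<lambda>x::real^'d. (indicator ?C x :: real) *\<^sub>R expo k x"
    have S: "?S \<in> borel_measurable ?P"
    proof (rule borel_measurable_sum)
      fix b :: "real^'d" assume "b \<in> Basis"
      from measurable_component_singleton[OF this, of "\<lambda>_. lborel :: real measure"]
      have "(\<lambda>f. f b) \<in> borel_measurable ?P" by simp
      thus "(\<lambda>f. f b *\<^sub>R b) \<in> borel_measurable ?P" by (rule borel_measurable_scaleR) simp
    qed
    have "integral\<^sup>L lborel ?h = integral\<^sup>L (distr ?P borel ?S) ?h"
      by (rule arg_cong[OF lborel_eq])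
    also have "\<dots> = integral\<^sup>L ?P (\<lambda>f. ?h (?S f))"
      by (rule integral_distr[OF S meas])
    finally show ?thesis .
  qed
  also have "\<dots> = (LINT f|Pi\<^sub>M Basis (\<lambda>b. lborel). (\<Prod>b\<in>Basis. g b (f b)))"
  proof (intro Bochner_Integration.integral_cong refl)
    fix f :: "real^'d \<Rightarrow> real"
    have "indicator ?C (\<Sum>b\<in>Basis. f b *\<^sub>R b) = (\<Prod>b\<in>Basis. indicator {0..2*pi} (f b) :: real)"
      unfolding ind_eq by (intro prod.cong refl) (simp only: inner_sum_left_Basis)
    moreover have "expo k (\<Sum>b\<in>Basis. f b *\<^sub>R b) = (\<Prod>b\<in>Basis. exp (\<i> * of_real (of_int (\<kappa> b) * f b)))"
      unfolding expo_eq by (intro prod.cong refl) (simp only: inner_sum_left_Basis)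
    ultimately show "indicator ?C (\<Sum>b\<in>Basis. f b *\<^sub>R b) *\<^sub>R expo k (\<Sum>b\<in>Basis. f b *\<^sub>R b) = (\<Prod>b\<in>Basis. g b (f b))"
      by (simp add: g_def scaleR_conv_of_real prod.distrib)
  qed
  also have "\<dots> = (\<Prod>b\<in>Basis. integral\<^sup>L lborel (g b))"
    by (rule P.product_integral_prod) (auto intro: int1)
  also have "\<dots> = (\<Prod>j\<in>UNIV. integral\<^sup>L lborel (g (axis j 1)))"
    unfolding Basis_cart_real prod.reindex[OF inj_axis_one] by simp
  also have "\<dots> = (\<Prod>j\<in>UNIV. if k $ j = 0 then 2 * pi else 0)"
    using integral_circle by (simp add: g_def \<kappa>)
  also have "\<dots> = (if k = 0 then of_real ?V else 0)"
    by (auto simp: vec_eq_iff prod_zero_iff)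
  finally show ?thesis by (auto simp: scaleR_conv_of_real)
qed

definition tpoly :: "(int^'d::finite) set \<Rightarrow> (int^'d \<Rightarrow> complex) \<Rightarrow> 'd tfun" where
  "tpoly F c x = (\<Sum>k\<in>F. c k * expo k x)"

lemma continuous_tpoly [continuous_intros]: "continuous_on S (tpoly F c)"
  unfolding tpoly_def by (intro continuous_intros)

lemma tpoly_measurable [measurable]: "tpoly F c \<in> borel_measurable torus"
  by (intro continuous_measurable_torus continuous_tpoly)

lemma expo_measurable [measurable]: "expo k \<in> borel_measurable torus"
  by (intro continuous_measurable_torus continuous_expo)

lemma cmod_tpoly_le: "cmod (tpoly F c x) \<le> (\<Sum>k\<in>F. cmod (c k))"
  unfolding tpoly_def by (rule order_trans[OF norm_sum]) (simp add: norm_mult)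

lemma integrable_tpoly: "integrable torus (tpoly F c)"
  by (rule torus.integrable_const_bound[where B="\<Sum>k\<in>F. cmod (c k)"]) (auto intro: cmod_tpoly_le)

lemma integrable_mult_tpoly:
  assumes "integrable torus f"
  shows "integrable torus (\<lambda>x. f x * tpoly F c x)"
proof (rule Bochner_Integration.integrable_bound)
  show "integrable torus (\<lambda>x. (\<Sum>k\<in>F. cmod (c k)) *\<^sub>R f x)" using assms by simp
  show "(\<lambda>x. f x * tpoly F c x) \<in> borel_measurable torus"
    using borel_measurable_integrable[OF assms] by measurable
  have *: "0 \<le> (\<Sum>k\<in>F. cmod (c k))" by (simp add: sum_nonneg)
  show "AE x in torus. norm (f x * tpoly F c x) \<le> norm ((\<Sum>k\<in>F. cmod (c k)) *\<^sub>R f x)"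
    using mult_right_mono[OF cmod_tpoly_le[of F c]] *
    by (auto simp: norm_mult mult.commute)
qed

lemma cnj_tpoly: "cnj (tpoly F c x) = tpoly (uminus ` F) (\<lambda>k. cnj (c (- k))) x"
  unfolding tpoly_def by (subst sum.reindex) (auto simp: cnj_expo)

lemma integrable_mult_cnj_expo: "integrable torus f \<Longrightarrow> integrable torus (\<lambda>x. f x * cnj (expo k x))"
  using integrable_mult_tpoly[of f "{- k}" "\<lambda>_. 1"] by (simp add: cnj_expo tpoly_def)

lemma integral_mult_cnj_tpoly:
  assumes "integrable torus f" "finite F"
  shows "(LINT x|torus. f x * cnj (tpoly F c x)) = (\<Sum>k\<in>F. fourier f k * cnj (c k))"
proof -
  have "(LINT x|torus. f x * cnj (tpoly F c x)) = (LINT x|torus. (\<Sum>k\<in>F. cnj (c k) * (f x * cnj (expo k x))))"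
    by (intro Bochner_Integration.integral_cong refl) (simp add: tpoly_def sum_distrib_left mult_ac)
  also have "\<dots> = (\<Sum>k\<in>F. LINT x|torus. cnj (c k) * (f x * cnj (expo k x)))"
  proof (rule Bochner_Integration.integral_sum)
    fix k
    show "integrable torus (\<lambda>x. cnj (c k) * (f x * cnj (expo k x)))"
      by (intro integrable_mult_right integrable_mult_cnj_expo assms)
  qed
  also have "\<dots> = (\<Sum>k\<in>F. fourier f k * cnj (c k))"
    by (simp add: fourier_eq mult.commute)
  finally show ?thesis .
qed

lemma fourier_expo: "fourier (expo l) k = (if k = l then 1 else 0)"
  using integral_expo[of "l - k"] by (simp add: fourier_eq expo_diff[symmetric])

lemma fourier_tpoly:
  assumes "finite F"
  shows "fourier (tpoly F c) k = (if k \<in> F then c k else 0)"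
proof -
  have "fourier (tpoly F c) k = (LINT x|torus. (\<Sum>l\<in>F. c l * (expo l x * cnj (expo k x))))"
    unfolding fourier_eq by (simp add: tpoly_def sum_distrib_right mult.assoc)
  also have "\<dots> = (\<Sum>l\<in>F. LINT x|torus. c l * (expo l x * cnj (expo k x)))"
    by (rule Bochner_Integration.integral_sum) (auto simp: expo_diff[symmetric] intro!: integrable_expo)
  also have "\<dots> = (\<Sum>l\<in>F. c l * fourier (expo l) k)"
    by (simp add: fourier_eq)
  also have "\<dots> = (if k \<in> F then c k else 0)"
    using assms by (simp add: fourier_expo if_distrib[of "\<lambda>z. _ * z"] cong: if_cong)
  finally show ?thesis .
qed

lemma parseval_tpoly:
  assumes "finite F"
  shows "(LINT x|torus. (cmod (tpoly F c x))\<^sup>2) = (\<Sum>k\<in>F. (cmod (c k))\<^sup>2)"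
proof -
  have "complex_of_real (LINT x|torus. (cmod (tpoly F c x))\<^sup>2) = (LINT x|torus. tpoly F c x * cnj (tpoly F c x))"
    by (simp add: complex_norm_square[symmetric] of_real_power[symmetric] del: of_real_power)
  also have "\<dots> = (\<Sum>k\<in>F. c k * cnj (c k))"
    by (subst integral_mult_cnj_tpoly[OF integrable_tpoly assms]) (simp add: fourier_tpoly[OF assms])
  also have "\<dots> = complex_of_real (\<Sum>k\<in>F. (cmod (c k))\<^sup>2)"
    by (simp add: complex_norm_square[symmetric])
  finally show ?thesis using of_real_eq_iff by blast
qed

section \<open>Integral inequalities\<close>

text \<open>
  The \<open>p\<close>-th power of the \<open>L\<^sub>p\<close> norm. It is an integral, hence monotone and accessible to
  pointwise estimates, without the case distinction between finite and infinite norms;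
  \<open>Lp_norm_le_iff\<close> translates back.
\<close>

definition pint :: "real \<Rightarrow> 'd::finite tfun \<Rightarrow> ennreal" where
  "pint p f = (\<integral>\<^sup>+x. ennreal (cmod (f x) powr p) \<partial>torus)"

lemma Lp_norm_le_iff:
  assumes "0 < p" "0 \<le> M"
  shows "Lp_norm p f \<le> ennreal M \<longleftrightarrow> pint p f \<le> ennreal (M powr p)"
proof (cases "pint p f")
  case (real i)
  have "i powr (1 / p) \<le> M \<longleftrightarrow> i \<le> M powr p"
  proof
    assume "i powr (1 / p) \<le> M"
    hence "(i powr (1 / p)) powr p \<le> M powr p" using assms by (intro powr_mono2) auto
    thus "i \<le> M powr p" using assms real by (simp add: powr_powr)
  next
    assume "i \<le> M powr p"
    hence "i powr (1 / p) \<le> (M powr p) powr (1 / p)" using assms real by (intro powr_mono2) auto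
    thus "i powr (1 / p) \<le> M" using assms by (simp add: powr_powr)
  qed
  thus ?thesis using real assms by (simp add: Lp_norm_def pint_def[symmetric] Let_def)
next
  case top
  thus ?thesis by (simp add: Lp_norm_def pint_def[symmetric] Let_def top_unique)
qed

lemma pint_two_tpoly:
  assumes "finite F"
  shows "pint 2 (tpoly F c) = ennreal (\<Sum>k\<in>F. (cmod (c k))\<^sup>2)"
proof -
  have "integrable torus (\<lambda>x. (cmod (tpoly F c x))\<^sup>2)"
    by (rule torus.integrable_const_bound[where B="(\<Sum>k\<in>F. cmod (c k))\<^sup>2"])
      (auto intro!: power_mono cmod_tpoly_le)
  hence "(\<integral>\<^sup>+x. ennreal ((cmod (tpoly F c x))\<^sup>2) \<partial>torus) = ennreal (LINT x|torus. (cmod (tpoly F c x))\<^sup>2)"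
    by (rule nn_integral_eq_integral) simp
  thus ?thesis using parseval_tpoly[OF assms, of c] by (simp add: pint_def)
qed

text \<open>
  The weighted inequality of arithmetic and geometric means, applied to \<open>u x / X\<close> and \<open>v x / Y\<close>
  and integrated. Both Hoelder's inequality and the logarithmic convexity of \<open>L\<^sub>p\<close> norms are
  instances of this form.
\<close>

lemma nn_integral_powr_mult_le:
  fixes u v :: "'a \<Rightarrow> real"
  assumes [measurable]: "u \<in> borel_measurable M" "v \<in> borel_measurable M"
    and nn: "\<And>x. 0 \<le> u x" "\<And>x. 0 \<le> v x"
    and ab: "0 < \<alpha>" "0 < \<beta>" "\<alpha> + \<beta> = 1"
    and U: "(\<integral>\<^sup>+x. ennreal (u x) \<partial>M) \<le> ennreal X" and V: "(\<integral>\<^sup>+x. ennreal (v x) \<partial>M) \<le> ennreal Y"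
    and pos: "0 < X" "0 < Y"
  shows "(\<integral>\<^sup>+x. ennreal (u x powr \<alpha> * v x powr \<beta>) \<partial>M) \<le> ennreal (X powr \<alpha> * Y powr \<beta>)"
proof -
  define Z where "Z = X powr \<alpha> * Y powr \<beta>"
  have Z: "0 < Z" using pos by (simp add: Z_def)
  have "u x powr \<alpha> * v x powr \<beta> \<le> Z * \<alpha> / X * u x + Z * \<beta> / Y * v x" for x
  proof (cases "u x = 0 \<or> v x = 0")
    case True
    thus ?thesis using nn[of x] pos ab Z by auto
  next
    case False
    hence "u x / X > 0" "v x / Y > 0" using nn[of x] pos by (auto simp: less_le)
    from Youngs_inequality_0[of \<alpha> \<beta>, OF _ _ _ this] ab
    have "(u x / X) powr \<alpha> * (v x / Y) powr \<beta> \<le> \<alpha> * (u x / X) + \<beta> * (v x / Y)" by simp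
    hence "Z * ((u x / X) powr \<alpha> * (v x / Y) powr \<beta>) \<le> Z * (\<alpha> * (u x / X) + \<beta> * (v x / Y))"
      using Z by (intro mult_left_mono) auto
    moreover have "Z * ((u x / X) powr \<alpha> * (v x / Y) powr \<beta>) = u x powr \<alpha> * v x powr \<beta>"
      using nn pos by (simp add: Z_def powr_divide)
    ultimately show ?thesis by (simp add: algebra_simps)
  qed
  hence "(\<integral>\<^sup>+x. ennreal (u x powr \<alpha> * v x powr \<beta>) \<partial>M)
      \<le> (\<integral>\<^sup>+x. ennreal (Z * \<alpha> / X) * ennreal (u x) + ennreal (Z * \<beta> / Y) * ennreal (v x) \<partial>M)"
    using nn pos ab Z
    by (intro nn_integral_mono) (simp add: ennreal_mult[symmetric] ennreal_plus[symmetric] del: ennreal_plus)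
  also have "\<dots> = ennreal (Z * \<alpha> / X) * (\<integral>\<^sup>+x. ennreal (u x) \<partial>M) + ennreal (Z * \<beta> / Y) * (\<integral>\<^sup>+x. ennreal (v x) \<partial>M)"
    by (simp add: nn_integral_add nn_integral_cmult)
  also have "\<dots> \<le> ennreal (Z * \<alpha> / X) * ennreal X + ennreal (Z * \<beta> / Y) * ennreal Y"
    by (intro add_mono mult_left_mono U V) auto
  also have "\<dots> = ennreal (Z * \<alpha> + Z * \<beta>)"
    using pos ab Z by (simp add: ennreal_mult[symmetric] ennreal_plus[symmetric] del: ennreal_plus)
  also have "Z * \<alpha> + Z * \<beta> = Z" using ab by (simp add: distrib_left[symmetric])
  finally show ?thesis by (simp add: Z_def)
qed

lemma pint_interpolation:
  assumes [measurable]: "f \<in> borel_measurable torus"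
    and ab: "0 < \<alpha>" "0 < \<beta>" "\<alpha> + \<beta> = 1" and r: "r = \<alpha> * r0 + \<beta> * r1"
    and X: "pint r0 f \<le> ennreal X" "0 < X" and Y: "pint r1 f \<le> ennreal Y" "0 < Y"
  shows "pint r f \<le> ennreal (X powr \<alpha> * Y powr \<beta>)"
proof -
  have "pint r f = (\<integral>\<^sup>+x. ennreal ((cmod (f x) powr r0) powr \<alpha> * (cmod (f x) powr r1) powr \<beta>) \<partial>torus)"
    unfolding pint_def r by (simp add: powr_powr powr_add mult.commute)
  also have "\<dots> \<le> ennreal (X powr \<alpha> * Y powr \<beta>)"
    using assms by (intro nn_integral_powr_mult_le) (auto simp: pint_def)
  finally show ?thesis .
qed

lemma Hoelder_torus:
  assumes [measurable]: "f \<in> borel_measurable torus" "g \<in> borel_measurable torus"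
    and pq: "1 < p" "1 < q" "1 / p + 1 / q = 1"
    and A: "pint p f \<le> ennreal (A powr p)" "0 < A" and B: "pint q g \<le> ennreal (B powr q)" "0 < B"
  shows "cmod (LINT x|torus. f x * g x) \<le> A * B"
proof (cases "integrable torus (\<lambda>x. f x * g x)")
  case True
  have "ennreal (cmod (LINT x|torus. f x * g x)) \<le> (\<integral>\<^sup>+x. ennreal (cmod (f x * g x)) \<partial>torus)"
    by (rule integral_norm_bound_ennreal[OF True])
  also have "\<dots> = (\<integral>\<^sup>+x. ennreal ((cmod (f x) powr p) powr (1/p) * (cmod (g x) powr q) powr (1/q)) \<partial>torus)"
    using pq by (simp add: powr_powr norm_mult)
  also have "\<dots> \<le> ennreal ((A powr p) powr (1/p) * (B powr q) powr (1/q))"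
    using pq A B by (intro nn_integral_powr_mult_le) (auto simp: pint_def)
  also have "\<dots> = ennreal (A * B)" using pq A B by (simp add: powr_powr)
  finally show ?thesis using A B by (subst (asm) ennreal_le_iff) auto
next
  case False
  thus ?thesis using A B by (simp add: not_integrable_integral_eq)
qed

lemma convex_on_powr_nonneg:
  fixes p :: real
  assumes "1 \<le> p" shows "convex_on {0..} (\<lambda>x. x powr p)"
proof (rule convex_onI)
  fix t x y :: real assume t: "0 < t" "t < 1" and xy: "x \<in> {0..}" "y \<in> {0..}"
  have small: "(s * z) powr p \<le> s * z powr p" if "0 < s" "s < 1" "0 \<le> z" for s z :: real
    using powr_mono'[of 1 p s] that assms by (simp add: powr_mult mult_right_mono)
  consider "x = 0" | "y = 0" | "0 < x" "0 < y" using xy by force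
  thus "((1 - t) *\<^sub>R x + t *\<^sub>R y) powr p \<le> (1 - t) * x powr p + t * y powr p"
  proof cases
    case 3
    thus ?thesis using convex_onD[OF powr_convex[OF assms], of t x y] t by simp
  qed (use small[of t y] small[of "1 - t" x] t xy in auto)
qed simp

text \<open>
  After division by \<open>\<Sum>j\<in>J. \<alpha> j\<close> the sum is a convex combination of the functions
  \<open>a j / \<alpha> j\<close>, and convexity of \<open>\<lambda>x. x powr p\<close> bounds it termwise.
\<close>

lemma Minkowski_torus:
  assumes fin: "finite J" and p: "1 \<le> p"
    and meas: "\<And>j. j \<in> J \<Longrightarrow> a j \<in> borel_measurable torus"
    and pos: "\<And>j. j \<in> J \<Longrightarrow> 0 < \<alpha> j"
    and bd: "\<And>j. j \<in> J \<Longrightarrow> pint p (a j) \<le> ennreal (\<alpha> j powr p)"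
  shows "pint p (\<lambda>x. \<Sum>j\<in>J. a j x) \<le> ennreal ((\<Sum>j\<in>J. \<alpha> j) powr p)"
proof (cases "J = {}")
  case True
  thus ?thesis using p by (simp add: pint_def)
next
  case False
  define S where "S = (\<Sum>j\<in>J. \<alpha> j)"
  have S: "0 < S" unfolding S_def using fin False pos by (intro sum_pos) auto
  have nn: "0 \<le> \<alpha> j" if "j \<in> J" for j using pos[OF that] by simp
  have pw: "cmod (\<Sum>j\<in>J. a j x) powr p \<le> (\<Sum>j\<in>J. (S powr p * (\<alpha> j / S) / \<alpha> j powr p) * cmod (a j x) powr p)" for x
  proof -
    have "cmod (\<Sum>j\<in>J. a j x) powr p \<le> (\<Sum>j\<in>J. cmod (a j x)) powr p"
      using p by (intro powr_mono2 norm_sum) auto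
    also have "(\<Sum>j\<in>J. cmod (a j x)) = S * (\<Sum>j\<in>J. (\<alpha> j / S) *\<^sub>R (cmod (a j x) / \<alpha> j))"
      unfolding sum_distrib_left using pos S by (intro sum.cong) (auto simp: less_imp_neq[symmetric])
    also have "\<dots> powr p = S powr p * (\<Sum>j\<in>J. (\<alpha> j / S) *\<^sub>R (cmod (a j x) / \<alpha> j)) powr p"
      using S pos by (intro powr_mult) 
    also have "\<dots> \<le> S powr p * (\<Sum>j\<in>J. (\<alpha> j / S) * (cmod (a j x) / \<alpha> j) powr p)"
    proof (intro mult_left_mono convex_on_sum[OF fin False convex_on_powr_nonneg[OF p]])
      show "(\<Sum>j\<in>J. \<alpha> j / S) = 1" using S by (simp add: S_def[symmetric] sum_divide_distrib[symmetric])
    qed (use S nn in auto)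
    also have "\<dots> = (\<Sum>j\<in>J. (S powr p * (\<alpha> j / S) / \<alpha> j powr p) * cmod (a j x) powr p)"
      unfolding sum_distrib_left by (intro sum.cong refl) (simp add: powr_divide nn)
    finally show ?thesis .
  qed
  have "pint p (\<lambda>x. \<Sum>j\<in>J. a j x) \<le> (\<integral>\<^sup>+x. (\<Sum>j\<in>J. ennreal (S powr p * (\<alpha> j / S) / \<alpha> j powr p) * ennreal (cmod (a j x) powr p)) \<partial>torus)"
    unfolding pint_def
  proof (rule nn_integral_mono)
    fix x
    have "ennreal (cmod (\<Sum>j\<in>J. a j x) powr p) \<le> ennreal (\<Sum>j\<in>J. (S powr p * (\<alpha> j / S) / \<alpha> j powr p) * cmod (a j x) powr p)"
      by (rule ennreal_leI[OF pw])
    also have "\<dots> = (\<Sum>j\<in>J. ennreal ((S powr p * (\<alpha> j / S) / \<alpha> j powr p) * cmod (a j x) powr p))"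
      using S nn by (intro sum_ennreal[symmetric]) simp
    also have "\<dots> = (\<Sum>j\<in>J. ennreal (S powr p * (\<alpha> j / S) / \<alpha> j powr p) * ennreal (cmod (a j x) powr p))"
      using S nn by (intro sum.cong refl ennreal_mult) simp_all
    finally show "ennreal (cmod (\<Sum>j\<in>J. a j x) powr p) \<le> \<dots>" .
  qed
  also have "\<dots> = (\<Sum>j\<in>J. ennreal (S powr p * (\<alpha> j / S) / \<alpha> j powr p) * pint p (a j))"
    unfolding pint_def using meas by (subst nn_integral_sum) (auto simp: nn_integral_cmult intro!: sum.cong)
  also have "\<dots> \<le> (\<Sum>j\<in>J. ennreal (S powr p * (\<alpha> j / S) / \<alpha> j powr p) * ennreal (\<alpha> j powr p))"
    by (intro sum_mono mult_left_mono bd) auto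
  also have "\<dots> = (\<Sum>j\<in>J. ennreal (S powr p * (\<alpha> j / S)))"
  proof (intro sum.cong refl)
    fix j assume "j \<in> J"
    thus "ennreal (S powr p * (\<alpha> j / S) / \<alpha> j powr p) * ennreal (\<alpha> j powr p) = ennreal (S powr p * (\<alpha> j / S))"
      using pos[of j] S by (subst ennreal_mult[symmetric]) auto
  qed
  also have "\<dots> = ennreal (\<Sum>j\<in>J. S powr p * (\<alpha> j / S))"
    using pos S by (intro sum_ennreal) (auto simp: less_imp_le)
  also have "(\<Sum>j\<in>J. S powr p * (\<alpha> j / S)) = S powr p * (S / S)"
    by (simp only: sum_distrib_left[symmetric] sum_divide_distrib[symmetric] S_def[symmetric])
  finally show ?thesis using S by (simp add: S_def)
qed

lemma Minkowski_torus_add: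
  assumes "1 \<le> p" "f \<in> borel_measurable torus" "g \<in> borel_measurable torus"
    and "pint p f \<le> ennreal (a powr p)" "pint p g \<le> ennreal (b powr p)" "0 < a" "0 < b"
  shows "pint p (\<lambda>x. f x + g x) \<le> ennreal ((a + b) powr p)"
proof -
  have "pint p (\<lambda>x. \<Sum>j\<in>(UNIV :: bool set). (if j then f else g) x) \<le>
      ennreal ((\<Sum>j\<in>(UNIV :: bool set). if j then a else b) powr p)"
    using assms by (intro Minkowski_torus) auto
  thus ?thesis by (simp add: UNIV_bool add.commute)
qed

lemma pint_le_AE_bound:
  assumes "AE x in torus. cmod (f x) \<le> M" "0 \<le> p"
  shows "pint p (f :: 'd::finite tfun) \<le> ennreal (M powr p)"
proof -
  have "pint p f \<le> (\<integral>\<^sup>+x. ennreal (M powr p) \<partial>(torus :: (real^'d) measure))"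
    unfolding pint_def
  proof (rule nn_integral_mono_AE)
    show "AE x in torus. ennreal (cmod (f x) powr p) \<le> ennreal (M powr p)"
      using assms(1) by eventually_elim (auto intro!: ennreal_leI powr_mono2 assms(2))
  qed
  thus ?thesis by simp
qed

lemma pint_cmult:
  assumes "0 \<le> a" "f \<in> borel_measurable torus"
  shows "pint p (\<lambda>x. of_real a * f x) = ennreal (a powr p) * pint p f"
proof -
  have [measurable]: "f \<in> borel_measurable torus" by fact
  have "pint p (\<lambda>x. of_real a * f x) = (\<integral>\<^sup>+x. ennreal (a powr p) * ennreal (cmod (f x) powr p) \<partial>torus)"
    unfolding pint_def using assms by (simp add: norm_mult powr_mult ennreal_mult)
  also have "\<dots> = ennreal (a powr p) * pint p f" unfolding pint_def by (rule nn_integral_cmult) measurable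
  finally show ?thesis .
qed

lemma nn_integral_le_of_pint:
  assumes [measurable]: "f \<in> borel_measurable torus" and p: "1 < p"
    and \<alpha>: "pint p f \<le> ennreal (\<alpha> powr p)" "0 < \<alpha>"
  shows "(\<integral>\<^sup>+x. ennreal (cmod (f x)) \<partial>torus) \<le> ennreal \<alpha>"
proof -
  have "(\<integral>\<^sup>+x. ennreal (cmod (f x)) \<partial>torus) =
      (\<integral>\<^sup>+x. ennreal ((cmod (f x) powr p) powr (1 / p) * 1 powr (1 - 1 / p)) \<partial>torus)"
    using p by (simp add: powr_powr)
  also have "\<dots> \<le> ennreal ((\<alpha> powr p) powr (1 / p) * 1 powr (1 - 1 / p))"
    using p \<alpha> by (intro nn_integral_powr_mult_le) (auto simp: pint_def)
  also have "\<dots> = ennreal \<alpha>" using p \<alpha> by (simp add: powr_powr)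
  finally show ?thesis .
qed

text \<open>
  Hoelder's inequality against the constant 1 on a probability space.
\<close>

lemma pint_le_of_pint_two:
  fixes f :: "'d::finite tfun"
  assumes [measurable]: "f \<in> borel_measurable torus" and r: "0 < r" "r < 2" and X: "pint 2 f \<le> ennreal X" "0 < X"
  shows "pint r f \<le> ennreal (X powr (r / 2))"
proof -
  have "pint r f = (\<integral>\<^sup>+x. ennreal ((cmod (f x) powr 2) powr (r / 2) * 1 powr (1 - r / 2)) \<partial>torus)"
    unfolding pint_def powr_powr by simp
  also have "\<dots> \<le> ennreal (X powr (r / 2) * 1 powr (1 - r / 2))"
    using r X by (intro nn_integral_powr_mult_le) (auto simp: pint_def)
  finally show ?thesis by simp
qed

section \<open>Uniqueness of Fourier coefficients\<close>

text \<open>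
  The torus as a compact subset of \<open>complex^'d\<close>. Polynomials in the real and imaginary parts of
  the coordinates pull back to trigonometric polynomials along this map, which makes the
  Stone--Weierstrass theorem applicable.
\<close>

definition circle_map :: "real^'d::finite \<Rightarrow> complex^'d" where
  "circle_map x = (\<chi> j. cis (x $ j))"

definition trig_fun :: "'d::finite tfun \<Rightarrow> bool" where
  "trig_fun f \<longleftrightarrow> (\<exists>F c. finite F \<and> f = tpoly F c)"

lemma tpoly_mono:
  assumes "finite G" "F \<subseteq> G"
  shows "tpoly F c = tpoly G (\<lambda>k. if k \<in> F then c k else 0)"
proof
  fix x
  have "tpoly G (\<lambda>k. if k \<in> F then c k else 0) x = (\<Sum>k\<in>F. (if k \<in> F then c k else 0) * expo k x)"
    unfolding tpoly_def using assms by (intro sum.mono_neutral_right) auto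
  thus "tpoly F c x = tpoly G (\<lambda>k. if k \<in> F then c k else 0) x"
    by (simp add: tpoly_def)
qed

lemma tpoly_add: "tpoly F c x + tpoly F d x = tpoly F (\<lambda>k. c k + d k) x"
  by (simp add: tpoly_def sum.distrib algebra_simps)

lemma tpoly_diff: "tpoly F c x - tpoly F d x = tpoly F (\<lambda>k. c k - d k) x"
  by (simp add: tpoly_def sum_subtractf algebra_simps)

lemma trig_fun_tpoly [intro]: "finite F \<Longrightarrow> trig_fun (tpoly F c)"
  by (auto simp: trig_fun_def)

lemma trig_fun_expo [intro]: "trig_fun (\<lambda>x. a * expo k x)"
proof -
  have "(\<lambda>x. a * expo k x) = tpoly {k} (\<lambda>_. a)" by (auto simp: tpoly_def)
  thus ?thesis by auto
qed

lemma trig_fun_const [intro]: "trig_fun (\<lambda>x. a)"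
  using trig_fun_expo[of a 0] by simp

lemma trig_fun_add [intro]:
  assumes "trig_fun f" "trig_fun g" shows "trig_fun (\<lambda>x. f x + g x)"
proof -
  obtain F c G d where fg: "finite F" "f = tpoly F c" "finite G" "g = tpoly G d"
    using assms unfolding trig_fun_def by metis
  have "tpoly F c = tpoly (F \<union> G) (\<lambda>k. if k \<in> F then c k else 0)"
    "tpoly G d = tpoly (F \<union> G) (\<lambda>k. if k \<in> G then d k else 0)"
    using fg by (auto intro!: tpoly_mono)
  thus ?thesis using fg by (auto simp: tpoly_add)
qed

lemma trig_fun_sum [intro]:
  "(\<And>i. i \<in> I \<Longrightarrow> trig_fun (f i)) \<Longrightarrow> trig_fun (\<lambda>x. \<Sum>i\<in>I. f i x)"
  by (induction I rule: infinite_finite_induct) auto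

lemma trig_fun_mult [intro]:
  assumes "trig_fun f" "trig_fun g" shows "trig_fun (\<lambda>x. f x * g x)"
proof -
  obtain F c G d where fg: "finite F" "f = tpoly F c" "finite G" "g = tpoly G d"
    using assms unfolding trig_fun_def by metis
  have "(\<lambda>x. f x * g x) = (\<lambda>x. \<Sum>k\<in>F. \<Sum>l\<in>G. (c k * d l) * expo (k + l) x)"
    by (auto simp: fg tpoly_def sum_product expo_add mult_ac)
  moreover have "trig_fun \<dots>" by (intro trig_fun_sum trig_fun_expo)
  ultimately show ?thesis by simp
qed

lemma cis_axis: "cis (x $ j) = expo (axis j 1) x" "cnj (cis (x $ j)) = expo (- axis j 1) x"
proof -
  have "phase (axis j 1) x = x $ j"
    by (simp add: phase_def axis_def if_distrib[of "\<lambda>t. of_int t * _"] cong: if_cong)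
  thus "cis (x $ j) = expo (axis j 1) x" "cnj (cis (x $ j)) = expo (- axis j 1) x"
    by (simp_all add: expo_def cis_conv_exp phase_uminus exp_cnj)
qed

text \<open>
  On the torus the real and imaginary parts of a coordinate are \<open>cos\<close> and \<open>sin\<close>, combinations of
  two characters.
\<close>

lemma trig_fun_linear:
  assumes "bounded_linear (L :: complex^'d::finite \<Rightarrow> real)"
  shows "trig_fun (\<lambda>x. of_real (L (circle_map x)))"
proof -
  interpret L: bounded_linear L by fact
  have "of_real (L (circle_map x)) = (\<Sum>j\<in>UNIV.
      (of_real (L (axis j 1)) / 2 - \<i> * of_real (L (axis j \<i>)) / 2) * expo (axis j 1) x
      + (of_real (L (axis j 1)) / 2 + \<i> * of_real (L (axis j \<i>)) / 2) * expo (- axis j 1) x)" for x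
  proof -
    have "circle_map x = (\<Sum>j\<in>UNIV. cos (x $ j) *\<^sub>R axis j 1 + sin (x $ j) *\<^sub>R axis j \<i>)"
      by (simp add: vec_eq_iff circle_map_def axis_def if_distrib[of "\<lambda>t. _ *\<^sub>R t"] sum.distrib
          complex_eq_iff cong: if_cong)
    hence "L (circle_map x) = (\<Sum>j\<in>UNIV. cos (x $ j) * L (axis j 1) + sin (x $ j) * L (axis j \<i>))"
      by (simp add: L.sum L.add L.scaleR)
    moreover have "of_real (cos (x $ j) * L (axis j 1) + sin (x $ j) * L (axis j \<i>)) =
      (of_real (L (axis j 1)) / 2 - \<i> * of_real (L (axis j \<i>)) / 2) * expo (axis j 1) x
      + (of_real (L (axis j 1)) / 2 + \<i> * of_real (L (axis j \<i>)) / 2) * expo (- axis j 1) x" for j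
      unfolding cis_axis[symmetric] by (simp add: complex_eq_iff algebra_simps)
    ultimately show ?thesis by (simp only: of_real_sum)
  qed
  moreover have "trig_fun (\<lambda>x. \<Sum>j\<in>UNIV.
      (of_real (L (axis j 1)) / 2 - \<i> * of_real (L (axis j \<i>)) / 2) * expo (axis j 1) x
      + (of_real (L (axis j 1)) / 2 + \<i> * of_real (L (axis j \<i>)) / 2) * expo (- axis j 1) x)"
    by (intro trig_fun_sum trig_fun_add trig_fun_expo)
  ultimately show ?thesis by presburger
qed

lemma trig_fun_polynomial:
  assumes "real_polynomial_function (g :: complex^'d::finite \<Rightarrow> real)"
  shows "trig_fun (\<lambda>x. of_real (g (circle_map x)))"
  using assms by induction (auto intro: trig_fun_linear)

lemma integral_mult_trig_fun_eq_0:
  assumes f: "integrable torus f" "\<And>k. fourier f k = 0" and t: "trig_fun t"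
  shows "(LINT x|torus. f x * t x) = 0"
proof -
  obtain F c where F: "finite F" and t: "t = tpoly F c" using t by (auto simp: trig_fun_def)
  have "t x = cnj (tpoly (uminus ` F) (\<lambda>k. cnj (c (- k))) x)" for x
    by (simp add: t cnj_tpoly image_image)
  thus ?thesis using integral_mult_cnj_tpoly[OF f(1), of "uminus ` F" "\<lambda>k. cnj (c (- k))"] F f(2) by simp
qed

lemma integrable_mult_trig_fun: "integrable torus f \<Longrightarrow> trig_fun t \<Longrightarrow> integrable torus (\<lambda>x. f x * t x)"
  by (auto simp: trig_fun_def intro: integrable_mult_tpoly)

lemma norm_circle_map: "norm (circle_map x :: complex^'d::finite) \<le> CARD('d)"
proof -
  have "norm (circle_map x :: complex^'d) \<le> (\<Sum>j\<in>UNIV. norm (circle_map x $ j))"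
    unfolding norm_vec_def by (rule L2_set_le_sum) simp
  thus ?thesis by (simp add: circle_map_def)
qed

lemma continuous_circle_map [continuous_intros]: "continuous_on S circle_map"
  unfolding circle_map_def by (intro continuous_intros)

text \<open>
  The function \<open>\<psi>\<close> is uniformly close to a polynomial on a ball that contains the image of the
  torus, and polynomials are orthogonal to \<open>f\<close> by assumption.
\<close>

lemma integral_mult_continuous_eq_0:
  fixes f :: "'d::finite tfun" and \<psi> :: "complex^'d \<Rightarrow> real"
  assumes f: "integrable torus f" "\<And>k. fourier f k = 0" and \<psi>: "continuous_on UNIV \<psi>"
  shows "(LINT x|torus. f x * of_real (\<psi> (circle_map x))) = 0"
proof -
  define A where "A = (LINT x|torus. cmod (f x))"
  have A: "0 \<le> A" by (simp add: A_def)
  have meas: "(\<lambda>x. \<psi> (circle_map x)) \<in> borel_measurable torus"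
    by (intro continuous_measurable_torus continuous_on_compose2[OF \<psi>] continuous_circle_map) auto
  note [measurable] = meas borel_measurable_integrable[OF f(1)]
  have le: "cmod (LINT x|torus. f x * of_real (\<psi> (circle_map x))) \<le> e * A" if e: "0 < e" for e
  proof -
    obtain g where g: "real_polynomial_function g"
      "\<And>z. z \<in> cball 0 (CARD('d)) \<Longrightarrow> \<bar>\<psi> z - g z\<bar> < e"
      using Stone_Weierstrass_real_polynomial_function[of "cball 0 (CARD('d))" \<psi> e] e
        continuous_on_subset[OF \<psi>] by auto
    have close: "\<bar>\<psi> (circle_map x) - g (circle_map x)\<bar> < e" for x
      using norm_circle_map[of x] by (intro g(2)) simp
    have intg: "integrable torus (\<lambda>x. f x * of_real (g (circle_map x)))"
      by (intro integrable_mult_trig_fun f trig_fun_polynomial g)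
    have [measurable]: "(\<lambda>x. f x * of_real (g (circle_map x))) \<in> borel_measurable torus"
      using intg by simp
    have m2: "(\<lambda>x. f x * of_real (\<psi> (circle_map x) - g (circle_map x))) \<in> borel_measurable torus"
      by (simp add: right_diff_distrib)
    have bd: "norm (f x * of_real (\<psi> (circle_map x) - g (circle_map x))) \<le> norm (e * cmod (f x))" for x
      using close[of x] e by (simp add: norm_mult mult.commute[of e] mult_left_mono less_imp_le
          del: of_real_diff)
    have intd: "integrable torus (\<lambda>x. f x * of_real (\<psi> (circle_map x) - g (circle_map x)))"
      by (rule Bochner_Integration.integrable_bound[OF _ m2, of "\<lambda>x. e * cmod (f x)"]) (use f bd in auto)
    have "(LINT x|torus. f x * of_real (\<psi> (circle_map x))) =
        (LINT x|torus. f x * of_real (\<psi> (circle_map x) - g (circle_map x)) + f x * of_real (g (circle_map x)))"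
      by (simp add: algebra_simps)
    also have "\<dots> = (LINT x|torus. f x * of_real (\<psi> (circle_map x) - g (circle_map x)))"
      unfolding Bochner_Integration.integral_add[OF intd intg]
      by (simp add: integral_mult_trig_fun_eq_0[OF f trig_fun_polynomial[OF g(1)]])
    also have "cmod \<dots> \<le> (LINT x|torus. e * cmod (f x))"
      using bd e f(1) by (intro Bochner_Integration.integral_norm_bound_integral intd) auto
    also have "\<dots> = e * A" by (simp add: A_def)
    finally show ?thesis .
  qed
  have "cmod (LINT x|torus. f x * of_real (\<psi> (circle_map x))) \<le> 0 + e" if "0 < e" for e
  proof -
    have "e / (A + 1) * A \<le> e" using that A by (simp add: field_simps)
    thus ?thesis using le[of "e / (A + 1)"] that A by simp
  qed
  hence "cmod (LINT x|torus. f x * of_real (\<psi> (circle_map x))) \<le> 0"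
    by (rule field_le_epsilon)
  thus ?thesis by simp
qed

text \<open>
  The indicator of a closed set is the bounded limit of the continuous functions
  \<open>max 0 (1 - n * infdist z C)\<close>.
\<close>

lemma integral_mult_indicator_closed_eq_0:
  fixes f :: "'d::finite tfun" and C :: "(complex^'d) set"
  assumes f: "integrable torus f" "\<And>k. fourier f k = 0" and C: "closed C"
  shows "(LINT x|torus. f x * indicator C (circle_map x)) = 0"
proof (cases "C = {}")
  case False
  define \<psi> where "\<psi> = (\<lambda>n z. max 0 (1 - real n * infdist z C))"
  have cont: "continuous_on UNIV (\<psi> n)" for n
    unfolding \<psi>_def by (intro continuous_intros)
  have lim: "(\<lambda>n. \<psi> n z) \<longlonglongrightarrow> indicator C z" for z
  proof (cases "z \<in> C")
    case True
    thus ?thesis by (simp add: \<psi>_def)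
  next
    case False
    hence pos: "0 < infdist z C" using in_closed_iff_infdist_zero[OF C \<open>C \<noteq> {}\<close>] infdist_nonneg[of z C]
      by (auto simp: less_le)
    have "eventually (\<lambda>n. \<psi> n z = 0) sequentially"
    proof -
      obtain N where N: "1 < real N * infdist z C" using reals_Archimedean3[OF pos] by blast
      have "\<psi> n z = 0" if "N \<le> n" for n
      proof -
        have "real N * infdist z C \<le> real n * infdist z C" using that pos by (intro mult_right_mono) auto
        thus ?thesis using N by (simp add: \<psi>_def)
      qed
      thus ?thesis by (auto simp: eventually_sequentially)
    qed
    thus ?thesis using False by (simp add: tendsto_eventually)
  qed
  note [measurable] = borel_measurable_integrable[OF f(1)]
  have meas [measurable]: "(\<lambda>x. \<psi> n (circle_map x)) \<in> borel_measurable torus" for n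
    by (intro continuous_measurable_torus continuous_on_compose2[OF cont] continuous_circle_map) auto
  have cm [measurable]: "circle_map \<in> borel_measurable torus"
    by (intro continuous_measurable_torus continuous_circle_map)
  have "(\<lambda>n. LINT x|torus. f x * of_real (\<psi> n (circle_map x))) \<longlonglongrightarrow> (LINT x|torus. f x * indicator C (circle_map x))"
  proof (rule integral_dominated_convergence[where w="\<lambda>x. cmod (f x)"])
    have [measurable]: "C \<in> sets borel" using C by simp
    show "(\<lambda>x. f x * indicator C (circle_map x)) \<in> borel_measurable torus" by measurable
    show "integrable torus (\<lambda>x. cmod (f x))" using f by simp
    have "\<psi> n z \<le> 1 \<and> 0 \<le> \<psi> n z" for n z by (auto simp: \<psi>_def infdist_nonneg)
    thus "AE x in torus. norm (f x * of_real (\<psi> n (circle_map x))) \<le> cmod (f x)" for n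
      by (auto simp: norm_mult mult_left_le)
    have "(\<lambda>n. f x * of_real (\<psi> n (circle_map x))) \<longlonglongrightarrow> f x * of_real (indicator C (circle_map x))" for x
      by (intro tendsto_intros lim)
    thus "AE x in torus. (\<lambda>n. f x * of_real (\<psi> n (circle_map x))) \<longlonglongrightarrow> f x * indicator C (circle_map x)"
      by (simp add: of_real_indicator)
  qed measurable
  moreover have "(\<lambda>n. LINT x|torus. f x * of_real (\<psi> n (circle_map x))) = (\<lambda>n. 0)"
    using integral_mult_continuous_eq_0[OF f cont] by simp
  ultimately have "(\<lambda>n::nat. 0) \<longlonglongrightarrow> (LINT x|torus. f x * indicator C (circle_map x))"
    by (simp only:)
  from LIMSEQ_unique[OF this tendsto_const] show ?thesis .
qed simp

lemma AE_torus_box: "AE x::real^'d::finite in torus. x \<in> box 0 (\<chi> j. 2 * pi)"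
proof -
  have "cbox 0 (\<chi> j. 2 * pi) - box 0 (\<chi> j. 2 * pi) \<in> null_sets (lebesgue :: (real^'d) measure)"
    using negligible_frontier_interval by (simp add: negligible_iff_null_sets)
  from AE_not_in[OF this] show ?thesis unfolding AE_torus by eventually_elim auto
qed

lemma inj_on_circle_map: "inj_on circle_map (box 0 (\<chi> j. 2 * pi))"
proof (rule inj_onI)
  fix x y :: "real^'d::finite"
  assume x: "x \<in> box 0 (\<chi> j. 2 * pi)" and y: "y \<in> box 0 (\<chi> j. 2 * pi)" and eq: "circle_map x = circle_map y"
  have "x $ j = y $ j" for j
  proof -
    have "cis (x $ j) = cis (y $ j)" using eq by (simp add: circle_map_def vec_eq_iff)
    hence "\<exists>n::int. \<i> * of_real (x $ j) = \<i> * of_real (y $ j) + (of_int (2 * n) * pi) * \<i>"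
      by (simp add: cis_conv_exp exp_eq)
    then obtain n :: int where "\<i> * of_real (x $ j) = \<i> * of_real (y $ j) + (of_int (2 * n) * pi) * \<i>" by blast
    hence n: "x $ j = y $ j + 2 * of_int n * pi" by (auto simp: complex_eq_iff)
    have bnds: "0 < x $ j" "x $ j < 2 * pi" "0 < y $ j" "y $ j < 2 * pi"
      using x y by (auto simp: mem_box_cart)
    define t where "t = of_int n * pi"
    have "x $ j = y $ j + 2 * t" using n by (simp add: t_def)
    hence "t < 1 * pi" "(- 1) * pi < t" using bnds by linarith+
    hence "real_of_int n < 1" "- 1 < real_of_int n"
      unfolding t_def by (simp_all only: mult_less_cancel_right_pos[OF pi_gt_zero])
    hence "n = 0" by linarith
    thus ?thesis using n by simp
  qed
  thus "x = y" by (simp add: vec_eq_iff)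
qed

text \<open>
  Since \<open>circle_map\<close> is injective on the open period cell, \<open>D\<close> agrees with the preimage of a
  closed set up to the boundary of the cell, a null set.
\<close>

lemma integral_mult_indicator_compact_eq_0:
  fixes f :: "'d::finite tfun"
  assumes f: "integrable torus f" "\<And>k. fourier f k = 0"
    and D: "compact D" "D \<subseteq> box 0 (\<chi> j. 2 * pi)"
  shows "(LINT x|torus. f x * indicator D x) = 0"
proof -
  have cl: "closed (circle_map ` D)"
    using D by (intro compact_imp_closed compact_continuous_image continuous_circle_map)
  have "(LINT x|torus. f x * indicator D x) = (LINT x|torus. f x * indicator (circle_map ` D) (circle_map x))"
  proof (rule integral_cong_AE)
    have [measurable]: "f \<in> borel_measurable torus" using f by simp
    have [measurable]: "D \<in> sets (torus :: (real^'d) measure)" using D by (auto dest: lmeasurable_compact)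
    have [measurable]: "circle_map ` D \<in> sets borel" using cl by simp
    have [measurable]: "(circle_map :: real^'d \<Rightarrow> _) \<in> borel_measurable torus"
      by (intro continuous_measurable_torus continuous_circle_map)
    show "(\<lambda>x. f x * indicator D x) \<in> borel_measurable torus" by measurable
    show "(\<lambda>x. f x * indicator (circle_map ` D) (circle_map x)) \<in> borel_measurable torus" by measurable
    show "AE x in torus. f x * indicator D x = f x * indicator (circle_map ` D) (circle_map x)"
      using AE_torus_box
    proof eventually_elim
      case (elim x)
      have "circle_map x \<in> circle_map ` D \<longleftrightarrow> x \<in> D"
        using elim D(2) inj_on_circle_map by (auto simp: inj_on_def)
      thus ?case by (simp add: indicator_def)
    qed
  qed
  thus ?thesis using integral_mult_indicator_closed_eq_0[OF f cl] by simp
qed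

text \<open>
  Up to a null set, \<open>{x. 0 < u x}\<close> is a countable union of compact sets. A positive function
  with integral zero over a set forces the set to be null.
\<close>

lemma AE_nonpos_if_compact_integrals_zero:
  fixes u :: "real^'d::finite \<Rightarrow> real"
  assumes u: "integrable torus u"
    and z: "\<And>D. compact D \<Longrightarrow> D \<subseteq> box 0 (\<chi> j. 2 * pi) \<Longrightarrow> (LINT x|torus. u x * indicator D x) = 0"
  shows "AE x in torus. u x \<le> 0"
proof -
  let ?B = "box 0 (\<chi> j. 2 * pi) :: (real^'d) set"
  have "u \<in> borel_measurable lebesgue" using borel_measurable_integrable[OF u] by simp
  hence "\<forall>a. {w \<in> space lebesgue. a < u w} \<in> sets lebesgue"
    by (simp only: borel_measurable_iff_greater simp_thms)
  from spec[OF this, of 0] have "{x. 0 < u x} \<in> sets lebesgue"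
    by (simp only: space_completion space_lborel space_borel UNIV_I simp_thms)
  moreover have "?B \<in> sets lebesgue"
    by (rule lmeasurable_box[THEN fmeasurableD])
  ultimately have "?B \<inter> {x. 0 < u x} \<in> sets lebesgue" by (rule sets.Int[rotated])
  also have "?B \<inter> {x. 0 < u x} = {x \<in> ?B. 0 < u x}" by blast
  finally have "{x \<in> ?B. 0 < u x} \<in> sets lebesgue" .
  then obtain C T where C: "fsigma C" and T: "T \<in> null_sets lebesgue" and CT: "C \<union> T = {x \<in> ?B. 0 < u x}"
    by (rule lebesgue_set_almost_fsigma)
  from C obtain F :: "nat \<Rightarrow> (real^'d) set" where F: "\<And>n. closed (F n)" "C = \<Union> (range F)"
    by (cases rule: fsigma.cases) auto
  have "AE x in torus. x \<notin> F n" for n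
  proof -
    have sub: "F n \<subseteq> {x \<in> ?B. 0 < u x}" using F CT by auto
    have "bounded (F n)" by (rule bounded_subset[OF bounded_box[of 0 "\<chi> j. 2 * pi"]]) (use sub in auto)
    hence cp: "compact (F n)" using F by (simp add: compact_eq_bounded_closed)
    have Fn: "F n \<in> sets (torus :: (real^'d) measure)" using cp by (auto dest: lmeasurable_compact)
    have nn: "0 \<le> u x * indicator (F n) x" for x using sub by (auto simp: indicator_def intro: less_imp_le)
    have "integrable torus (\<lambda>x. u x * indicator (F n) x)"
      using u Fn by (rule integrable_real_mult_indicator[rotated])
    moreover have "(LINT x|torus. u x * indicator (F n) x) = 0"
      using cp sub by (intro z) auto
    ultimately have "AE x in torus. u x * indicator (F n) x = 0"
      using nn by (subst (asm) integral_nonneg_eq_0_iff_AE) auto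
    thus ?thesis by eventually_elim (use sub in auto)
  qed
  hence "AE x in torus. \<forall>n. x \<notin> F n" by (simp add: AE_all_countable)
  moreover have "AE x in torus. x \<notin> T" unfolding AE_torus using AE_not_in[OF T] by eventually_elim auto
  ultimately show ?thesis using AE_torus_box
  proof eventually_elim
    case (elim x)
    hence "x \<notin> C \<union> T" using F by auto
    thus ?case using CT elim by auto
  qed
qed

theorem fourier_uniqueness:
  fixes f :: "'d::finite tfun"
  assumes f: "integrable torus f" "\<And>k. fourier f k = 0"
  shows "AE x in torus. f x = 0"
proof -
  have z: "(LINT x|torus. f x * indicator D x) = 0" "integrable torus (\<lambda>x. f x * indicator D x)"
    if "compact D" "D \<subseteq> box 0 (\<chi> j. 2 * pi)" for D
  proof -
    show "(LINT x|torus. f x * indicator D x) = 0"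
      by (rule integral_mult_indicator_compact_eq_0[OF f that])
    have [measurable]: "D \<in> sets (torus :: (real^'d) measure)" using that by (auto dest: lmeasurable_compact)
    have [measurable]: "f \<in> borel_measurable torus" using f by simp
    show "integrable torus (\<lambda>x. f x * indicator D x)"
      by (rule Bochner_Integration.integrable_bound[OF f(1)]) (auto simp: indicator_def)
  qed
  have Re: "(LINT x|torus. Re (f x) * indicator D x) = 0" "(LINT x|torus. Im (f x) * indicator D x) = 0"
    if "compact D" "D \<subseteq> box 0 (\<chi> j. 2 * pi)" for D
  proof -
    have "Re (f x * indicator D x) = Re (f x) * indicator D x" "Im (f x * indicator D x) = Im (f x) * indicator D x" for x
      by (auto simp: indicator_def)
    thus "(LINT x|torus. Re (f x) * indicator D x) = 0" "(LINT x|torus. Im (f x) * indicator D x) = 0"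
      using integral_Re[OF z(2)[OF that]] integral_Im[OF z(2)[OF that]] z(1)[OF that] by simp_all
  qed
  have i: "integrable torus (\<lambda>x. Re (f x))" "integrable torus (\<lambda>x. Im (f x))" using f by auto
  have "AE x in torus. Re (f x) \<le> 0" "AE x in torus. - Re (f x) \<le> 0"
    "AE x in torus. Im (f x) \<le> 0" "AE x in torus. - Im (f x) \<le> 0"
    using i Re by (auto intro!: AE_nonpos_if_compact_integrals_zero simp del: neg_le_0_iff_le)
  thus ?thesis by eventually_elim (simp add: complex_eq_iff)
qed

section \<open>Dyadic blocks and layers\<close>

definition layer_freqs :: "nat \<Rightarrow> (int^'d::finite) set" where
  "layer_freqs l = (\<Union>s\<in>levels l. rho s)"

lemma rho_iff:
  "k \<in> rho s \<longleftrightarrow> (\<forall>j. \<bar>k $ j\<bar> < 2 ^ (s $ j) \<and> (s $ j = 0 \<or> 2 ^ (s $ j - 1) \<le> \<bar>k $ j\<bar>))"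
proof -
  have fl: "\<lfloor>2 powr (real n - 1)\<rfloor> = (if n = 0 then 0 else 2 ^ (n - 1))" for n
  proof (cases n)
    case 0
    have "\<lfloor>2 powr (- 1 :: real)\<rfloor> = 0" by (simp add: powr_minus floor_eq_iff)
    thus ?thesis using 0 by simp
  next
    case (Suc n')
    have "2 powr (real n - 1) = real_of_int (2 ^ n')" using Suc by (simp add: powr_realpow)
    thus ?thesis using Suc by (simp only: floor_of_int) simp
  qed
  have "\<lfloor>2 powr (real n - 1)\<rfloor> \<le> \<bar>a\<bar> \<and> \<bar>a\<bar> < 2 ^ n \<longleftrightarrow>
      \<bar>a\<bar> < 2 ^ n \<and> (n = 0 \<or> 2 ^ (n - 1) \<le> \<bar>a\<bar>)" for n and a :: int
    unfolding fl by auto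
  thus ?thesis unfolding rho_def by (simp only: mem_Collect_eq)
qed

lemma ex_dyadic:
  fixes a :: int
  shows "\<exists>!n. \<bar>a\<bar> < 2 ^ n \<and> (n = 0 \<or> 2 ^ (n - 1) \<le> \<bar>a\<bar>)"
proof -
  define n where "n = (LEAST n. \<bar>a\<bar> < 2 ^ n)"
  have ex: "\<bar>a\<bar> < 2 ^ nat \<bar>a\<bar>"
    using of_nat_less_two_power[of "nat \<bar>a\<bar>", where 'a=int] by simp
  have n: "\<bar>a\<bar> < 2 ^ n" unfolding n_def by (rule LeastI[of "\<lambda>n. \<bar>a\<bar> < 2 ^ n", OF ex])
  have h1: "2 ^ (n - 1) \<le> \<bar>a\<bar>" if "n \<noteq> 0"
  proof -
    have "\<not> \<bar>a\<bar> < 2 ^ (n - 1)"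
      unfolding n_def by (rule not_less_Least[of _ "\<lambda>n. \<bar>a\<bar> < 2 ^ n"]) (use that n_def in simp)
    thus ?thesis by simp
  qed
  have h2: "m = n" if m: "\<bar>a\<bar> < 2 ^ m" "m = 0 \<or> 2 ^ (m - 1) \<le> \<bar>a\<bar>" for m
  proof (rule antisym)
    show "n \<le> m" unfolding n_def by (rule Least_le[of "\<lambda>n. \<bar>a\<bar> < 2 ^ n", OF m(1)])
    show "m \<le> n"
    proof (rule ccontr)
      assume "\<not> m \<le> n"
      hence "n \<le> m - 1" "m \<noteq> 0" by auto
      hence "(2::int) ^ n \<le> 2 ^ (m - 1)" by (intro power_increasing) auto
      moreover have "2 ^ (m - 1) \<le> \<bar>a\<bar>" using m(2) \<open>m \<noteq> 0\<close> by blast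
      ultimately show False using n by linarith
    qed
  qed
  show ?thesis
  proof (rule ex1I[of _ n])
    show "\<bar>a\<bar> < 2 ^ n \<and> (n = 0 \<or> 2 ^ (n - 1) \<le> \<bar>a\<bar>)" using n h1 by (cases "n = 0") simp_all
  qed (use h2 in blast)
qed

lemma ex_rho: "\<exists>!s. k \<in> rho s"
proof -
  have "\<forall>j. \<exists>!n. \<bar>k $ j\<bar> < 2 ^ n \<and> (n = 0 \<or> 2 ^ (n - 1) \<le> \<bar>k $ j\<bar>)" by (intro allI ex_dyadic)
  then obtain s where s: "\<And>j. \<bar>k $ j\<bar> < 2 ^ s j \<and> (s j = 0 \<or> 2 ^ (s j - 1) \<le> \<bar>k $ j\<bar>)"
    "\<And>j n. \<bar>k $ j\<bar> < 2 ^ n \<and> (n = 0 \<or> 2 ^ (n - 1) \<le> \<bar>k $ j\<bar>) \<Longrightarrow> n = s j"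
    by metis
  show ?thesis
  proof (rule ex1I[of _ "\<chi> j. s j"])
    show "k \<in> rho (\<chi> j. s j)" using s(1) by (simp add: rho_iff)
    show "s' = (\<chi> j. s j)" if "k \<in> rho s'" for s'
      using that s(2) by (simp add: rho_iff vec_eq_iff)
  qed
qed

lemma rho_disjoint: "k \<in> rho s \<Longrightarrow> k \<in> rho t \<Longrightarrow> s = t"
  using ex_rho by blast

lemma finite_layer_freqs [simp]: "finite (layer_freqs l)"
  unfolding layer_freqs_def by (intro finite_UN_I finite_levels finite_rho)

lemma layer_freqs_disjoint: "k \<in> layer_freqs l \<Longrightarrow> k \<in> layer_freqs l' \<Longrightarrow> l = l'"
  unfolding layer_freqs_def levels_def using rho_disjoint by fastforce

lemma ex_layer_freqs: "\<exists>l. k \<in> layer_freqs l"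
  unfolding layer_freqs_def levels_def using ex_rho by blast

lemma sum_layer_freqs:
  "(\<Sum>k\<in>layer_freqs l. h k) = (\<Sum>s\<in>levels l. \<Sum>k\<in>rho s. h k)"
  unfolding layer_freqs_def
  by (intro sum.UNION_disjoint finite_levels) (auto simp: finite_rho dest: rho_disjoint)

lemma delta_eq: "delta s f = tpoly (rho s) (fourier f)"
  by (auto simp: delta_def tpoly_def)

lemma layer_eq: "layer l f = tpoly (layer_freqs l) (fourier f)"
  by (auto simp: layer_def delta_eq tpoly_def sum_layer_freqs)

lemma tpoly_UNION:
  assumes "finite I" "\<And>i. i \<in> I \<Longrightarrow> finite (F i)"
    "\<And>i j. i \<in> I \<Longrightarrow> j \<in> I \<Longrightarrow> i \<noteq> j \<Longrightarrow> F i \<inter> F j = {}"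
  shows "(\<Sum>i\<in>I. tpoly (F i) c x) = tpoly (\<Union>i\<in>I. F i) c x"
  unfolding tpoly_def using assms by (subst sum.UNION_disjoint) auto

lemma sum_layers_eq:
  assumes "finite I"
  shows "(\<Sum>l\<in>I. layer l f x) = tpoly (\<Union>l\<in>I. layer_freqs l) (fourier f) x"
  unfolding layer_eq using assms by (intro tpoly_UNION) (auto dest: layer_freqs_disjoint)

text \<open>
  One coordinate is determined by the others; this is the source of the exponent \<open>d - 1\<close> of the
  logarithm.
\<close>

lemma card_levels_le: "card (levels l :: (nat^'d::finite) set) \<le> (l + 1) ^ (CARD('d) - 1)"
proof -
  obtain i :: 'd where True by simp
  let ?r = "\<lambda>s::nat^'d. restrict (vec_nth s) (UNIV - {i})"
  have inj: "inj_on ?r (levels l)"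
  proof (rule inj_onI)
    fix s t :: "nat^'d" assume st: "s \<in> levels l" "t \<in> levels l" "?r s = ?r t"
    have eq: "s $ j = t $ j" if "j \<noteq> i" for j
      using fun_cong[OF st(3), of j] that by simp
    have "l = s $ i + (\<Sum>j\<in>UNIV - {i}. s $ j)" "l = t $ i + (\<Sum>j\<in>UNIV - {i}. t $ j)"
      using st by (simp_all add: levels_def sum.remove[symmetric])
    moreover have "(\<Sum>j\<in>UNIV - {i}. s $ j) = (\<Sum>j\<in>UNIV - {i}. t $ j)"
      by (intro sum.cong) (auto simp: eq)
    ultimately have "s $ i = t $ i" by simp
    thus "s = t" using eq by (metis vec_eq_iff)
  qed
  have "?r ` levels l \<subseteq> PiE (UNIV - {i}) (\<lambda>_. {..l})"
  proof -
    have "s $ j \<le> l" if "s \<in> levels l" for s :: "nat^'d" and j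
      using that member_le_sum[of j UNIV "vec_nth s"] by (simp add: levels_def)
    thus ?thesis by (intro image_subsetI) (simp add: restrict_PiE_iff)
  qed
  hence "card (?r ` levels l) \<le> card (PiE (UNIV - {i}) (\<lambda>_. {..l}))"
    by (intro card_mono finite_PiE) auto
  thus ?thesis using inj by (simp add: card_image card_PiE)
qed

lemma card_vec_set:
  fixes F :: "'d::finite \<Rightarrow> 'a set"
  shows "card {v :: 'a^'d. \<forall>j. v $ j \<in> F j} = (\<Prod>j\<in>UNIV. card (F j))"
proof -
  have "bij_betw vec_lambda (PiE UNIV F) {v :: 'a^'d. \<forall>j. v $ j \<in> F j}"
    by (rule bij_betwI[where g=vec_nth]) auto
  thus ?thesis using bij_betw_same_card card_PiE[of UNIV F] by force
qed

lemma prod_two_power_levels: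
  "s \<in> levels l \<Longrightarrow> (\<Prod>j\<in>UNIV. 2 ^ (s $ j) :: 'a::comm_semiring_1) = 2 ^ l"
  by (simp add: levels_def power_sum[symmetric])

lemma card_rho_le:
  assumes "s \<in> levels l"
  shows "card (rho s :: (int^'d::finite) set) \<le> 2 ^ CARD('d) * 2 ^ l"
proof -
  have "rho s \<subseteq> {k :: int^'d. \<forall>j. k $ j \<in> {- (2 ^ (s $ j)) <..< 2 ^ (s $ j)}}"
  proof clarify
    fix k :: "int^'d" and j assume "k \<in> rho s"
    hence "\<bar>k $ j\<bar> < 2 ^ (s $ j)" by (simp add: rho_iff)
    thus "k $ j \<in> {- (2 ^ (s $ j)) <..< 2 ^ (s $ j)}"
      unfolding greaterThanLessThan_iff by linarith
  qed
  hence "card (rho s) \<le> card {k :: int^'d. \<forall>j. k $ j \<in> {- (2 ^ (s $ j)) <..< 2 ^ (s $ j)}}"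
    by (intro card_mono finite_vec_set) auto
  also have "\<dots> = (\<Prod>j\<in>UNIV. card {- (2 ^ (s $ j) :: int) <..< 2 ^ (s $ j)})"
    by (rule card_vec_set)
  also have "\<dots> \<le> (\<Prod>j\<in>(UNIV::'d set). 2 * 2 ^ (s $ j))"
    by (intro prod_mono) (auto simp: nat_le_iff)
  also have "\<dots> = 2 ^ CARD('d) * 2 ^ l"
    by (simp add: prod.distrib prod_two_power_levels[OF assms])
  finally show ?thesis .
qed

lemma card_layer_freqs_le:
  "card (layer_freqs l :: (int^'d::finite) set) \<le> 2 ^ CARD('d) * 2 ^ l * (l + 1) ^ (CARD('d) - 1)"
proof -
  have "card (layer_freqs l :: (int^'d) set) \<le> (\<Sum>s\<in>(levels l :: (nat^'d) set). card (rho s :: (int^'d) set))"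
    unfolding layer_freqs_def by (rule card_UN_le[OF finite_levels])
  also have "\<dots> \<le> (\<Sum>s\<in>(levels l :: (nat^'d) set). 2 ^ CARD('d) * 2 ^ l)"
    by (intro sum_mono card_rho_le)
  also have "\<dots> = card (levels l :: (nat^'d) set) * (2 ^ CARD('d) * 2 ^ l)"
    by (simp only: sum_constant of_nat_id)
  also have "\<dots> \<le> (l + 1) ^ (CARD('d) - 1) * (2 ^ CARD('d) * 2 ^ l)"
    by (intro mult_right_mono card_levels_le) auto
  finally show ?thesis by (simp add: mult_ac)
qed

lemma uminus_rho: "- k \<in> rho s \<longleftrightarrow> k \<in> rho s"
  by (simp add: rho_iff)

lemma uminus_layer_freqs: "uminus ` layer_freqs l = layer_freqs l"
proof -
  have "- k \<in> layer_freqs l" if "k \<in> layer_freqs l" for k :: "int^'d"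
    using that by (auto simp: layer_freqs_def uminus_rho)
  thus ?thesis by (metis (no_types, lifting) image_subset_iff minus_minus subsetI subset_antisym image_eqI)
qed

section \<open>Zero sums of frequencies and norms of layer polynomials\<close>

abbreviation zero_sums :: "nat \<Rightarrow> (nat \<Rightarrow> 'a::comm_monoid_add set) \<Rightarrow> (nat \<Rightarrow> 'a) set" where
  "zero_sums R Q \<equiv> {\<kappa> \<in> PiE {..<R} Q. (\<Sum>i<R. \<kappa> i) = 0}"

abbreviation coord_max :: "nat \<Rightarrow> (nat \<Rightarrow> nat^'d::finite) \<Rightarrow> 'd \<Rightarrow> nat" where
  "coord_max R \<sigma> j \<equiv> Max ((\<lambda>i. \<sigma> i $ j) ` {..<R})"

text \<open>
  In a zero sum the \<open>i\<close>-th term is determined by the others, so the count gains a factor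
  \<open>2 ^ s i\<close>. It is used for the longest interval, where the gain is largest.
\<close>

lemma card_zero_sum_interval:
  fixes s :: "nat \<Rightarrow> nat"
  assumes "i < R"
  shows "real (card {v \<in> PiE {..<R} (\<lambda>i. {- (2 ^ s i) <..< 2 ^ s i :: int}). (\<Sum>i<R. v i) = 0})
    \<le> 2 ^ R * (\<Prod>i<R. 2 ^ s i) / 2 ^ s i"
proof -
  let ?I = "\<lambda>i. {- (2 ^ s i) <..< 2 ^ s i :: int}"
  let ?V = "{v \<in> PiE {..<R} ?I. (\<Sum>i<R. v i) = 0}"
  let ?r = "\<lambda>v. restrict v ({..<R} - {i})"
  have inj: "inj_on ?r ?V"
  proof (rule inj_onI)
    fix v w assume v: "v \<in> ?V" and w: "w \<in> ?V" and eq: "?r v = ?r w"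
    have j: "v j = w j" if "j \<in> {..<R} - {i}" for j
      using fun_cong[OF eq, of j] that by (simp only: restrict_apply' )
    have "v i + (\<Sum>j\<in>{..<R} - {i}. v j) = 0" "w i + (\<Sum>j\<in>{..<R} - {i}. w j) = 0"
      using v w assms by (simp_all add: sum.remove[symmetric])
    moreover have "(\<Sum>j\<in>{..<R} - {i}. v j) = (\<Sum>j\<in>{..<R} - {i}. w j)"
      by (intro sum.cong) (auto simp: j)
    ultimately have "v i = w i" by simp
    with j have jj: "v j = w j" if "j \<in> {..<R}" for j using that by (cases "j = i") auto
    have "v \<in> PiE {..<R} ?I" "w \<in> PiE {..<R} ?I" using v w by auto
    thus "v = w" using jj by (rule PiE_ext)
  qed
  have "card ?V = card (?r ` ?V)" by (rule card_image[OF inj, symmetric])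
  also have "\<dots> \<le> card (PiE ({..<R} - {i}) ?I)"
  proof (intro card_mono finite_PiE)
    show "?r ` ?V \<subseteq> PiE ({..<R} - {i}) ?I"
    proof
      fix u assume "u \<in> ?r ` ?V"
      then obtain v where v: "v \<in> PiE {..<R} ?I" "u = ?r v" by blast
      have "\<forall>j\<in>{..<R} - {i}. v j \<in> ?I j" using PiE_mem[OF v(1)] by blast
      thus "u \<in> PiE ({..<R} - {i}) ?I" unfolding v(2) restrict_PiE_iff .
    qed
  qed simp_all
  also have "\<dots> = (\<Prod>j\<in>{..<R} - {i}. card (?I j))" by (simp add: card_PiE)
  also have "\<dots> \<le> (\<Prod>j\<in>{..<R} - {i}. 2 * 2 ^ s j)"
    by (intro prod_mono) (auto simp: nat_le_iff)
  finally have "real (card ?V) \<le> real (\<Prod>j\<in>{..<R} - {i}. 2 * 2 ^ s j)" by (simp only: of_nat_le_iff)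
  also have "\<dots> = (\<Prod>j\<in>{..<R} - {i}. 2 * 2 ^ s j)" by simp
  also have "\<dots> = (\<Prod>j<R. 2 * 2 ^ s j) / (2 * 2 ^ s i)"
    using assms by (subst prod.remove[of "{..<R}" i]) auto
  also have "\<dots> \<le> (\<Prod>j<R. 2 * 2 ^ s j) / 2 ^ s i"
    by (intro divide_left_mono) (auto intro!: prod_nonneg prod_pos)
  finally show ?thesis by (simp add: prod.distrib)
qed

text \<open>
  The coordinates are counted independently, each gaining from its own longest interval.
\<close>

lemma card_zero_sum_rho:
  fixes \<sigma> :: "nat \<Rightarrow> nat^'d::finite"
  assumes R: "0 < R" and \<sigma>: "\<And>i. i < R \<Longrightarrow> \<sigma> i \<in> levels l"
  shows "real (card (zero_sums R (\<lambda>i. rho (\<sigma> i))))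
    \<le> 2 ^ (R * CARD('d)) * 2 ^ (l * R) / 2 ^ (\<Sum>j\<in>UNIV. coord_max R \<sigma> j)"
proof -
  let ?M = "\<lambda>j. coord_max R \<sigma> j"
  let ?K = "(zero_sums R (\<lambda>i. rho (\<sigma> i)))"
  let ?I = "\<lambda>j i. {- (2 ^ (\<sigma> i $ j)) <..< 2 ^ (\<sigma> i $ j) :: int}"
  define V where "V = (\<lambda>j. {v \<in> PiE {..<R} (?I j). (\<Sum>i<R. v i) = 0})"
  have finV: "finite (V j)" for j unfolding V_def by (rule finite_Collect_conjI) (simp add: finite_PiE)
  define \<Phi> where "\<Phi> = (\<lambda>(\<kappa> :: nat \<Rightarrow> int^'d) j. restrict (\<lambda>i. \<kappa> i $ j) {..<R})"
  have inj: "inj_on \<Phi> ?K"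
  proof (rule inj_onI)
    fix \<kappa> \<mu> assume k: "\<kappa> \<in> ?K" and m: "\<mu> \<in> ?K" and eq: "\<Phi> \<kappa> = \<Phi> \<mu>"
    have jj: "\<kappa> i = \<mu> i" if "i \<in> {..<R}" for i
    proof -
      have "\<kappa> i $ j = \<mu> i $ j" for j using fun_cong[OF fun_cong[OF eq, of j], of i] that by (simp add: \<Phi>_def)
      thus ?thesis by (simp add: vec_eq_iff)
    qed
    have "\<kappa> \<in> PiE {..<R} (\<lambda>i. rho (\<sigma> i))" "\<mu> \<in> PiE {..<R} (\<lambda>i. rho (\<sigma> i))" using k m by auto
    thus "\<kappa> = \<mu>" using jj by (rule PiE_ext)
  qed
  have sub: "\<Phi> ` ?K \<subseteq> PiE UNIV V"
  proof
    fix u assume "u \<in> \<Phi> ` ?K"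
    then obtain \<kappa> where \<kappa>: "\<kappa> \<in> PiE {..<R} (\<lambda>i. rho (\<sigma> i))" "(\<Sum>i<R. \<kappa> i) = 0" "u = \<Phi> \<kappa>" by blast
    have "\<Phi> \<kappa> j \<in> V j" for j
    proof -
      have "\<kappa> i $ j \<in> ?I j i" if "i < R" for i
      proof -
        have "\<kappa> i \<in> rho (\<sigma> i)" using PiE_mem[OF \<kappa>(1)] that by simp
        hence "\<bar>\<kappa> i $ j\<bar> < 2 ^ (\<sigma> i $ j)" by (simp add: rho_iff)
        thus ?thesis unfolding greaterThanLessThan_iff by linarith
      qed
      moreover have "(\<Sum>i<R. \<kappa> i $ j) = 0"
        using arg_cong[OF \<kappa>(2), of "\<lambda>v. v $ j"] by simp
      ultimately show ?thesis unfolding V_def \<Phi>_def mem_Collect_eq restrict_PiE_iff by simp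
    qed
    thus "u \<in> PiE UNIV V" using \<kappa>(3) by (simp add: PiE_iff)
  qed
  have cV: "real (card (V j)) \<le> 2 ^ R * (\<Prod>i<R. 2 ^ (\<sigma> i $ j)) / 2 ^ ?M j" for j
  proof -
    have "?M j \<in> (\<lambda>i. \<sigma> i $ j) ` {..<R}" using R by (intro Max_in) auto
    then obtain i where "i < R" "?M j = \<sigma> i $ j" by auto
    thus ?thesis using card_zero_sum_interval[of i R "\<lambda>i. \<sigma> i $ j"] unfolding V_def by simp
  qed
  have "card ?K = card (\<Phi> ` ?K)" by (rule card_image[OF inj, symmetric])
  also have "\<dots> \<le> card (PiE UNIV V)" by (intro card_mono sub finite_PiE finV) simp
  also have "\<dots> = (\<Prod>j\<in>UNIV. card (V j))" by (rule card_PiE) simp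
  finally have "real (card ?K) \<le> real (\<Prod>j\<in>UNIV. card (V j))" by (simp only: of_nat_le_iff)
  also have "\<dots> = (\<Prod>j\<in>UNIV. real (card (V j)))" by simp
  also have "\<dots> \<le> (\<Prod>j\<in>UNIV. 2 ^ R * (\<Prod>i<R. 2 ^ (\<sigma> i $ j)) / 2 ^ ?M j)"
    using cV by (intro prod_mono) auto
  also have "\<dots> = (2 ^ R) ^ CARD('d) * (\<Prod>j\<in>UNIV. \<Prod>i<R. 2 ^ (\<sigma> i $ j)) / (\<Prod>j\<in>UNIV. 2 ^ ?M j)"
    by (simp add: prod.distrib prod_dividef)
  also have "(\<Prod>j\<in>UNIV. \<Prod>i<R. 2 ^ (\<sigma> i $ j) :: real) = (\<Prod>i<R. \<Prod>j\<in>UNIV. 2 ^ (\<sigma> i $ j))"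
    by (rule prod.swap)
  also have "\<dots> = (\<Prod>i<R. 2 ^ l)" using prod_two_power_levels[OF \<sigma>] by (intro prod.cong) auto
  finally show ?thesis by (simp add: power_sum power_mult)
qed

text \<open>
  The difference of \<open>M\<close> and \<open>s\<close> has nonnegative entries with sum \<open>e\<close>.
\<close>

lemma card_levels_below:
  fixes M :: "nat^'d::finite"
  assumes "M \<in> levels (l + e)"
  shows "card {s \<in> levels l. \<forall>j. s $ j \<le> M $ j} \<le> (e + 1) ^ CARD('d)"
proof -
  let ?S = "{s \<in> levels l. \<forall>j. s $ j \<le> M $ j}"
  let ?h = "\<lambda>s. \<chi> j. M $ j - s $ j"
  have inj: "inj_on ?h ?S"
  proof (rule inj_onI)
    fix s t assume s: "s \<in> ?S" and t: "t \<in> ?S" and eq: "?h s = ?h t"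
    have "s $ j = t $ j" for j
    proof -
      have "M $ j - s $ j = M $ j - t $ j" using eq by (simp add: vec_eq_iff)
      moreover have "s $ j \<le> M $ j" "t $ j \<le> M $ j" using s t by auto
      ultimately show ?thesis by linarith
    qed
    thus "s = t" by (simp add: vec_eq_iff)
  qed
  have "?h ` ?S \<subseteq> {v. \<forall>j. v $ j \<in> {..e}}"
  proof (intro image_subsetI CollectI allI)
    fix s j assume s: "s \<in> ?S"
    have "(\<Sum>j\<in>UNIV. M $ j - s $ j) = (\<Sum>j\<in>UNIV. M $ j) - (\<Sum>j\<in>UNIV. s $ j)"
      using s by (intro sum_subtractf_nat) auto
    also have "\<dots> = e" using s assms by (simp add: levels_def)
    finally have "M $ j - s $ j \<le> e" using member_le_sum[of j UNIV "\<lambda>j. M $ j - s $ j"] by simp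
    thus "(\<chi> j. M $ j - s $ j) $ j \<in> {..e}" by simp
  qed
  hence "card (?h ` ?S) \<le> card {v :: nat^'d. \<forall>j. v $ j \<in> {..e}}"
    by (intro card_mono finite_vec_set) auto
  also have "\<dots> = (e + 1) ^ CARD('d)" by (subst card_vec_set) simp
  finally show ?thesis using card_image[OF inj] by simp
qed

lemma summable_power_over_two_power: "summable (\<lambda>e::nat. real (e + 1) ^ k / 2 ^ e)"
proof (rule summable_comparison_test_bigo[where g="\<lambda>e. inverse (real e ^ 2)"])
  show "summable (\<lambda>n. norm (inverse (real n ^ 2)))" using inverse_power_summable[of 2, where 'a=real] by simp
  have "(\<lambda>e::nat. (real e + 1) powr real k / 2 ^ e) \<in> O(\<lambda>e. inverse (real e ^ 2))" by real_asymp
  also have "(\<lambda>e::nat. (real e + 1) powr real k / 2 ^ e) = (\<lambda>e. real (e + 1) ^ k / 2 ^ e)"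
    by (simp add: powr_realpow[symmetric] add.commute)
  finally show "(\<lambda>e::nat. real (e + 1) ^ k / 2 ^ e) \<in> O(\<lambda>e. inverse (real e ^ 2))" .
qed

text \<open>
  The tuples are grouped by their coordinatewise maximum \<open>\<mu>\<close>, whose entries have a sum \<open>l + e\<close>
  with \<open>e \<ge> 0\<close>. At most \<open>(e + 1) ^ (d * R)\<close> tuples share a given maximum, there are at most
  \<open>(l + e + 1) ^ (d - 1)\<close> maxima, and the factor \<open>2 ^ e\<close> in the denominator beats these
  polynomials in \<open>e\<close>. Hence the sum has the size of its part \<open>e = 0\<close>, where all entries of the
  tuple coincide: the power of \<open>l + 1\<close> is \<open>d - 1\<close> although the tuples number about
  \<open>(l + 1) ^ ((d - 1) * R)\<close>.
\<close>

lemma sum_max_levels: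
  fixes R :: nat
  assumes R: "0 < R"
  shows "\<exists>C>0. \<forall>l. (\<Sum>\<sigma>\<in>PiE {..<R} (\<lambda>_. levels l :: (nat^'d::finite) set).
      1 / 2 ^ (\<Sum>j\<in>UNIV. coord_max R \<sigma> j))
    \<le> C * real (l + 1) ^ (CARD('d) - 1) / 2 ^ l"
proof -
  let ?D = "CARD('d)"
  define h where "h = (\<lambda>e::nat. real (e + 1) ^ (?D - 1 + ?D * R) / 2 ^ e)"
  have h0: "0 \<le> h e" for e by (simp add: h_def)
  have sumh: "summable h" unfolding h_def by (rule summable_power_over_two_power)
  define C where "C = suminf h"
  have C: "0 < C" unfolding C_def
    using sumh by (intro suminf_pos) (simp_all add: h_def)
  have "(\<Sum>\<sigma>\<in>PiE {..<R} (\<lambda>_. levels l :: (nat^'d) set).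
      1 / 2 ^ (\<Sum>j\<in>UNIV. coord_max R \<sigma> j))
    \<le> C * real (l + 1) ^ (?D - 1) / 2 ^ l" for l
  proof -
    let ?P = "PiE {..<R} (\<lambda>_. levels l :: (nat^'d) set)"
    define M where "M = (\<lambda>\<sigma> :: nat \<Rightarrow> nat^'d. \<chi> j. coord_max R \<sigma> j)"
    define w where "w = (\<lambda>\<mu> :: nat^'d. \<Sum>j\<in>UNIV. \<mu> $ j)"
    have finP: "finite ?P" by (intro finite_PiE finite_levels) simp
    have le_M: "\<sigma> i $ j \<le> M \<sigma> $ j" if "i < R" for \<sigma> i j
      using that unfolding M_def by simp
    have M_range: "M ` ?P \<subseteq> (\<Union>e\<in>{..?D * l}. levels (l + e))"
    proof (rule image_subsetI)
      fix \<sigma> assume \<sigma>: "\<sigma> \<in> ?P"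
      have lev: "\<sigma> i \<in> levels l" if "i < R" for i using PiE_mem[OF \<sigma>, of i] that by simp
      have "M \<sigma> $ j \<le> l" for j
      proof -
        have "M \<sigma> $ j \<in> (\<lambda>i. \<sigma> i $ j) ` {..<R}" unfolding M_def using R by (auto intro!: Max_in)
        then obtain i where i: "i < R" "M \<sigma> $ j = \<sigma> i $ j" by auto
        have "\<sigma> i $ j \<le> (\<Sum>j\<in>UNIV. \<sigma> i $ j)" by (rule member_le_sum) auto
        thus ?thesis using i lev[OF i(1)] by (simp add: levels_def)
      qed
      hence "w (M \<sigma>) \<le> ?D * l" unfolding w_def using sum_bounded_above[of UNIV "\<lambda>j. M \<sigma> $ j" l] by simp
      moreover have "l \<le> w (M \<sigma>)"
      proof -
        have "l = (\<Sum>j\<in>UNIV. \<sigma> 0 $ j)" using lev[OF R] by (simp add: levels_def)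
        also have "\<dots> \<le> w (M \<sigma>)" unfolding w_def by (intro sum_mono le_M R)
        finally show ?thesis .
      qed
      ultimately have "w (M \<sigma>) - l \<in> {..?D * l}" "M \<sigma> \<in> levels (l + (w (M \<sigma>) - l))"
        by (auto simp: levels_def w_def)
      thus "M \<sigma> \<in> (\<Union>e\<in>{..?D * l}. levels (l + e))" by blast
    qed
    have fib: "real (card {\<sigma> \<in> ?P. M \<sigma> = \<mu>}) \<le> real (e + 1) ^ (?D * R)" if "\<mu> \<in> levels (l + e)" for \<mu> e
    proof -
      let ?S = "{s \<in> levels l. \<forall>j. s $ j \<le> \<mu> $ j}"
      have "{\<sigma> \<in> ?P. M \<sigma> = \<mu>} \<subseteq> PiE {..<R} (\<lambda>_. ?S)"
      proof
        fix \<sigma> assume \<sigma>: "\<sigma> \<in> {\<sigma> \<in> ?P. M \<sigma> = \<mu>}"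
        hence "\<sigma> \<in> extensional {..<R}" "\<forall>i\<in>{..<R}. \<sigma> i \<in> ?S"
          using le_M by (auto simp: PiE_iff)
        thus "\<sigma> \<in> PiE {..<R} (\<lambda>_. ?S)" by (simp add: PiE_iff)
      qed
      hence "card {\<sigma> \<in> ?P. M \<sigma> = \<mu>} \<le> card (PiE {..<R} (\<lambda>_. ?S))"
        by (intro card_mono finite_PiE finite_subset[OF _ finite_levels]) auto
      also have "\<dots> = card ?S ^ R" by (simp add: card_PiE)
      also have "\<dots> \<le> ((e + 1) ^ ?D) ^ R" by (intro power_mono card_levels_below that) simp
      finally have "real (card {\<sigma> \<in> ?P. M \<sigma> = \<mu>}) \<le> real (((e + 1) ^ ?D) ^ R)" by (simp only: of_nat_le_iff)
      thus ?thesis by (simp add: power_mult)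
    qed
    have "(\<Sum>\<sigma>\<in>?P. 1 / 2 ^ w (M \<sigma>)) = (\<Sum>\<mu>\<in>M ` ?P. \<Sum>\<sigma>\<in>{\<sigma> \<in> ?P. M \<sigma> = \<mu>}. 1 / 2 ^ w (M \<sigma>))"
      by (rule sum.image_gen[OF finP])
    also have "\<dots> = (\<Sum>\<mu>\<in>M ` ?P. real (card {\<sigma> \<in> ?P. M \<sigma> = \<mu>}) / 2 ^ w \<mu>)"
      by (intro sum.cong refl) simp
    also have "\<dots> \<le> (\<Sum>\<mu>\<in>(\<Union>e\<in>{..?D * l}. levels (l + e)). real (card {\<sigma> \<in> ?P. M \<sigma> = \<mu>}) / 2 ^ w \<mu>)"
      using M_range by (intro sum_mono2) (auto simp: finite_levels)
    also have "\<dots> = (\<Sum>e\<le>?D * l. \<Sum>\<mu>\<in>levels (l + e). real (card {\<sigma> \<in> ?P. M \<sigma> = \<mu>}) / 2 ^ w \<mu>)"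
    proof (rule sum.UNION_disjoint)
      show "\<forall>e\<in>{..?D * l}. finite (levels (l + e) :: (nat^'d) set)" by (simp add: finite_levels)
    qed (auto simp: levels_def)
    also have "\<dots> \<le> (\<Sum>e\<le>?D * l. real (l + 1) ^ (?D - 1) / 2 ^ l * h e)"
    proof (rule sum_mono)
      fix e
      have "(\<Sum>\<mu>\<in>levels (l + e). real (card {\<sigma> \<in> ?P. M \<sigma> = \<mu>}) / 2 ^ w \<mu>)
          \<le> (\<Sum>\<mu>\<in>(levels (l + e) :: (nat^'d) set). real (e + 1) ^ (?D * R) / 2 ^ (l + e))"
        by (intro sum_mono frac_le fib) (auto simp: levels_def w_def)
      also have "\<dots> = real (card (levels (l + e) :: (nat^'d) set)) * (real (e + 1) ^ (?D * R) / 2 ^ (l + e))"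
        by simp
      also have "\<dots> \<le> (real (l + 1) * real (e + 1)) ^ (?D - 1) * (real (e + 1) ^ (?D * R) / 2 ^ (l + e))"
      proof (rule mult_right_mono)
        have "card (levels (l + e) :: (nat^'d) set) \<le> (l + e + 1) ^ (?D - 1)" by (rule card_levels_le)
        also have "\<dots> \<le> ((l + 1) * (e + 1)) ^ (?D - 1)" by (intro power_mono) auto
        finally have "real (card (levels (l + e) :: (nat^'d) set)) \<le> real (((l + 1) * (e + 1)) ^ (?D - 1))"
          by (simp only: of_nat_le_iff)
        thus "real (card (levels (l + e) :: (nat^'d) set)) \<le> (real (l + 1) * real (e + 1)) ^ (?D - 1)"
          by (simp only: of_nat_power of_nat_mult)
      qed simp
      also have "\<dots> = real (l + 1) ^ (?D - 1) / 2 ^ l * h e"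
        by (simp only: h_def power_add power_mult_distrib) (simp add: field_simps)
      finally show "(\<Sum>\<mu>\<in>levels (l + e). real (card {\<sigma> \<in> ?P. M \<sigma> = \<mu>}) / 2 ^ w \<mu>)
          \<le> real (l + 1) ^ (?D - 1) / 2 ^ l * h e" .
    qed
    also have "\<dots> = real (l + 1) ^ (?D - 1) / 2 ^ l * (\<Sum>e\<le>?D * l. h e)"
      by (simp only: sum_distrib_left)
    also have "\<dots> \<le> real (l + 1) ^ (?D - 1) / 2 ^ l * C"
      unfolding C_def by (intro mult_left_mono sum_le_suminf sumh) (auto simp: h0)
    finally show ?thesis by (simp add: M_def w_def mult.commute)
  qed
  thus ?thesis using C by blast
qed

lemma card_zero_sum_layer_freqs:
  fixes R :: nat
  assumes R: "0 < R"
  shows "\<exists>C>0. \<forall>l. real (card (zero_sums R (\<lambda>_. layer_freqs l :: (int^'d::finite) set)))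
    \<le> C * real (l + 1) ^ (CARD('d) - 1) * (2 ^ (l * R) / 2 ^ l)"
proof -
  obtain C where C: "0 < C" "\<And>l. (\<Sum>\<sigma>\<in>PiE {..<R} (\<lambda>_. levels l :: (nat^'d) set).
      1 / 2 ^ (\<Sum>j\<in>UNIV. coord_max R \<sigma> j))
    \<le> C * real (l + 1) ^ (CARD('d) - 1) / 2 ^ l"
    using sum_max_levels[OF R] by blast
  have "real (card (zero_sums R (\<lambda>_. layer_freqs l :: (int^'d) set)))
    \<le> (2 ^ (R * CARD('d)) * C) * real (l + 1) ^ (CARD('d) - 1) * (2 ^ (l * R) / 2 ^ l)" for l
  proof -
    let ?P = "PiE {..<R} (\<lambda>_. levels l :: (nat^'d) set)"
    let ?K = "\<lambda>\<sigma> :: nat \<Rightarrow> nat^'d. (zero_sums R (\<lambda>i. rho (\<sigma> i)))"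
    have finP: "finite ?P" by (intro finite_PiE finite_levels) simp
    have finK: "finite (?K \<sigma>)" for \<sigma>
      by (rule finite_Collect_conjI) (simp add: finite_PiE finite_rho)
    have "(zero_sums R (\<lambda>_. layer_freqs l :: (int^'d) set)) \<subseteq> (\<Union>\<sigma>\<in>?P. ?K \<sigma>)"
    proof
      fix \<kappa> assume "\<kappa> \<in> (zero_sums R (\<lambda>_. layer_freqs l :: (int^'d) set))"
      hence \<kappa>: "\<kappa> \<in> extensional {..<R}" "\<And>i. i < R \<Longrightarrow> \<kappa> i \<in> layer_freqs l" "(\<Sum>i<R. \<kappa> i) = 0"
        by (auto simp: PiE_iff)
      have "\<forall>i\<in>{..<R}. \<exists>s. s \<in> levels l \<and> \<kappa> i \<in> rho s" using \<kappa>(2) by (auto simp: layer_freqs_def)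
      then obtain \<sigma> where \<sigma>: "\<And>i. i \<in> {..<R} \<Longrightarrow> \<sigma> i \<in> levels l \<and> \<kappa> i \<in> rho (\<sigma> i)" by metis
      have "restrict \<sigma> {..<R} \<in> ?P" "\<kappa> \<in> ?K (restrict \<sigma> {..<R})"
        using \<sigma> \<kappa> by (auto simp: PiE_iff)
      thus "\<kappa> \<in> (\<Union>\<sigma>\<in>?P. ?K \<sigma>)" by blast
    qed
    hence "card (zero_sums R (\<lambda>_. layer_freqs l :: (int^'d) set)) \<le> card (\<Union>\<sigma>\<in>?P. ?K \<sigma>)"
      by (intro card_mono finite_UN_I finP finK)
    also have "\<dots> \<le> (\<Sum>\<sigma>\<in>?P. card (?K \<sigma>))" by (rule card_UN_le[OF finP])
    finally have "real (card (zero_sums R (\<lambda>_. layer_freqs l :: (int^'d) set)))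
        \<le> real (\<Sum>\<sigma>\<in>?P. card (?K \<sigma>))" by (simp only: of_nat_le_iff)
    also have "\<dots> = (\<Sum>\<sigma>\<in>?P. real (card (?K \<sigma>)))" by (rule of_nat_sum)
    also have "\<dots> \<le> (\<Sum>\<sigma>\<in>?P. 2 ^ (R * CARD('d)) * 2 ^ (l * R) * (1 / 2 ^ (\<Sum>j\<in>UNIV. coord_max R \<sigma> j)))"
    proof (rule sum_mono)
      fix \<sigma> assume "\<sigma> \<in> ?P"
      hence "\<sigma> i \<in> levels l" if "i < R" for i using that PiE_mem by blast
      from card_zero_sum_rho[OF R this]
      show "real (card (?K \<sigma>)) \<le> 2 ^ (R * CARD('d)) * 2 ^ (l * R) * (1 / 2 ^ (\<Sum>j\<in>UNIV. coord_max R \<sigma> j))"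
        by simp
    qed
    also have "\<dots> \<le> 2 ^ (R * CARD('d)) * 2 ^ (l * R) * (C * real (l + 1) ^ (CARD('d) - 1) / 2 ^ l)"
      unfolding sum_distrib_left[symmetric] by (intro mult_left_mono C) simp
    finally show ?thesis by (simp add: mult_ac)
  qed
  moreover have "0 < 2 ^ (R * CARD('d)) * C" using C by simp
  ultimately show ?thesis by blast
qed

lemma integral_prod_tpoly:
  fixes R :: nat
  assumes "finite Q"
  shows "(LINT x|torus. (\<Prod>i<R. tpoly Q (c i) x)) =
    (\<Sum>\<kappa>\<in>(zero_sums R (\<lambda>_. Q)). \<Prod>i<R. c i (\<kappa> i))"
proof -
  have finP: "finite (PiE {..<R} (\<lambda>_. Q))" using assms by (intro finite_PiE) auto
  have "(\<Prod>i<R. tpoly Q (c i) x) = (\<Sum>\<kappa>\<in>PiE {..<R} (\<lambda>_. Q). (\<Prod>i<R. c i (\<kappa> i)) * expo (\<Sum>i<R. \<kappa> i) x)" for x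
    unfolding tpoly_def using assms by (subst prod_sum_PiE) (auto simp: prod.distrib expo_sum)
  hence "(LINT x|torus. (\<Prod>i<R. tpoly Q (c i) x)) =
      (\<Sum>\<kappa>\<in>PiE {..<R} (\<lambda>_. Q). LINT x|torus. (\<Prod>i<R. c i (\<kappa> i)) * expo (\<Sum>i<R. \<kappa> i) x)"
    by (simp add: Bochner_Integration.integral_sum integrable_expo)
  also have "\<dots> = (\<Sum>\<kappa>\<in>PiE {..<R} (\<lambda>_. Q). if (\<Sum>i<R. \<kappa> i) = 0 then \<Prod>i<R. c i (\<kappa> i) else 0)"
    by (intro sum.cong refl) (simp add: integral_expo)
  also have "\<dots> = (\<Sum>\<kappa>\<in>(zero_sums R (\<lambda>_. Q)). \<Prod>i<R. c i (\<kappa> i))"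
    by (rule sum.inter_filter[OF finP, symmetric])
  finally show ?thesis .
qed

text \<open>
  For an even exponent the integrand is a product of \<open>2 * N\<close> polynomials on \<open>Q\<close>, because \<open>Q\<close> is
  symmetric and so the conjugate of the polynomial also has its frequencies in \<open>Q\<close>. Integration
  keeps the tuples of frequencies with sum zero.
\<close>

lemma pint_even_le_card:
  assumes Q: "finite Q" "uminus ` Q = Q" and \<epsilon>: "\<And>k. k \<in> Q \<Longrightarrow> cmod (\<epsilon> k) \<le> 1"
  shows "pint (real (2 * N)) (tpoly Q \<epsilon>) \<le>
    ennreal (real (card (zero_sums (2 * N) (\<lambda>_. Q))))"
proof (cases "N = 0")
  case True
  have "pint 0 (tpoly Q \<epsilon>) \<le> (\<integral>\<^sup>+x. 1 \<partial>(torus :: (real^'a) measure))"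
    unfolding pint_def by (intro nn_integral_mono) simp
  also have "\<dots> = 1" using torus.emeasure_space_1 by simp
  finally have "pint 0 (tpoly Q \<epsilon>) \<le> 1" .
  moreover have "(zero_sums (2 * N) (\<lambda>_. Q)) = {\<lambda>_. undefined}"
    using True by auto
  ultimately show ?thesis using True by simp
next
  case False
  let ?K = "(zero_sums (2 * N) (\<lambda>_. Q))"
  define c where "c = (\<lambda>i k. if i < N then \<epsilon> k else cnj (\<epsilon> (- k)))"
  have sym: "- k \<in> Q" if "k \<in> Q" for k using that Q(2) by blast
  have c: "cmod (c i k) \<le> 1" if "k \<in> Q" for i k using \<epsilon> sym that by (auto simp: c_def)
  have pw: "complex_of_real (cmod (tpoly Q \<epsilon> x) ^ (2 * N)) = (\<Prod>i<2 * N. tpoly Q (c i) x)" for x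
  proof -
    have "(\<Prod>i<2 * N. tpoly Q (c i) x) = (\<Prod>i<2 * N. if i < N then tpoly Q \<epsilon> x else cnj (tpoly Q \<epsilon> x))"
      by (intro prod.cong refl) (auto simp: c_def cnj_tpoly Q(2))
    also have "\<dots> = (\<Prod>i\<in>{..<N} \<union> {N..<2 * N}. if i < N then tpoly Q \<epsilon> x else cnj (tpoly Q \<epsilon> x))"
      by (rule prod.cong) auto
    also have "\<dots> = (\<Prod>i<N. tpoly Q \<epsilon> x) * (\<Prod>i\<in>{N..<2 * N}. cnj (tpoly Q \<epsilon> x))"
      by (subst prod.union_disjoint) (auto intro!: arg_cong2[where f="(*)"] prod.cong)
    also have "\<dots> = (tpoly Q \<epsilon> x * cnj (tpoly Q \<epsilon> x)) ^ N" by (simp add: power_mult_distrib)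
    also have "\<dots> = complex_of_real (cmod (tpoly Q \<epsilon> x) ^ (2 * N))"
      by (simp add: complex_norm_square[symmetric] power_mult)
    finally show ?thesis by simp
  qed
  have "integrable torus (\<lambda>x. cmod (tpoly Q \<epsilon> x) ^ (2 * N))"
    by (rule torus.integrable_const_bound[where B="(\<Sum>k\<in>Q. cmod (\<epsilon> k)) ^ (2 * N)"])
      (auto intro!: power_mono cmod_tpoly_le)
  hence "(\<integral>\<^sup>+x. ennreal (cmod (tpoly Q \<epsilon> x) ^ (2 * N)) \<partial>torus) = ennreal (LINT x|torus. cmod (tpoly Q \<epsilon> x) ^ (2 * N))"
    by (rule nn_integral_eq_integral) simp
  moreover have "pint (real (2 * N)) (tpoly Q \<epsilon>) = (\<integral>\<^sup>+x. ennreal (cmod (tpoly Q \<epsilon> x) ^ (2 * N)) \<partial>torus)"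
    unfolding pint_def using False by (simp only: powr_realpow' norm_ge_zero)
  moreover have "(LINT x|torus. cmod (tpoly Q \<epsilon> x) ^ (2 * N)) \<le> real (card ?K)"
  proof -
    have "(LINT x|torus. cmod (tpoly Q \<epsilon> x) ^ (2 * N)) \<le> cmod (of_real (LINT x|torus. cmod (tpoly Q \<epsilon> x) ^ (2 * N)))"
      unfolding norm_of_real by (rule abs_ge_self)
    also have "complex_of_real (LINT x|torus. cmod (tpoly Q \<epsilon> x) ^ (2 * N)) = (LINT x|torus. (\<Prod>i<2 * N. tpoly Q (c i) x))"
      unfolding pw[symmetric] by (rule integral_complex_of_real[symmetric])
    also have "\<dots> = (\<Sum>\<kappa>\<in>?K. \<Prod>i<2 * N. c i (\<kappa> i))" by (rule integral_prod_tpoly[OF Q(1)])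
    also have "cmod \<dots> \<le> (\<Sum>\<kappa>\<in>?K. 1)"
    proof (rule sum_norm_le)
      fix \<kappa> assume "\<kappa> \<in> ?K"
      hence "\<kappa> i \<in> Q" if "i < 2 * N" for i using that PiE_mem[of \<kappa> "{..<2 * N}" "\<lambda>_. Q" i] by simp
      thus "cmod (\<Prod>i<2 * N. c i (\<kappa> i)) \<le> 1"
        unfolding prod_norm[symmetric] using c by (intro prod_le_1) auto
    qed
    finally show ?thesis by simp
  qed
  ultimately show ?thesis by (simp add: ennreal_leI)
qed

lemma pint_two_layer_poly:
  fixes \<epsilon> :: "int^'d::finite \<Rightarrow> complex"
  assumes "\<forall>k\<in>layer_freqs l. cmod (\<epsilon> k) \<le> 1"
  shows "pint 2 (tpoly (layer_freqs l) \<epsilon>) \<le> ennreal (2 ^ CARD('d) * 2 powr real l * real (l + 1) ^ (CARD('d) - 1))"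
proof -
  have "(\<Sum>k\<in>layer_freqs l. (cmod (\<epsilon> k))\<^sup>2) \<le> (\<Sum>k\<in>(layer_freqs l :: (int^'d) set). 1)"
    using assms by (intro sum_mono) (auto simp: power_le_one)
  also have "\<dots> = real (card (layer_freqs l :: (int^'d) set))" by simp
  also have "\<dots> \<le> real (2 ^ CARD('d) * 2 ^ l * (l + 1) ^ (CARD('d) - 1))"
    unfolding of_nat_le_iff by (rule card_layer_freqs_le)
  also have "\<dots> = 2 ^ CARD('d) * 2 powr real l * real (l + 1) ^ (CARD('d) - 1)"
    by (simp only: of_nat_mult of_nat_power powr_realpow) simp
  finally show ?thesis by (subst pint_two_tpoly) (auto intro: ennreal_leI)
qed

text \<open>
  Interpolation between the exponent 2 and an even exponent \<open>R > r\<close>. At both ends the power of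
  \<open>l + 1\<close> is the same, and the exponent of 2 is affine in \<open>r\<close>.
\<close>

lemma pint_layer_poly:
  assumes r: "2 \<le> r"
  shows "\<exists>C>0. \<forall>l (\<epsilon> :: int^'d::finite \<Rightarrow> complex). (\<forall>k\<in>layer_freqs l. cmod (\<epsilon> k) \<le> 1) \<longrightarrow>
    pint r (tpoly (layer_freqs l) \<epsilon>) \<le> ennreal (C * 2 powr (real l * (r - 1)) * real (l + 1) ^ (CARD('d) - 1))"
proof -
  let ?D = "CARD('d)"
  note two = pint_two_layer_poly
  show ?thesis
  proof (cases "r = 2")
    case True
    thus ?thesis using two by (intro exI[of _ "2 ^ ?D"]) auto
  next
    case False
    define N where "N = nat \<lceil>r\<rceil>"
    define R where "R = 2 * N"
    have R: "r < real R" "0 < R" using r by (simp_all add: R_def N_def, linarith+)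
    obtain C where C: "0 < C" "\<And>l. real (card (zero_sums R (\<lambda>_. layer_freqs l :: (int^'d) set)))
      \<le> C * real (l + 1) ^ (?D - 1) * (2 ^ (l * R) / 2 ^ l)"
      using card_zero_sum_layer_freqs[OF R(2), where 'd='d] by blast
    define \<beta> where "\<beta> = (r - 2) / (real R - 2)"
    define \<alpha> where "\<alpha> = 1 - \<beta>"
    have ab: "0 < \<alpha>" "0 < \<beta>" "\<alpha> + \<beta> = 1" "r = \<alpha> * 2 + \<beta> * real R"
    proof -
      have "\<beta> * (real R - 2) = r - 2" using r R by (simp add: \<beta>_def)
      thus "r = \<alpha> * 2 + \<beta> * real R" by (simp add: \<alpha>_def algebra_simps)
      have "\<beta> < 1" using r R by (simp add: \<beta>_def divide_less_eq)
      thus "0 < \<alpha>" "\<alpha> + \<beta> = 1" by (simp_all add: \<alpha>_def)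
      show "0 < \<beta>" using r False R by (simp add: \<beta>_def)
    qed
    define K where "K = (2 ^ ?D) powr \<alpha> * C powr \<beta>"
    have "pint r (tpoly (layer_freqs l) \<epsilon>) \<le> ennreal (K * 2 powr (real l * (r - 1)) * real (l + 1) ^ (?D - 1))"
      if eps: "\<forall>k\<in>layer_freqs l. cmod (\<epsilon> k) \<le> 1" for l and \<epsilon> :: "int^'d \<Rightarrow> complex"
    proof -
      define L where "L = real (l + 1) ^ (?D - 1)"
      have L: "0 < L" by (simp add: L_def)
      have "pint (real R) (tpoly (layer_freqs l) \<epsilon>) \<le>
          ennreal (real (card (zero_sums R (\<lambda>_. layer_freqs l :: (int^'d) set))))"
        unfolding R_def using eps by (intro pint_even_le_card uminus_layer_freqs) auto
      also have "\<dots> \<le> ennreal (C * L * (2 ^ (l * R) / 2 ^ l))"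
        unfolding L_def by (rule ennreal_leI[OF C(2)])
      also have "(2::real) ^ (l * R) / 2 ^ l = 2 powr (real l * (real R - 1))"
        by (simp add: powr_realpow[symmetric] powr_diff[symmetric] algebra_simps del: of_nat_mult) (simp add: algebra_simps)
      finally have bR: "pint (real R) (tpoly (layer_freqs l) \<epsilon>) \<le> ennreal (C * L * 2 powr (real l * (real R - 1)))" .
      have "pint r (tpoly (layer_freqs l) \<epsilon>) \<le>
          ennreal ((2 ^ ?D * 2 powr real l * L) powr \<alpha> * (C * L * 2 powr (real l * (real R - 1))) powr \<beta>)"
        using two[OF eps] bR C L ab
        by (intro pint_interpolation[OF tpoly_measurable ab]) (simp_all add: L_def)
      also have "(2 ^ ?D * 2 powr real l * L) powr \<alpha> * (C * L * 2 powr (real l * (real R - 1))) powr \<beta>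
          = K * (L powr \<alpha> * L powr \<beta>) * (2 powr (real l * \<alpha>) * 2 powr (real l * (real R - 1) * \<beta>))"
        using C L by (simp add: powr_mult powr_powr K_def mult_ac)
      also have "\<dots> = K * 2 powr (real l * (r - 1)) * L"
      proof -
        have "L powr \<alpha> * L powr \<beta> = L" using L ab by (simp add: powr_add[symmetric])
        moreover have "real l * \<alpha> + real l * (real R - 1) * \<beta> = real l * (r - 1)"
        proof -
          have al: "\<alpha> = 1 - \<beta>" using ab(3) by simp
          have "real l * \<alpha> + real l * (real R - 1) * \<beta> = real l * ((\<alpha> * 2 + \<beta> * real R) - 1)"
            unfolding al by (simp add: algebra_simps)
          thus ?thesis by (simp only: ab(4)[symmetric])
        qed
        ultimately show ?thesis by (simp add: powr_add[symmetric])
      qed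
      finally show ?thesis by (simp add: L_def)
    qed
    moreover have "0 < K" using C by (simp add: K_def)
    ultimately show ?thesis by blast
  qed
qed

text \<open>
  Duality: pairing the layer with the polynomial whose coefficients are the signs of those of
  \<open>f\<close> produces the sum of their moduli, and \<open>pint_layer_poly\<close> bounds the other factor in Hoelder's
  inequality. The exponent \<open>1 - 1 / q\<close> of the logarithmic factor is the point: counting
  frequencies after the Hausdorff--Young inequality would give \<open>1 / q\<close> in its place.
\<close>

lemma sum_fourier_layer_le:
  assumes q: "1 < q" "q \<le> 2"
  shows "\<exists>C>0. \<forall>l (f :: 'd::finite tfun) M. 0 < M \<longrightarrow> pint q (layer l f) \<le> ennreal (M powr q) \<longrightarrow>
    (\<Sum>k\<in>layer_freqs l. cmod (fourier f k)) \<le>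
      M * (C * 2 powr (real l / q) * real (l + 1) powr ((real CARD('d) - 1) * (1 - 1 / q)))"
proof -
  define r where "r = q / (q - 1)"
  have r: "2 \<le> r" "1 / q + 1 / r = 1" using q by (simp_all add: r_def field_simps)
  obtain C where C: "0 < C" "\<And>l (\<epsilon> :: int^'d \<Rightarrow> complex). (\<forall>k\<in>layer_freqs l. cmod (\<epsilon> k) \<le> 1) \<Longrightarrow>
    pint r (tpoly (layer_freqs l) \<epsilon>) \<le> ennreal (C * 2 powr (real l * (r - 1)) * real (l + 1) ^ (CARD('d) - 1))"
    using pint_layer_poly[OF r(1), where 'd='d] by blast
  have "(\<Sum>k\<in>layer_freqs l. cmod (fourier f k)) \<le>
      M * (C powr (1 / r) * 2 powr (real l / q) * real (l + 1) powr ((real CARD('d) - 1) * (1 - 1 / q)))"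
    if M: "0 < M" "pint q (layer l f) \<le> ennreal (M powr q)" for l and f :: "'d tfun" and M
  proof -
    define B where "B = (C * 2 powr (real l * (r - 1)) * real (l + 1) ^ (CARD('d) - 1)) powr (1 / r)"
    have B0: "0 < B" using C by (simp add: B_def)
    define \<epsilon> where "\<epsilon> = (\<lambda>k. sgn (fourier f k))"
    have "pint r (tpoly (layer_freqs l) \<epsilon>) \<le> ennreal (C * 2 powr (real l * (r - 1)) * real (l + 1) ^ (CARD('d) - 1))"
      by (rule C(2)) (simp add: \<epsilon>_def norm_sgn)
    also have "C * 2 powr (real l * (r - 1)) * real (l + 1) ^ (CARD('d) - 1) = B powr r"
      using C r by (simp add: B_def powr_powr)
    finally have g: "pint r (\<lambda>x. cnj (tpoly (layer_freqs l) \<epsilon> x)) \<le> ennreal (B powr r)"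
      by (simp add: pint_def)
    have "(LINT x|torus. layer l f x * cnj (tpoly (layer_freqs l) \<epsilon> x)) =
        (\<Sum>k\<in>layer_freqs l. fourier f k * cnj (\<epsilon> k))"
      unfolding layer_eq by (subst integral_mult_cnj_tpoly) (auto simp: integrable_tpoly fourier_tpoly)
    also have "\<dots> = of_real (\<Sum>k\<in>layer_freqs l. cmod (fourier f k))"
      unfolding of_real_sum
    proof (intro sum.cong refl)
      fix k
      show "fourier f k * cnj (\<epsilon> k) = of_real (cmod (fourier f k))"
        by (cases "fourier f k = 0")
          (simp_all add: \<epsilon>_def sgn_eq complex_norm_square[symmetric] power2_eq_square field_simps)
    qed
    finally have "(\<Sum>k\<in>layer_freqs l. cmod (fourier f k)) =
        cmod (LINT x|torus. layer l f x * cnj (tpoly (layer_freqs l) \<epsilon> x))"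
      by (simp del: of_real_sum add: sum_nonneg)
    also have "\<dots> \<le> M * B"
      using q r M g B0 unfolding layer_eq
      by (intro Hoelder_torus[of _ _ q r]) (auto simp: cnj_tpoly)
    also have "B = C powr (1 / r) * 2 powr (real l / q) * real (l + 1) powr ((real CARD('d) - 1) * (1 - 1 / q))"
    proof -
      have e: "(r - 1) / r = 1 / q" "1 / r = 1 - 1 / q" using q r by (simp_all add: r_def field_simps)
      have "real (l + 1) ^ (CARD('d) - 1) = real (l + 1) powr (real CARD('d) - 1)"
        by (subst powr_realpow[symmetric]) (simp_all add: of_nat_diff Suc_leI)
      thus ?thesis using C e by (simp add: B_def powr_mult powr_powr) (metis times_divide_eq_right mult.right_neutral)
    qed
    finally show ?thesis .
  qed
  moreover have "0 < C powr (1 / r)" using C by simp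
  ultimately show ?thesis by blast
qed

section \<open>Convergence of the layer decomposition\<close>

text \<open>
  The layers converge absolutely almost everywhere and in \<open>L\<^sub>1\<close>; their sum has the Fourier
  coefficients of \<open>f\<close>, hence equals \<open>f\<close>.
\<close>

lemma layers_sum_AE:
  fixes f :: "'d::finite tfun"
  assumes f: "integrable torus f"
    and \<beta>: "\<And>l. (\<integral>\<^sup>+x. ennreal (cmod (layer l f x)) \<partial>torus) \<le> ennreal (\<beta> l)" "\<And>l. 0 \<le> \<beta> l" "summable \<beta>"
  shows "AE x in torus. (\<lambda>l. layer l f x) sums f x"
proof -
  have int: "integrable torus (layer l f)" for l unfolding layer_eq by (rule integrable_tpoly)
  have [measurable]: "layer l f \<in> borel_measurable torus" for l using int by simp
  have "(\<integral>\<^sup>+x. (\<Sum>l. ennreal (cmod (layer l f x))) \<partial>torus) = (\<Sum>l. \<integral>\<^sup>+x. ennreal (cmod (layer l f x)) \<partial>torus)"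
    by (rule nn_integral_suminf) simp
  also have "\<dots> \<le> (\<Sum>l. ennreal (\<beta> l))" using \<beta>(1) by (intro suminf_le) auto
  also have "\<dots> = ennreal (suminf \<beta>)" using \<beta> by (intro suminf_ennreal2) auto
  also have "\<dots> < \<infinity>" by simp
  finally have "AE x in torus. (\<Sum>l. ennreal (cmod (layer l f x))) \<noteq> \<infinity>"
    by (intro nn_integral_PInf_AE) auto
  hence sm: "AE x in torus. summable (\<lambda>l. cmod (layer l f x))"
    by eventually_elim (auto intro: summable_suminf_not_top)
  have ints: "summable (\<lambda>l. LINT x|torus. cmod (layer l f x))"
  proof (rule summable_comparison_test'[OF \<beta>(3)])
    fix l
    have "ennreal (LINT x|torus. cmod (layer l f x)) = (\<integral>\<^sup>+x. ennreal (cmod (layer l f x)) \<partial>torus)"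
      using int[of l] by (intro nn_integral_eq_integral[symmetric]) auto
    with \<beta>(1)[of l] have "ennreal (LINT x|torus. cmod (layer l f x)) \<le> ennreal (\<beta> l)" by simp
    thus "norm (LINT x|torus. cmod (layer l f x)) \<le> \<beta> l" using \<beta>(2)[of l] by simp
  qed
  define F where "F = (\<lambda>x. \<Sum>l. layer l f x)"
  have intF: "integrable torus F" unfolding F_def by (rule integrable_suminf[OF int sm ints])
  have "fourier F k = fourier f k" for k
  proof -
    obtain l0 where l0: "k \<in> layer_freqs l0" using ex_layer_freqs by blast
    have cm: "cmod (layer l f x * cnj (expo k x)) = cmod (layer l f x)" for l x by (simp add: norm_mult)
    have int': "integrable torus (\<lambda>x. layer l f x * cnj (expo k x))" for l
      by (rule integrable_mult_cnj_expo[OF int])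
    have "fourier F k = (LINT x|torus. (\<Sum>l. layer l f x * cnj (expo k x)))"
      unfolding fourier_eq
    proof (rule integral_cong_AE)
      have [measurable]: "F \<in> borel_measurable torus" using intF by simp
      show "(\<lambda>x. F x * cnj (expo k x)) \<in> borel_measurable torus"
        unfolding cnj_expo by measurable
      show "(\<lambda>x. \<Sum>l. layer l f x * cnj (expo k x)) \<in> borel_measurable torus"
        unfolding cnj_expo by measurable
      show "AE x in torus. F x * cnj (expo k x) = (\<Sum>l. layer l f x * cnj (expo k x))"
        using sm by eventually_elim (auto simp: F_def intro!: suminf_mult2 summable_norm_cancel)
    qed
    also have "\<dots> = (\<Sum>l. fourier (layer l f) k)"
      unfolding fourier_eq by (rule integral_suminf) (use int' sm ints in \<open>simp_all add: cm\<close>)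
    also have "\<dots> = (\<Sum>l. if l = l0 then fourier f k else 0)"
      by (intro suminf_cong) (use l0 layer_freqs_disjoint in \<open>auto simp: layer_eq fourier_tpoly\<close>)
    also have "\<dots> = fourier f k" by (subst suminf_finite[of "{l0}"]) auto
    finally show ?thesis .
  qed
  hence "fourier (\<lambda>x. F x - f x) k = 0" for k
  proof -
    have "fourier (\<lambda>x. F x - f x) k = fourier F k - fourier f k"
      unfolding fourier_eq using intF f by (simp add: left_diff_distrib integrable_mult_cnj_expo)
    thus ?thesis using \<open>\<And>k. fourier F k = fourier f k\<close> by simp
  qed
  from fourier_uniqueness[OF _ this] have "AE x in torus. F x - f x = 0"
    using intF f by simp
  thus ?thesis using sm
  proof eventually_elim
    case (elim x)
    have "(\<lambda>l. layer l f x) sums F x"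
      unfolding F_def using elim by (intro summable_sums) (rule summable_norm_cancel)
    thus ?case using elim by simp
  qed
qed

text \<open>
  Minkowski's inequality for the finite parts of the tail, and Fatou's lemma.
\<close>

lemma pint_tail_le:
  fixes f :: "'d::finite tfun"
  assumes f: "integrable torus f" and p: "1 < p"
    and \<alpha>: "\<And>l. pint p (layer l f) \<le> ennreal (\<alpha> l powr p)" "\<And>l. 0 < \<alpha> l" "summable \<alpha>"
  shows "pint p (\<lambda>x. f x - (\<Sum>l<N. layer l f x)) \<le> ennreal ((\<Sum>l. \<alpha> (l + N)) powr p)"
proof -
  have [measurable]: "layer l f \<in> borel_measurable torus" for l by (simp add: layer_eq)
  have sA: "summable (\<lambda>l. \<alpha> (l + N))" using \<alpha>(3) by (simp add: summable_iff_shift)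
  have "AE x in torus. (\<lambda>l. layer l f x) sums f x"
    using \<alpha> p by (intro layers_sum_AE[OF f, of \<alpha>] nn_integral_le_of_pint) (auto intro: less_imp_le)
  hence lim: "AE x in torus. ennreal (cmod (f x - (\<Sum>l<N. layer l f x)) powr p) =
      liminf (\<lambda>M. ennreal (cmod (\<Sum>l<M. layer (l + N) f x) powr p))"
  proof eventually_elim
    case (elim x)
    from sums_split_initial_segment[OF elim, of N]
    have "(\<lambda>M. \<Sum>l<M. layer (l + N) f x) \<longlonglongrightarrow> f x - (\<Sum>l<N. layer l f x)" by (simp add: sums_def)
    hence "(\<lambda>M. ennreal (cmod (\<Sum>l<M. layer (l + N) f x) powr p)) \<longlonglongrightarrow> ennreal (cmod (f x - (\<Sum>l<N. layer l f x)) powr p)"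
      using p by (intro tendsto_ennrealI tendsto_powr' tendsto_norm tendsto_const) auto
    from lim_imp_Liminf[OF _ this] show ?case by simp
  qed
  have "pint p (\<lambda>x. f x - (\<Sum>l<N. layer l f x)) =
      (\<integral>\<^sup>+x. liminf (\<lambda>M. ennreal (cmod (\<Sum>l<M. layer (l + N) f x) powr p)) \<partial>torus)"
    unfolding pint_def by (rule nn_integral_cong_AE[OF lim])
  also have "\<dots> \<le> liminf (\<lambda>M. pint p (\<lambda>x. \<Sum>l<M. layer (l + N) f x))"
    unfolding pint_def by (rule nn_integral_liminf) measurable
  also have "\<dots> \<le> liminf (\<lambda>M::nat. ennreal ((\<Sum>l. \<alpha> (l + N)) powr p))"
  proof (intro Liminf_mono always_eventually allI)
    fix M
    have "pint p (\<lambda>x. \<Sum>l<M. layer (l + N) f x) \<le> ennreal ((\<Sum>l<M. \<alpha> (l + N)) powr p)"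
      using p \<alpha> by (intro Minkowski_torus) auto
    also have "\<dots> \<le> ennreal ((\<Sum>l. \<alpha> (l + N)) powr p)"
      using p \<alpha> by (intro ennreal_leI powr_mono2 sum_le_suminf sA sum_nonneg) (auto intro: less_imp_le)
    finally show "pint p (\<lambda>x. \<Sum>l<M. layer (l + N) f x) \<le> ennreal ((\<Sum>l. \<alpha> (l + N)) powr p)" .
  qed
  also have "\<dots> = ennreal ((\<Sum>l. \<alpha> (l + N)) powr p)" by (simp add: Liminf_const)
  finally show ?thesis .
qed

section \<open>Polynomials with few terms\<close>

lemma sum_expo_as_tpoly:
  assumes "finite J"
  shows "(\<lambda>x. \<Sum>j\<in>J. d j * expo (k j) x) = tpoly (k ` J) (\<lambda>\<kappa>. \<Sum>j\<in>{j \<in> J. k j = \<kappa>}. d j)"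
proof
  fix x
  have "(\<Sum>j\<in>J. d j * expo (k j) x) = (\<Sum>\<kappa>\<in>k ` J. \<Sum>j\<in>{j \<in> J. k j = \<kappa>}. d j * expo (k j) x)"
    by (rule sum.image_gen[OF assms])
  also have "\<dots> = tpoly (k ` J) (\<lambda>\<kappa>. \<Sum>j\<in>{j \<in> J. k j = \<kappa>}. d j) x"
    unfolding tpoly_def sum_distrib_right by (intro sum.cong refl) auto
  finally show "(\<Sum>j\<in>J. d j * expo (k j) x) = \<dots>" .
qed

lemma trig_polysD:
  assumes "t \<in> trig_polys m"
  obtains F c where "finite F" "card F \<le> m" "t = tpoly F c"
proof -
  obtain k c where t: "t = (\<lambda>x. \<Sum>j=1..m. c j * expo (k j) x)" using assms by (auto simp: trig_polys_def)
  have "card (k ` {1..m}) \<le> m" using card_image_le[of "{1..m}" k] by simp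
  thus ?thesis using that[OF _ _ t[unfolded sum_expo_as_tpoly[OF finite_atLeastAtMost]]] by simp
qed

lemma trig_polysI:
  assumes "finite F" "card F \<le> m"
  shows "tpoly F c \<in> trig_polys m"
proof -
  obtain h where h: "bij_betw h {1..card F} F" using ex_bij_betw_nat_finite_1[OF assms(1)] by blast
  have "tpoly F c x = (\<Sum>j=1..m. (if j \<le> card F then c (h j) else 0) * expo (h j) x)" for x
  proof -
    have "(\<Sum>j=1..m. (if j \<le> card F then c (h j) else 0) * expo (h j) x) = (\<Sum>j=1..card F. c (h j) * expo (h j) x)"
      using assms(2) by (intro sum.mono_neutral_cong_right) auto
    also have "\<dots> = tpoly F c x" unfolding tpoly_def by (rule sum.reindex_bij_betw[OF h])
    finally show ?thesis by simp
  qed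
  hence "tpoly F c = (\<lambda>x. \<Sum>j=1..m. (if j \<le> card F then c (h j) else 0) * expo (h j) x)" by (rule ext)
  thus ?thesis unfolding trig_polys_def mem_Collect_eq
    by (intro exI[of _ h] exI[of _ "\<lambda>j. if j \<le> card F then c (h j) else 0"])
qed

lemma trig_polys_add:
  assumes "s \<in> trig_polys m" "t \<in> trig_polys n"
  shows "(\<lambda>x. s x + t x) \<in> trig_polys (m + n)"
proof -
  obtain F c G d where F: "finite F" "card F \<le> m" "s = tpoly F c" and G: "finite G" "card G \<le> n" "t = tpoly G d"
    using assms by (meson trig_polysD)
  have "tpoly F c = tpoly (F \<union> G) (\<lambda>k. if k \<in> F then c k else 0)"
    "tpoly G d = tpoly (F \<union> G) (\<lambda>k. if k \<in> G then d k else 0)"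
    using F G by (auto intro!: tpoly_mono)
  hence "(\<lambda>x. s x + t x) = tpoly (F \<union> G) (\<lambda>k. (if k \<in> F then c k else 0) + (if k \<in> G then d k else 0))"
    using F G by (simp add: tpoly_add)
  moreover have "card (F \<union> G) \<le> m + n" using F G card_Un_le[of F G] by linarith
  ultimately show ?thesis using F G by (auto intro: trig_polysI)
qed

lemma tpoly_empty: "tpoly {} c = (\<lambda>x. 0)"
  by (auto simp: tpoly_def)

lemma zero_trig_polys: "(\<lambda>x. 0) \<in> trig_polys m"
  using trig_polysI[of "{}" m] by (simp add: tpoly_empty)

lemma trig_polys_measurable: "t \<in> trig_polys m \<Longrightarrow> t \<in> borel_measurable torus"
  by (metis trig_polysD tpoly_measurable)

lemma expo_periodic: "expo k (x + axis j (2 * pi)) = expo k x"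
proof -
  have "phase k (x + axis j (2 * pi)) = phase k x + of_int (k $ j) * (2 * pi)"
    by (simp add: phase_def algebra_simps sum.distrib axis_def if_distrib[of "\<lambda>t. _ * t"] cong: if_cong)
  hence "expo k (x + axis j (2 * pi)) = expo k x * exp (\<i> * of_real (of_int (k $ j) * (2 * pi)))"
    by (simp add: expo_def algebra_simps exp_add)
  moreover have "exp (\<i> * of_real (of_int (k $ j) * (2 * pi))) = 1" by (auto simp: exp_eq_1)
  ultimately show ?thesis by simp
qed

lemma tpoly_L1: "tpoly F c \<in> L1_torus"
  by (simp add: L1_torus_def periodic_def integrable_tpoly) (simp add: tpoly_def expo_periodic)

lemma A_norm_tpoly:
  assumes "finite F"
  shows "A_norm (tpoly F c) = ennreal (\<Sum>k\<in>F. cmod (c k))"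
proof -
  have "A_norm (tpoly F c) = (\<Sum>\<^sub>\<infinity>k\<in>F. ennreal (cmod (c k)))"
    unfolding A_norm_def by (intro infsum_cong_neutral) (auto simp: fourier_tpoly[OF assms])
  thus ?thesis using assms by simp
qed

lemma A_norm_zero: "A_norm (\<lambda>x. 0) = 0"
  using A_norm_tpoly[of "{}"] by (simp add: tpoly_empty)

lemma A_norm_sum_expo_le:
  assumes "finite J"
  shows "A_norm (\<lambda>x. \<Sum>j\<in>J. d j * expo (k j) x) \<le> ennreal (\<Sum>j\<in>J. cmod (d j))"
proof -
  have "A_norm (\<lambda>x. \<Sum>j\<in>J. d j * expo (k j) x) = ennreal (\<Sum>\<kappa>\<in>k ` J. cmod (\<Sum>j\<in>{j \<in> J. k j = \<kappa>}. d j))"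
    using assms by (simp add: sum_expo_as_tpoly A_norm_tpoly)
  also have "\<dots> \<le> ennreal (\<Sum>\<kappa>\<in>k ` J. \<Sum>j\<in>{j \<in> J. k j = \<kappa>}. cmod (d j))"
    by (intro ennreal_leI sum_mono norm_sum)
  also have "(\<Sum>\<kappa>\<in>k ` J. \<Sum>j\<in>{j \<in> J. k j = \<kappa>}. cmod (d j)) = (\<Sum>j\<in>J. cmod (d j))"
    by (rule sum.image_gen[OF assms, symmetric])
  finally show ?thesis .
qed

lemma sum_fourier_le_A_norm:
  assumes "finite F"
  shows "ennreal (\<Sum>k\<in>F. cmod (fourier g k)) \<le> A_norm g"
proof -
  have "ennreal (\<Sum>k\<in>F. cmod (fourier g k)) = (\<Sum>\<^sub>\<infinity>k\<in>F. ennreal (cmod (fourier g k)))"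
    using assms by (simp add: sum_ennreal)
  also have "\<dots> \<le> A_norm g" unfolding A_norm_def
    by (intro infsum_mono_neutral nonneg_summable_on_complete) auto
  finally show ?thesis .
qed

section \<open>Existence of greedy methods\<close>

lemma cosh_le_exp_square: "cosh (x::real) \<le> exp (x\<^sup>2)"
proof -
  have pos: "cosh y \<le> exp (y\<^sup>2)" if y: "0 \<le> y" for y :: real
  proof (cases "y \<le> 1")
    case True
    have "exp y \<le> 1 + y + y\<^sup>2" using exp_bound[OF y True] .
    moreover have "exp (- y) \<le> 1 - y + y\<^sup>2"
    proof -
      have "exp (- y) \<le> 1 / (1 + y)"
        using exp_ge_add_one_self[of y] y by (simp add: exp_minus inverse_eq_divide frac_le)
      also have "\<dots> \<le> 1 - y + y\<^sup>2"
      proof -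
        have "(1 - y + y\<^sup>2) * (1 + y) = 1 + y ^ 3" by (simp add: algebra_simps power2_eq_square power3_eq_cube)
        hence "1 \<le> (1 - y + y\<^sup>2) * (1 + y)" using y by simp
        thus ?thesis using y by (subst pos_divide_le_eq) auto
      qed
      finally show ?thesis .
    qed
    ultimately have "cosh y \<le> 1 + y\<^sup>2" by (simp add: cosh_def)
    thus ?thesis using exp_ge_add_one_self[of "y\<^sup>2"] by linarith
  next
    case False
    have "cosh y \<le> exp y" using y by (simp add: cosh_def)
    also have "\<dots> \<le> exp (y\<^sup>2)" using False by (simp add: power2_eq_square)
    finally show ?thesis .
  qed
  show ?thesis using pos[of "\<bar>x\<bar>"] by simp
qed

text \<open>
  Hoeffding's lemma for \<open>cosh\<close>: by convexity, among the centred variables with values in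
  \<open>[-B, B]\<close> the mean is largest for the values \<open>-B\<close> and \<open>B\<close> with equal weights, where it is
  \<open>cosh u * cosh B\<close>.
\<close>

lemma sum_cosh_le:
  fixes w x :: "'a \<Rightarrow> real"
  assumes w: "\<And>k. k \<in> F \<Longrightarrow> 0 \<le> w k" "(\<Sum>k\<in>F. w k) = 1" and x: "\<And>k. k \<in> F \<Longrightarrow> \<bar>x k\<bar> \<le> B"
    and mean: "(\<Sum>k\<in>F. w k * x k) = 0" and B: "0 < B"
  shows "(\<Sum>k\<in>F. w k * cosh (u + x k)) \<le> exp (B\<^sup>2) * cosh u"
proof -
  have chord: "cosh (u + y) \<le> cosh u * cosh B + y * (sinh u * sinh B / B)" if "\<bar>y\<bar> \<le> B" for y
  proof -
    define t where "t = (B + y) / (2 * B)"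
    have t: "0 \<le> t" "t \<le> 1" using that B by (auto simp: t_def)
    have eq: "u + y = (1 - t) * (u - B) + t * (u + B)" using B by (simp add: t_def field_simps)
    have ex: "convex_on UNIV (exp :: real \<Rightarrow> real)" by (rule exp_convex)
    have "exp (u + y) \<le> (1 - t) * exp (u - B) + t * exp (u + B)"
      unfolding eq using convex_onD[OF ex, of t "u - B" "u + B"] t by simp
    moreover have "exp (- (u + y)) \<le> (1 - t) * exp (- (u - B)) + t * exp (- (u + B))"
    proof -
      have "- (u + y) = (1 - t) * (- (u - B)) + t * (- (u + B))" unfolding eq by (simp add: algebra_simps)
      thus ?thesis using convex_onD[OF ex, of t "- (u - B)" "- (u + B)"] t by simp
    qed
    ultimately have "cosh (u + y) \<le> (1 - t) * cosh (u - B) + t * cosh (u + B)"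
      by (simp add: cosh_def field_simps)
    also have "\<dots> = cosh u * cosh B + (2 * t - 1) * (sinh u * sinh B)"
      by (simp add: cosh_add cosh_diff algebra_simps)
    also have "2 * t - 1 = y / B" using B by (simp add: t_def field_simps)
    finally show ?thesis by simp
  qed
  have "(\<Sum>k\<in>F. w k * cosh (u + x k)) \<le> (\<Sum>k\<in>F. w k * (cosh u * cosh B + x k * (sinh u * sinh B / B)))"
    using w x chord by (intro sum_mono mult_left_mono) auto
  also have "\<dots> = (\<Sum>k\<in>F. w k) * (cosh u * cosh B) + (\<Sum>k\<in>F. w k * x k) * (sinh u * sinh B / B)"
    unfolding sum_distrib_right distrib_left sum.distrib mult.assoc ..
  also have "\<dots> = cosh u * cosh B" using w mean by simp
  also have "\<dots> \<le> cosh u * exp (B\<^sup>2)" by (intro mult_left_mono cosh_le_exp_square) simp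
  finally show ?thesis by (simp add: mult.commute)
qed

text \<open>
  Grows exponentially in every direction, so its integral controls the powers of the modulus
  of all orders (\<open>cmod_powr_le_potential\<close>); a centred perturbation of size \<open>B\<close> increases its mean
  at most by the factor \<open>exp (B^2)\<close>, which is \<open>1 + O(B^2)\<close> for small \<open>B\<close> (\<open>sum_potential_le\<close>).
\<close>

definition potential :: "complex \<Rightarrow> real" where
  "potential z = cosh (Re z) + cosh (Im z)"

lemma potential_nonneg: "0 \<le> potential z" by (simp add: potential_def)

lemma measurable_potential [measurable]: "potential \<in> borel_measurable borel"
  unfolding potential_def by (intro borel_measurable_continuous_onI continuous_intros)

lemma sum_potential_le:
  fixes w :: "'a \<Rightarrow> real" and X :: "'a \<Rightarrow> complex"
  assumes w: "\<And>k. k \<in> F \<Longrightarrow> 0 \<le> w k" "(\<Sum>k\<in>F. w k) = 1" and X: "\<And>k. k \<in> F \<Longrightarrow> cmod (X k) \<le> B"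
    and mean: "(\<Sum>k\<in>F. of_real (w k) * X k) = 0" and B: "0 < B"
  shows "(\<Sum>k\<in>F. w k * potential (z + X k)) \<le> exp (B\<^sup>2) * potential z"
proof -
  have "(\<Sum>k\<in>F. w k * cosh (Re z + Re (X k))) \<le> exp (B\<^sup>2) * cosh (Re z)"
    using arg_cong[OF mean, of Re] abs_Re_le_cmod X
    by (intro sum_cosh_le w B) (auto intro: order_trans)
  moreover have "(\<Sum>k\<in>F. w k * cosh (Im z + Im (X k))) \<le> exp (B\<^sup>2) * cosh (Im z)"
    using arg_cong[OF mean, of Im] abs_Im_le_cmod X
    by (intro sum_cosh_le w B) (auto intro: order_trans)
  ultimately show ?thesis by (simp add: potential_def distrib_left sum.distrib)
qed

lemma cmod_powr_le_potential:
  assumes p: "0 < p"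
  shows "cmod z powr p \<le> (2 * p) powr p * (2 * potential z)"
proof -
  have e: "x powr p \<le> p powr p * exp x" if "0 \<le> x" for x :: real
  proof -
    have "x / p \<le> exp (x / p)" using exp_ge_add_one_self[of "x / p"] by linarith
    hence "(x / p) powr p \<le> exp (x / p) powr p" using that p by (intro powr_mono2) auto
    also have "\<dots> = exp x" using p by (simp add: powr_def)
    finally show ?thesis using that p by (simp add: powr_divide field_simps)
  qed
  have ec: "exp \<bar>x\<bar> \<le> 2 * cosh x" for x :: real by (cases "0 \<le> x") (simp_all add: cosh_def)
  define M where "M = max \<bar>Re z\<bar> \<bar>Im z\<bar>"
  have "cmod z \<le> 2 * M" using cmod_le[of z] by (simp add: M_def)
  hence "cmod z powr p \<le> (2 * M) powr p" using p by (intro powr_mono2) auto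
  also have "\<dots> = 2 powr p * M powr p" by (simp add: powr_mult M_def)
  also have "\<dots> \<le> 2 powr p * (p powr p * exp M)" by (intro mult_left_mono e) (auto simp: M_def)
  also have "exp M \<le> 2 * potential z"
  proof -
    have "exp M \<le> 2 * max (cosh (Re z)) (cosh (Im z))"
      using ec[of "Re z"] ec[of "Im z"] by (auto simp: M_def max_def)
    also have "\<dots> \<le> 2 * potential z" by (auto simp: potential_def max_def)
    finally show ?thesis .
  qed
  finally show ?thesis using p by (simp add: powr_mult mult_ac mult_left_mono)
qed

text \<open>
  With \<open>k\<close> drawn with probability \<open>cmod (c k) / A\<close>, the term \<open>A sgn (c k) e^(i(k,x))\<close> has mean
  \<open>tpoly F c\<close> and deviates from it by at most \<open>2 * A\<close>. So a further sample multiplies the integral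
  of the potential by at most \<open>exp ((2 * A * \<eta>)^2)\<close> on average, and the best \<open>k\<close> does not do worse
  than the average.
\<close>

lemma greedy_selection:
  fixes c :: "int^'d::finite \<Rightarrow> complex"
  assumes F: "finite F" and A: "A = (\<Sum>k\<in>F. cmod (c k))" "0 < A" and \<eta>: "0 < \<eta>"
  shows "\<exists>\<kappa>. (\<forall>i<m. \<kappa> i \<in> F) \<and>
    (\<integral>\<^sup>+x. ennreal (potential (of_real \<eta> * (\<Sum>i<m. of_real A * sgn (c (\<kappa> i)) * expo (\<kappa> i) x - tpoly F c x))) \<partial>torus)
      \<le> ennreal (2 * exp (real m * (2 * A * \<eta>)\<^sup>2))"
proof (induction m)
  case 0
  show ?case by (auto simp: potential_def)
next
  case (Suc m)
  let ?X = "\<lambda>k x. of_real A * sgn (c k) * expo k x - tpoly F c x"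
  let ?E = "exp ((2 * A * \<eta>)\<^sup>2)"
  from Suc obtain \<kappa> where \<kappa>: "\<forall>i<m. \<kappa> i \<in> F"
    "(\<integral>\<^sup>+x. ennreal (potential (of_real \<eta> * (\<Sum>i<m. ?X (\<kappa> i) x))) \<partial>torus) \<le> ennreal (2 * exp (real m * (2 * A * \<eta>)\<^sup>2))"
    by blast
  define h where "h = (\<lambda>x. of_real \<eta> * (\<Sum>i<m. ?X (\<kappa> i) x))"
  have [measurable]: "h \<in> borel_measurable torus" unfolding h_def by measurable
  define J where "J = (\<lambda>k. \<integral>\<^sup>+x. ennreal (potential (h x + of_real \<eta> * ?X k x)) \<partial>torus)"
  have Fne: "F \<noteq> {}" using A by auto
  \<comment> \<open>The minimum is at most every weighted mean.\<close>
  define k0 where "k0 = arg_min_on J F"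
  have k0: "k0 \<in> F" "\<And>k. k \<in> F \<Longrightarrow> J k0 \<le> J k"
    unfolding k0_def using arg_min_if_finite(1)[OF F Fne, of J] arg_min_least[OF F Fne] by auto
  define w where "w = (\<lambda>k. cmod (c k) / A)"
  have w: "0 \<le> w k" "(\<Sum>k\<in>F. w k) = 1" for k
    using A by (auto simp: w_def sum_divide_distrib[symmetric])
  have pw: "(\<Sum>k\<in>F. w k * potential (h x + of_real \<eta> * ?X k x)) \<le> ?E * potential (h x)" for x
  proof (rule sum_potential_le)
    show "(\<Sum>k\<in>F. of_real (w k) * (of_real \<eta> * ?X k x)) = 0"
    proof -
      have sg: "of_real (cmod z) * sgn z = z" for z :: complex
        by (cases "z = 0") (simp_all add: sgn_eq)
      have "(\<Sum>k\<in>F. of_real (w k) * (of_real \<eta> * ?X k x)) =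
          of_real \<eta> * ((\<Sum>k\<in>F. of_real (w k) * (of_real A * sgn (c k) * expo k x)) - of_real (\<Sum>k\<in>F. w k) * tpoly F c x)"
        by (simp add: sum_distrib_left sum_distrib_right sum_subtractf algebra_simps)
      also have "(\<Sum>k\<in>F. of_real (w k) * (of_real A * sgn (c k) * expo k x)) = tpoly F c x"
        unfolding tpoly_def
      proof (intro sum.cong refl)
        fix k
        have "of_real (w k) * (of_real A * sgn (c k) * expo k x) = of_real (w k * A) * sgn (c k) * expo k x" by simp
        also have "w k * A = cmod (c k)" using A by (simp add: w_def)
        finally show "of_real (w k) * (of_real A * sgn (c k) * expo k x) = c k * expo k x" by (simp only: sg)
      qed
      finally show ?thesis using w(2) by simp
    qed
    fix k assume k: "k \<in> F"
    have "cmod (?X k x) \<le> cmod (of_real A * sgn (c k) * expo k x) + cmod (tpoly F c x)" by (rule norm_triangle_ineq4)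
    also have "cmod (of_real A * sgn (c k) * expo k x) \<le> A"
      using A(2) by (simp add: norm_mult norm_sgn)
    also have "cmod (tpoly F c x) \<le> A" unfolding A(1) by (rule cmod_tpoly_le)
    finally have "cmod (?X k x) \<le> 2 * A" by simp
    thus "cmod (of_real \<eta> * ?X k x) \<le> 2 * A * \<eta>"
      using \<eta> by (simp add: norm_mult mult.commute)
  qed (use w A \<eta> in auto)
  have "J k0 = ennreal (\<Sum>k\<in>F. w k) * J k0" using w by simp
  also have "\<dots> = (\<Sum>k\<in>F. ennreal (w k) * J k0)"
    unfolding sum_distrib_right[symmetric] using w by (subst sum_ennreal) auto
  also have "\<dots> \<le> (\<Sum>k\<in>F. ennreal (w k) * J k)" using k0 by (intro sum_mono mult_left_mono) auto
  also have "\<dots> = (\<integral>\<^sup>+x. (\<Sum>k\<in>F. ennreal (w k) * ennreal (potential (h x + of_real \<eta> * ?X k x))) \<partial>torus)"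
    unfolding J_def by (subst nn_integral_sum) (auto simp: nn_integral_cmult)
  also have "\<dots> \<le> (\<integral>\<^sup>+x. ennreal ?E * ennreal (potential (h x)) \<partial>torus)"
  proof (rule nn_integral_mono)
    fix x
    have "(\<Sum>k\<in>F. ennreal (w k) * ennreal (potential (h x + of_real \<eta> * ?X k x))) =
        ennreal (\<Sum>k\<in>F. w k * potential (h x + of_real \<eta> * ?X k x))"
      using w potential_nonneg by (simp add: sum_ennreal[symmetric] ennreal_mult)
    also have "\<dots> \<le> ennreal (?E * potential (h x))" by (rule ennreal_leI[OF pw])
    finally show "(\<Sum>k\<in>F. ennreal (w k) * ennreal (potential (h x + of_real \<eta> * ?X k x)))
        \<le> ennreal ?E * ennreal (potential (h x))" by (simp add: ennreal_mult potential_nonneg)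
  qed
  also have "\<dots> = ennreal ?E * (\<integral>\<^sup>+x. ennreal (potential (h x)) \<partial>torus)" by (rule nn_integral_cmult) measurable
  also have "\<dots> \<le> ennreal ?E * ennreal (2 * exp (real m * (2 * A * \<eta>)\<^sup>2))"
    unfolding h_def by (intro mult_left_mono \<kappa>) simp
  also have "\<dots> = ennreal (2 * exp (real (Suc m) * (2 * A * \<eta>)\<^sup>2))"
    by (simp add: ennreal_mult[symmetric] distrib_right exp_add)
  finally have J0: "J k0 \<le> ennreal (2 * exp (real (Suc m) * (2 * A * \<eta>)\<^sup>2))" .
  have sumeq: "(\<Sum>i<Suc m. ?X ((\<kappa>(m := k0)) i) x) = (\<Sum>i<m. ?X (\<kappa> i) x) + ?X k0 x" for x
    by (simp add: sum.lessThan_Suc)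
  show ?case
  proof (intro exI[of _ "\<kappa>(m := k0)"] conjI)
    show "\<forall>i<Suc m. (\<kappa>(m := k0)) i \<in> F" using \<kappa>(1) k0(1) by (auto simp: less_Suc_eq)
    show "(\<integral>\<^sup>+x. ennreal (potential (of_real \<eta> * (\<Sum>i<Suc m. ?X ((\<kappa>(m := k0)) i) x))) \<partial>torus)
      \<le> ennreal (2 * exp (real (Suc m) * (2 * A * \<eta>)\<^sup>2))"
      using J0 unfolding sumeq J_def h_def by (simp only: distrib_left)
  qed
qed

text \<open>
  The finiteness of the \<open>A\<close>-norm makes the layers absolutely and uniformly summable.
\<close>

lemma layer_tails:
  fixes g :: "'d::finite tfun"
  assumes g: "integrable torus g" and A: "A_norm g \<le> ennreal A" "0 \<le> A"
  defines "a \<equiv> \<lambda>l. \<Sum>k\<in>layer_freqs l. cmod (fourier g k)"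
  shows "summable a" "suminf a \<le> A"
    "AE x in torus. \<forall>L. cmod (g x - (\<Sum>l<L. layer l g x)) \<le> (\<Sum>l. a (l + L))"
proof -
  have a0: "0 \<le> a l" for l by (simp add: a_def sum_nonneg)
  have part: "(\<Sum>l<n. a l) \<le> A" for n
  proof -
    have "(\<Sum>l<n. a l) = (\<Sum>k\<in>(\<Union>l<n. layer_freqs l). cmod (fourier g k))"
      unfolding a_def by (rule sum.UNION_disjoint[symmetric]) (auto dest: layer_freqs_disjoint)
    moreover have "ennreal (\<Sum>k\<in>(\<Union>l<n. layer_freqs l). cmod (fourier g k)) \<le> ennreal A"
      by (rule order_trans[OF sum_fourier_le_A_norm A(1)]) simp
    ultimately show ?thesis using A(2) by simp
  qed
  show sm: "summable a" by (rule summableI_nonneg_bounded[OF a0 part])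
  show "suminf a \<le> A" by (rule suminf_le_const[OF sm part])
  have le: "cmod (layer l g x) \<le> a l" for l x unfolding layer_eq a_def by (rule cmod_tpoly_le)
  have "AE x in torus. (\<lambda>l. layer l g x) sums g x"
  proof (rule layers_sum_AE[OF g _ a0 sm])
    fix l
    have "(\<integral>\<^sup>+x. ennreal (cmod (layer l g x)) \<partial>torus) \<le> (\<integral>\<^sup>+x. ennreal (a l) \<partial>(torus :: (real^'d) measure))"
      by (intro nn_integral_mono ennreal_leI le)
    thus "(\<integral>\<^sup>+x. ennreal (cmod (layer l g x)) \<partial>torus) \<le> ennreal (a l)" by simp
  qed
  thus "AE x in torus. \<forall>L. cmod (g x - (\<Sum>l<L. layer l g x)) \<le> (\<Sum>l. a (l + L))"
  proof eventually_elim
    case (elim x)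
    show ?case
    proof
      fix L
      from sums_split_initial_segment[OF elim, of L]
      have "(\<Sum>l. layer (l + L) g x) = g x - (\<Sum>l<L. layer l g x)" by (rule sums_unique[symmetric])
      moreover have "cmod (\<Sum>l. layer (l + L) g x) \<le> (\<Sum>l. a (l + L))"
        using sm by (intro norm_suminf_le le) (simp add: summable_iff_shift)
      ultimately show "cmod (g x - (\<Sum>l<L. layer l g x)) \<le> (\<Sum>l. a (l + L))" by simp
    qed
  qed
qed

text \<open>
  The potential bounds the \<open>p\<close>-th moment at the cost of a factor \<open>(2 * p) powr p\<close>. After division
  by \<open>(m * \<eta>) powr p\<close>, where \<open>m * \<eta>\<close> has the order \<open>sqrt (m * p) / A\<close>, there remains the \<open>p\<close>-th power
  of a multiple of \<open>A * sqrt p / sqrt m\<close>.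
\<close>

lemma greedy_truncated:
  fixes c :: "int^'d::finite \<Rightarrow> complex"
  assumes F: "finite F" and A: "(\<Sum>k\<in>F. cmod (c k)) \<le> A" "0 < A" and p: "2 \<le> p" and m: "0 < m"
  shows "\<exists>t\<in>trig_polys m. A_norm t \<le> ennreal A \<and>
    pint p (\<lambda>x. tpoly F c x - t x) \<le> ennreal ((8 * exp 1 * A * sqrt p / sqrt m) powr p)"
proof (cases "(\<Sum>k\<in>F. cmod (c k)) = 0")
  case True
  hence "tpoly F c x = 0" for x using cmod_tpoly_le[of F c x] by simp
  moreover have "0 < p" using p by simp
  ultimately show ?thesis
    by (intro bexI[of _ "\<lambda>x. 0"] conjI zero_trig_polys) (simp_all add: A_norm_zero pint_def)
next
  case False
  define a where "a = (\<Sum>k\<in>F. cmod (c k))"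
  have a: "0 < a" "a \<le> A" using False A by (auto simp: a_def less_le sum_nonneg)
  \<comment> \<open>This scale turns the growth \<open>exp (m * (2 * a * \<eta>)\<^sup>2)\<close> of the potential into \<open>exp p\<close>.\<close>
  define \<eta> where "\<eta> = sqrt p / (2 * a * sqrt m)"
  have \<eta>: "0 < \<eta>" using p m a by (simp add: \<eta>_def)
  define X where "X = (\<lambda>k x. of_real a * sgn (c k) * expo k x - tpoly F c x)"
  obtain \<kappa> where \<kappa>: "\<forall>i<m. \<kappa> i \<in> F"
    "(\<integral>\<^sup>+x. ennreal (potential (of_real \<eta> * (\<Sum>i<m. X (\<kappa> i) x))) \<partial>torus) \<le> ennreal (2 * exp (real m * (2 * a * \<eta>)\<^sup>2))"
    using greedy_selection[OF F a_def a(1) \<eta>, of m] unfolding X_def by blast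
  have Xm [measurable]: "X k \<in> borel_measurable torus" for k unfolding X_def by measurable
  define d where "d = (\<lambda>i. of_real (a / m) * sgn (c (\<kappa> i)))"
  define t where "t = (\<lambda>x. \<Sum>i<m. d i * expo (\<kappa> i) x)"
  have t1: "t \<in> trig_polys m"
    unfolding t_def sum_expo_as_tpoly[OF finite_lessThan] using card_image_le[of "{..<m}" \<kappa>]
    by (intro trig_polysI) auto
  have t2: "A_norm t \<le> ennreal A"
  proof -
    have "A_norm t \<le> ennreal (\<Sum>i<m. cmod (d i))" unfolding t_def by (rule A_norm_sum_expo_le) simp
    also have "(\<Sum>i<m. cmod (d i)) \<le> (\<Sum>i<m. a / m)"
      using a by (intro sum_mono) (auto simp: d_def norm_mult norm_divide norm_sgn)
    hence "ennreal (\<Sum>i<m. cmod (d i)) \<le> ennreal a" using m by (intro ennreal_leI) simp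
    finally show ?thesis using a ennreal_leI[of a A] by (metis order_trans)
  qed
  have diff: "tpoly F c x - t x = of_real (1 / (m * \<eta>)) * - (of_real \<eta> * (\<Sum>i<m. X (\<kappa> i) x))" for x
  proof -
    have "(\<Sum>i<m. X (\<kappa> i) x) = of_nat m * (t x - tpoly F c x)"
      using m by (simp add: X_def t_def d_def sum_subtractf sum_distrib_left right_diff_distrib mult.assoc)
    thus ?thesis using m \<eta> by (simp add: field_simps)
  qed
  have "pint p (\<lambda>x. tpoly F c x - t x) =
      ennreal ((1 / (m * \<eta>)) powr p) * pint p (\<lambda>x. - (of_real \<eta> * (\<Sum>i<m. X (\<kappa> i) x)))"
    unfolding diff using m \<eta> by (intro pint_cmult) auto
  also have "pint p (\<lambda>x. - (of_real \<eta> * (\<Sum>i<m. X (\<kappa> i) x))) \<le>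
      (\<integral>\<^sup>+x. ennreal ((2 * p) powr p * 2) * ennreal (potential (of_real \<eta> * (\<Sum>i<m. X (\<kappa> i) x))) \<partial>torus)"
    unfolding pint_def
  proof (rule nn_integral_mono)
    fix x
    have "cmod (- (of_real \<eta> * (\<Sum>i<m. X (\<kappa> i) x))) powr p \<le>
        ((2 * p) powr p * 2) * potential (of_real \<eta> * (\<Sum>i<m. X (\<kappa> i) x))"
      using cmod_powr_le_potential[of p "of_real \<eta> * (\<Sum>i<m. X (\<kappa> i) x)"] p by (simp only: norm_minus_cancel) simp
    from ennreal_leI[OF this]
    show "ennreal (cmod (- (of_real \<eta> * (\<Sum>i<m. X (\<kappa> i) x))) powr p) \<le>
        ennreal ((2 * p) powr p * 2) * ennreal (potential (of_real \<eta> * (\<Sum>i<m. X (\<kappa> i) x)))"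
      by (simp only: ennreal_mult potential_nonneg powr_ge_zero mult_nonneg_nonneg zero_le_numeral)
  qed
  also have "\<dots> = ennreal ((2 * p) powr p * 2) * (\<integral>\<^sup>+x. ennreal (potential (of_real \<eta> * (\<Sum>i<m. X (\<kappa> i) x))) \<partial>torus)"
    by (rule nn_integral_cmult) measurable
  also have "\<dots> \<le> ennreal ((2 * p) powr p * 2) * ennreal (2 * exp (real m * (2 * a * \<eta>)\<^sup>2))"
    by (intro mult_left_mono \<kappa>) simp
  also have "real m * (2 * a * \<eta>)\<^sup>2 = p"
    using a m p by (simp add: \<eta>_def power_divide power_mult_distrib)
  also have "ennreal ((1 / (m * \<eta>)) powr p) * (ennreal ((2 * p) powr p * 2) * ennreal (2 * exp p)) =
      ennreal ((1 / (m * \<eta>)) powr p * ((2 * p) powr p * 2 * (2 * exp p)))"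
    by (simp add: ennreal_mult mult_ac)
  also have "\<dots> \<le> ennreal ((8 * exp 1 * A * sqrt p / sqrt m) powr p)"
  proof (rule ennreal_leI)
    have ep: "exp p = exp 1 powr p" by (simp add: powr_def)
    have "(2::real) powr 2 \<le> 2 powr p" using p by (intro powr_mono) auto
    hence four: "4 \<le> (2::real) powr p" by simp
    define Z where "Z = (1 / (m * \<eta>)) powr p * ((2 * p) powr p * exp 1 powr p)"
    have "(1 / (m * \<eta>)) powr p * ((2 * p) powr p * 2 * (2 * exp p)) = 4 * Z"
      unfolding ep Z_def by simp
    also have "\<dots> \<le> 2 powr p * Z" by (intro mult_right_mono four) (simp add: Z_def)
    also have "\<dots> = (1 / (m * \<eta>)) powr p * ((2 * p) powr p * 2 powr p * exp 1 powr p)"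
      by (simp add: Z_def mult_ac)
    also have "\<dots> = (1 / (m * \<eta>) * (2 * p * 2 * exp 1)) powr p"
    proof -
      have "0 \<le> 1 / (m * \<eta>)" "0 \<le> 2 * p" using p m \<eta> by simp_all
      thus ?thesis by (simp only: powr_mult mult_nonneg_nonneg zero_le_numeral exp_ge_zero mult.assoc)
    qed
    also have "1 / (m * \<eta>) * (2 * p * 2 * exp 1) = 8 * exp 1 * a * sqrt p / sqrt m"
    proof -
      define u v where "u = sqrt p" and "v = sqrt (real m)"
      have uv: "0 < u" "0 < v" "p = u\<^sup>2" "real m = v\<^sup>2" using p m by (simp_all add: u_def v_def)
      show ?thesis unfolding \<eta>_def u_def[symmetric] v_def[symmetric] unfolding uv(3,4)
        using uv(1,2) a by (simp add: field_simps power2_eq_square)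
    qed
    also have "\<dots> powr p \<le> (8 * exp 1 * A * sqrt p / sqrt m) powr p"
      using a p by (intro powr_mono2 divide_right_mono mult_right_mono mult_left_mono) auto
    finally show "(1 / (m * \<eta>)) powr p * ((2 * p) powr p * 2 * (2 * exp p)) \<le> (8 * exp 1 * A * sqrt p / sqrt m) powr p" .
  qed
  finally have "pint p (\<lambda>x. tpoly F c x - t x) \<le> ennreal ((8 * exp 1 * A * sqrt p / sqrt m) powr p)"
    by (simp add: mult_left_mono)
  with t1 t2 show ?thesis by blast
qed

text \<open>
  The function is truncated to so many layers that the discarded coefficients sum up to less
  than \<open>A / sqrt m\<close>, which is within the error allowed.
\<close>

lemma greedy_approximation:
  fixes g :: "'d::finite tfun"
  assumes g: "g \<in> L1_torus" and p: "2 \<le> p"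
  shows "\<exists>t\<in>trig_polys m. Lp_norm p (\<lambda>x. g x - t x)
      \<le> ennreal ((1 + 8 * exp 1) * real (max m 1) powr (- 1 / 2) * p powr (1 / 2)) * A_norm g \<and>
    A_norm t \<le> A_norm g"
proof (cases "A_norm g")
  case top
  have "0 < (1 + 8 * exp 1) * real (max m 1) powr (- 1 / 2) * p powr (1 / 2)"
    using p by (intro mult_pos_pos add_pos_pos) auto
  hence pos: "\<not> (1 + 8 * exp 1) * real (max m 1) powr (- 1 / 2) * p powr (1 / 2) \<le> 0" by (simp only: not_le)
  have "ennreal ((1 + 8 * exp 1) * real (max m 1) powr (- 1 / 2) * p powr (1 / 2)) * A_norm g = top"
    unfolding top ennreal_mult_top ennreal_eq_0_iff by (rule if_not_P[OF pos])
  thus ?thesis using top zero_trig_polys[of m] by auto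
next
  case (real A)
  have gi: "integrable torus g" using g by (simp add: L1_torus_def)
  have gm [measurable]: "g \<in> borel_measurable torus" using gi by simp
  have An: "A_norm g \<le> ennreal A" using real by simp
  note lt = layer_tails[OF gi An real(1)]
  define a where "a = (\<lambda>l. \<Sum>k\<in>layer_freqs l. cmod (fourier g k))"
  define c where "c = (1 + 8 * exp 1) * real (max m 1) powr (- 1 / 2) * p powr (1 / 2)"
  have sp: "1 \<le> p powr (1/2)" using p by (intro ge_one_powr_ge_zero) auto
  have c0: "0 \<le> c" using p by (simp add: c_def add_nonneg_nonneg)
  have fin: "Lp_norm p f \<le> ennreal c * A_norm g" if "pint p f \<le> ennreal ((c * A) powr p)" for f
    using that p c0 real by (simp add: ennreal_mult[symmetric] Lp_norm_le_iff)
  show ?thesis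
  proof (cases "m = 0 \<or> A = 0")
    case True
    have "AE x in torus. cmod (g x - 0) \<le> c * A"
      using lt(3)
    proof eventually_elim
      case (elim x)
      have "cmod (g x) \<le> suminf a" using spec[OF elim, of 0] by (simp add: a_def)
      also have "\<dots> \<le> A" using lt(2) by (simp add: a_def)
      also have "\<dots> \<le> c * A"
      proof (cases "A = 0")
        case False
        hence "m = 0" using True by simp
        have "1 * 1 \<le> (1 + 8 * exp 1) * p powr (1 / 2)" by (intro mult_mono sp) auto
        hence "1 \<le> c" using \<open>m = 0\<close> by (simp add: c_def)
        thus ?thesis using real by (simp add: mult_le_cancel_right1)
      qed simp
      finally show ?case by simp
    qed
    hence "Lp_norm p (\<lambda>x. g x - 0) \<le> ennreal c * A_norm g"
      using p by (intro fin pint_le_AE_bound) auto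
    thus ?thesis using zero_trig_polys[of m] unfolding c_def[symmetric]
      by (intro bexI[of _ "\<lambda>x. 0"]) (auto simp: A_norm_zero)
  next
    case False
    hence m: "0 < m" and A: "0 < A" using real by auto
    define \<delta> where "\<delta> = A / sqrt m"
    have \<delta>: "0 < \<delta>" using A m by (simp add: \<delta>_def)
    have sa: "summable a" using lt(1) by (simp add: a_def)
    obtain L where "\<forall>n\<ge>L. norm (\<Sum>l. a (l + n)) < \<delta>"
      using suminf_exist_split[OF \<delta> sa] by blast
    hence "norm (\<Sum>l. a (l + L)) < \<delta>" by blast
    hence L: "(\<Sum>l. a (l + L)) < \<delta>" by simp
    define F where "F = (\<Union>l<L. layer_freqs l :: (int^'d) set)"
    have SL: "(\<Sum>l<L. layer l g x) = tpoly F (fourier g) x" for x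
      unfolding F_def by (rule sum_layers_eq) simp
    have finF: "finite F" by (simp add: F_def)
    have "ennreal (\<Sum>k\<in>F. cmod (fourier g k)) \<le> ennreal A"
      using sum_fourier_le_A_norm[OF finF, of g] real by simp
    hence AF: "(\<Sum>k\<in>F. cmod (fourier g k)) \<le> A" using real by simp
    obtain t where t: "t \<in> trig_polys m" "A_norm t \<le> ennreal A"
      "pint p (\<lambda>x. tpoly F (fourier g) x - t x) \<le> ennreal ((8 * exp 1 * A * sqrt p / sqrt m) powr p)"
      using greedy_truncated[OF finF AF A p m] by blast
    have tm: "t \<in> borel_measurable torus" by (rule trig_polys_measurable[OF t(1)])
    have "pint p (\<lambda>x. g x - tpoly F (fourier g) x) \<le> ennreal (\<delta> powr p)"
    proof (rule pint_le_AE_bound)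
      show "AE x in torus. cmod (g x - tpoly F (fourier g) x) \<le> \<delta>"
        using lt(3)
      proof eventually_elim
        case (elim x)
        from spec[OF this, of L] L show ?case by (simp add: SL a_def)
      qed
    qed (use p in simp)
    hence "pint p (\<lambda>x. (g x - tpoly F (fourier g) x) + (tpoly F (fourier g) x - t x)) \<le>
        ennreal ((\<delta> + 8 * exp 1 * A * sqrt p / sqrt m) powr p)"
      using p \<delta> A m t tm by (intro Minkowski_torus_add) auto
    also have "\<dots> \<le> ennreal ((c * A) powr p)"
    proof (intro ennreal_leI powr_mono2)
      have "1 / sqrt m = real (max m 1) powr (- 1 / 2)"
        using m by (simp add: max_def powr_minus powr_half_sqrt inverse_eq_divide)
      moreover have "sqrt p = p powr (1/2)" using p by (simp add: powr_half_sqrt)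
      ultimately have "c * A = (1 + 8 * exp 1) * (1 / sqrt m) * sqrt p * A" by (simp add: c_def)
      also have "\<dots> = \<delta> * sqrt p + 8 * exp 1 * A * sqrt p / sqrt m"
        by (simp only: \<delta>_def distrib_right add_divide_distrib mult_1_left) (simp add: mult_ac)
      also have "\<dots> \<ge> \<delta> + 8 * exp 1 * A * sqrt p / sqrt m"
        using \<delta> p by (simp add: real_le_rsqrt mult_le_cancel_left1)
      finally show "\<delta> + 8 * exp 1 * A * sqrt p / sqrt m \<le> c * A" .
    qed (use p \<delta> A in auto)
    finally have "Lp_norm p (\<lambda>x. g x - t x) \<le> ennreal c * A_norm g" by (intro fin) simp
    thus ?thesis using t real unfolding c_def[symmetric] by auto
  qed
qed

theorem greedy_methods_exist:
  "\<exists>C1>0. \<exists>C2>0. \<exists>G :: real \<Rightarrow> nat \<Rightarrow> 'd::finite tfun \<Rightarrow> 'd tfun. greedy_methods C1 C2 G"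
proof -
  define C where "C = (1 + 8 * exp (1::real))"
  define G where "G = (\<lambda>p m (g :: 'd tfun). SOME t. t \<in> trig_polys m \<and> Lp_norm p (\<lambda>x. g x - t x)
      \<le> ennreal (C * real (max m 1) powr (- 1 / 2) * p powr (1 / 2)) * A_norm g \<and>
    A_norm t \<le> A_norm g)"
  have "greedy_methods C 1 G"
    unfolding greedy_methods_def
  proof (intro allI impI ballI)
    fix p :: real and m and g :: "'d tfun" assume "2 \<le> p" "g \<in> L1_torus"
    hence "\<exists>t. t \<in> trig_polys m \<and> Lp_norm p (\<lambda>x. g x - t x)
      \<le> ennreal (C * real (max m 1) powr (- 1 / 2) * p powr (1 / 2)) * A_norm g \<and>
      A_norm t \<le> A_norm g"
      using greedy_approximation[of g p m] unfolding C_def by blast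
    from someI_ex[OF this]
    show "G p m g \<in> trig_polys m \<and> Lp_norm p (\<lambda>x. g x - G p m g x)
      \<le> ennreal (C * real (max m 1) powr (- 1 / 2) * p powr (1 / 2)) * A_norm g \<and>
      A_norm (G p m g) \<le> ennreal 1 * A_norm g"
      unfolding G_def by simp
  qed
  moreover have "0 < C" by (simp add: C_def add_pos_pos)
  ultimately show ?thesis by (intro exI[of _ C] exI[of _ 1] exI[of _ G] conjI) simp_all
qed

section \<open>The upper bound\<close>

lemma powr_le_two_powr: "\<exists>K>0. \<forall>l::nat. real (max l 1) powr G \<le> K * 2 powr (real l / 4)"
proof -
  have "(\<lambda>l::nat. real l powr G / 2 powr (real l / 4)) \<longlonglongrightarrow> 0" by real_asymp
  hence "Bseq (\<lambda>l::nat. real l powr G / 2 powr (real l / 4))"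
    by (intro convergent_imp_Bseq) (auto simp: convergent_def)
  then obtain K where K: "0 < K" "\<And>l. norm (real l powr G / 2 powr (real l / 4)) \<le> K"
    by (auto elim: BseqE)
  have "real (max l 1) powr G \<le> (K + 1) * 2 powr (real l / 4)" for l
  proof (cases "l = 0")
    case False
    have "real l powr G \<le> K * 2 powr (real l / 4)"
      using K(2)[of l] by (simp add: pos_divide_le_eq)
    also have "\<dots> \<le> (K + 1) * 2 powr (real l / 4)" by (intro mult_right_mono) auto
    finally have "real l powr G \<le> (K + 1) * 2 powr (real l / 4)" .
    moreover have "max l 1 = l" using False by simp
    ultimately show ?thesis by simp
  qed (use K in simp)
  thus ?thesis using K(1) by (intro exI[of _ "K + 1"]) auto
qed

lemma pint_layer_W:
  fixes f :: "'d::finite tfun"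
  assumes "f \<in> W_class a b q" "0 < q"
  shows "pint q (layer l f) \<le>
    ennreal ((2 powr (- a * real l) * real (max l 1) powr ((real CARD('d) - 1) * b)) powr q)"
  using assms by (subst Lp_norm_le_iff[symmetric]) (auto simp: W_class_def)

text \<open>
  For the smoothness \<open>1 / q\<close> the factors \<open>2 powr (real l / q)\<close> and \<open>2 powr (- real l / q)\<close> cancel:
  all layers have \<open>A\<close>-norms of the same size up to powers of \<open>l\<close>.
\<close>

lemma W_layer_A:
  assumes q: "1 < q" "q \<le> 2"
  shows "\<exists>C>0. \<forall>f\<in>(W_class (1 / q) b q :: 'd::finite tfun set). \<forall>l.
    (\<Sum>k\<in>layer_freqs l. cmod (fourier f k)) \<le> C * real (max l 1) powr ((real CARD('d) - 1) * (b + 1 - 1 / q))"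
proof -
  let ?D = "real CARD('d) - 1"
  define e where "e = ?D * (1 - 1 / q)"
  have D: "0 \<le> ?D" by (simp add: Suc_leI)
  have e: "0 \<le> e" using q D by (simp add: e_def)
  obtain C where C: "0 < C" "\<And>l (f :: 'd tfun) M. 0 < M \<Longrightarrow> pint q (layer l f) \<le> ennreal (M powr q) \<Longrightarrow>
    (\<Sum>k\<in>layer_freqs l. cmod (fourier f k)) \<le> M * (C * 2 powr (real l / q) * real (l + 1) powr e)"
    using sum_fourier_layer_le[OF q, where 'd='d] unfolding e_def by blast
  have "(\<Sum>k\<in>layer_freqs l. cmod (fourier f k)) \<le> (C * 2 powr e) * real (max l 1) powr (?D * (b + 1 - 1 / q))"
    if f: "f \<in> W_class (1 / q) b q" for f :: "'d tfun" and l
  proof -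
    define L where "L = real (max l 1)"
    have L: "0 < L" "real (l + 1) \<le> 2 * L" by (auto simp: L_def)
    have "(\<Sum>k\<in>layer_freqs l. cmod (fourier f k)) \<le>
        (2 powr (- (1 / q) * real l) * L powr (?D * b)) * (C * 2 powr (real l / q) * real (l + 1) powr e)"
      using pint_layer_W[OF f, of l] q L by (intro C(2)) (auto simp: L_def)
    also have "\<dots> \<le> (2 powr (- (1 / q) * real l) * L powr (?D * b)) * (C * 2 powr (real l / q) * (2 * L) powr e)"
      using L C e by (intro mult_left_mono powr_mono2) auto
    also have "\<dots> = C * 2 powr e * (2 powr (- (1 / q) * real l) * 2 powr (real l / q)) * (L powr (?D * b) * L powr e)"
      using L by (simp add: powr_mult)
    also have "2 powr (- (1 / q) * real l) * 2 powr (real l / q) = 1" by (simp add: powr_add[symmetric])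
    also have "L powr (?D * b) * L powr e = L powr (?D * (b + 1 - 1 / q))"
      by (simp add: powr_add[symmetric] e_def algebra_simps)
    finally show ?thesis by (simp add: L_def)
  qed
  moreover have "0 < C * 2 powr e" using C by simp
  ultimately show ?thesis by blast
qed

text \<open>
  The modulus of a layer is at most its \<open>A\<close>-norm, which is bounded by a power of \<open>l\<close>. The \<open>p - q\<close>
  superfluous factors in the integrand are bounded by it, and the \<open>q\<close>-th power of the \<open>L\<^sub>q\<close> norm
  contributes the decay \<open>2 powr (- real l)\<close>. A quarter of this decay absorbs the powers of \<open>l\<close>.
\<close>

lemma W_layer_pint:
  assumes q: "1 < q" "q \<le> 2" and p: "2 < p"
  shows "\<exists>K>0. \<forall>f\<in>(W_class (1 / q) b q :: 'd::finite tfun set). \<forall>l.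
    pint p (layer l f) \<le> ennreal ((K * (2 powr (- 3 / (4 * p))) ^ l) powr p)"
proof -
  let ?D = "real CARD('d) - 1"
  define E where "E = ?D * (b + 1 - 1 / q)"
  define G where "G = E * (p - q) + ?D * b * q"
  obtain C where C: "0 < C" "\<And>f l. f \<in> (W_class (1 / q) b q :: 'd tfun set) \<Longrightarrow>
    (\<Sum>k\<in>layer_freqs l. cmod (fourier f k)) \<le> C * real (max l 1) powr E"
    using W_layer_A[OF q, where 'd='d, of b] unfolding E_def by blast
  obtain K where K: "0 < K" "\<And>l::nat. real (max l 1) powr G \<le> K * 2 powr (real l / 4)"
    using powr_le_two_powr by blast
  define K' where "K' = (C powr (p - q) * K) powr (1 / p)"
  have "pint p (layer l f) \<le> ennreal ((K' * (2 powr (- 3 / (4 * p))) ^ l) powr p)"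
    if f: "f \<in> (W_class (1 / q) b q :: 'd tfun set)" for f l
  proof -
    define L where "L = real (max l 1)"
    have L: "0 < L" by (auto simp: L_def)
    define A where "A = C * L powr E"
    have le: "cmod (layer l f x) \<le> A" for x
      using C(2)[OF f, of l] cmod_tpoly_le[of "layer_freqs l" "fourier f" x] by (simp add: layer_eq A_def L_def)
    have A: "0 < A" using C L by (simp add: A_def)
    define M where "M = 2 powr (- (1 / q) * real l) * L powr (?D * b)"
    have [measurable]: "layer l f \<in> borel_measurable torus" by (simp add: layer_eq)
    have "pint p (layer l f) \<le> (\<integral>\<^sup>+x. ennreal (A powr (p - q)) * ennreal (cmod (layer l f x) powr q) \<partial>torus)"
      unfolding pint_def
    proof (rule nn_integral_mono)
      fix x
      have "cmod (layer l f x) powr p = cmod (layer l f x) powr (p - q) * cmod (layer l f x) powr q"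
        by (simp add: powr_add[symmetric])
      also have "\<dots> \<le> A powr (p - q) * cmod (layer l f x) powr q"
        using p q le by (intro mult_right_mono powr_mono2) auto
      finally show "ennreal (cmod (layer l f x) powr p) \<le> ennreal (A powr (p - q)) * ennreal (cmod (layer l f x) powr q)"
        by (simp add: ennreal_mult[symmetric] ennreal_leI)
    qed
    also have "\<dots> = ennreal (A powr (p - q)) * pint q (layer l f)"
      unfolding pint_def by (rule nn_integral_cmult) measurable
    also have "\<dots> \<le> ennreal (A powr (p - q)) * ennreal (M powr q)"
      unfolding M_def L_def using pint_layer_W[OF f] q by (intro mult_left_mono) auto
    also have "\<dots> = ennreal (A powr (p - q) * M powr q)" by (simp add: ennreal_mult)
    also have "A powr (p - q) * M powr q = C powr (p - q) * (L powr G) * 2 powr (- real l)"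
      using C L q by (simp add: A_def M_def G_def powr_mult powr_powr powr_add)
    also have "\<dots> \<le> C powr (p - q) * (K * 2 powr (real l / 4)) * 2 powr (- real l)"
      unfolding L_def by (intro mult_right_mono mult_left_mono K) auto
    also have "\<dots> = (K' * (2 powr (- 3 / (4 * p))) ^ l) powr p"
    proof -
      have "(2 powr (- 3 / (4 * p))) ^ l = 2 powr (- 3 / (4 * p) * real l)"
        by (simp add: powr_powr powr_realpow[symmetric])
      hence "((2 powr (- 3 / (4 * p))) ^ l) powr p = 2 powr (- 3 / 4 * real l)"
        using p by (simp add: powr_powr)
      moreover have "K' powr p = C powr (p - q) * K" using p C K by (simp add: K'_def powr_powr)
      ultimately have "(K' * (2 powr (- 3 / (4 * p))) ^ l) powr p = (C powr (p - q) * K) * 2 powr (- 3 / 4 * real l)"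
        by (simp only: powr_mult)
      moreover have "2 powr (real l / 4) * 2 powr (- real l) = 2 powr (- 3 / 4 * real l)"
        by (simp add: powr_add[symmetric])
      ultimately show ?thesis by (simp add: mult_ac)
    qed
    finally show ?thesis by (simp add: ennreal_leI)
  qed
  moreover have "0 < K'" using C K by (simp add: K'_def)
  ultimately show ?thesis by blast
qed

lemma W_tail:
  assumes q: "1 < q" "q \<le> 2" and p: "2 < p"
  shows "\<exists>K>0. \<forall>f\<in>(W_class (1 / q) b q :: 'd::finite tfun set). \<forall>N.
    pint p (\<lambda>x. f x - (\<Sum>l<N. layer l f x)) \<le> ennreal ((K * 2 powr (- 3 / (4 * p) * real N)) powr p)"
proof -
  define \<rho> where "\<rho> = 2 powr (- 3 / (4 * p))"
  have \<rho>: "0 < \<rho>" "\<rho> < 1"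
    using p powr_less_mono[of "- 3 / (4 * p)" 0 2] by (simp_all add: \<rho>_def)
  obtain K where K: "0 < K" "\<And>f l. f \<in> (W_class (1 / q) b q :: 'd tfun set) \<Longrightarrow>
    pint p (layer l f) \<le> ennreal ((K * \<rho> ^ l) powr p)"
    using W_layer_pint[OF assms, where 'd='d, of b] unfolding \<rho>_def by blast
  have sm: "summable (\<lambda>l. K * \<rho> ^ l)" using \<rho> by (intro summable_mult summable_geometric) auto
  have "pint p (\<lambda>x. f x - (\<Sum>l<N. layer l f x)) \<le> ennreal ((K / (1 - \<rho>) * 2 powr (- 3 / (4 * p) * real N)) powr p)"
    if f: "f \<in> (W_class (1 / q) b q :: 'd tfun set)" for f N
  proof -
    have "integrable torus f" using f by (simp add: W_class_def L1_torus_def)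
    hence "pint p (\<lambda>x. f x - (\<Sum>l<N. layer l f x)) \<le> ennreal ((\<Sum>l. K * \<rho> ^ (l + N)) powr p)"
      using p K \<rho> f sm by (intro pint_tail_le) auto
    also have "(\<Sum>l. K * \<rho> ^ (l + N)) = (\<Sum>l. (K * \<rho> ^ N) * \<rho> ^ l)" by (simp add: power_add mult_ac)
    also have "\<dots> = (K * \<rho> ^ N) * (1 / (1 - \<rho>))"
      using \<rho> by (subst suminf_mult) (auto simp: suminf_geometric)
    also have "\<rho> ^ N = 2 powr (- 3 / (4 * p) * real N)"
      by (simp add: \<rho>_def powr_powr powr_realpow[symmetric])
    finally show ?thesis by simp
  qed
  moreover have "0 < K / (1 - \<rho>)" using K \<rho> by simp
  ultimately show ?thesis by blast
qed

lemma card_hyperbolic_cross: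
  "real (card (\<Union>l<n. layer_freqs l :: (int^'d::finite) set)) \<le> 2 ^ CARD('d) * 2 powr real n * (real n + 1) powr real CARD('d)"
proof -
  have "card (\<Union>l<n. layer_freqs l :: (int^'d) set) \<le> (\<Sum>l<n. card (layer_freqs l :: (int^'d) set))"
    by (rule card_UN_le) simp
  also have "\<dots> \<le> (\<Sum>l<n. 2 ^ CARD('d) * 2 ^ l * (n + 1) ^ CARD('d))"
  proof (rule sum_mono)
    fix l assume l: "l \<in> {..<n}"
    have "(l + 1) ^ (CARD('d) - 1) \<le> (n + 1) ^ (CARD('d) - 1)" using l by (intro power_mono) auto
    also have "\<dots> \<le> (n + 1) ^ CARD('d)" by (intro power_increasing) auto
    finally show "card (layer_freqs l :: (int^'d) set) \<le> 2 ^ CARD('d) * 2 ^ l * (n + 1) ^ CARD('d)"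
      using card_layer_freqs_le[where 'd='d, of l] by (meson le_trans mult_le_mono2)
  qed
  also have "\<dots> = 2 ^ CARD('d) * (\<Sum>l<n. 2 ^ l) * (n + 1) ^ CARD('d)"
    by (simp add: sum_distrib_left sum_distrib_right)
  also have "(\<Sum>l<n. 2 ^ l) = 2 ^ n - (1 :: nat)" using sum_power2[of n] by (simp add: atLeast0LessThan)
  also have "2 ^ CARD('d) * (2 ^ n - (1 :: nat)) * (n + 1) ^ CARD('d) \<le> 2 ^ CARD('d) * 2 ^ n * (n + 1) ^ CARD('d)"
    by (intro mult_right_mono mult_left_mono) auto
  finally have "real (card (\<Union>l<n. layer_freqs l :: (int^'d) set)) \<le> real (2 ^ CARD('d) * 2 ^ n * (n + 1) ^ CARD('d))"
    by (simp only: of_nat_le_iff)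
  also have "\<dots> = 2 ^ CARD('d) * 2 powr real n * (real n + 1) powr real CARD('d)"
    by (simp add: powr_realpow[symmetric] add.commute)
  finally show ?thesis .
qed

lemma powr_between:
  fixes c c' x y E :: real
  assumes "0 < c" "0 < c'" "0 < x" "c * x \<le> y" "y \<le> c' * x"
  shows "y powr E \<le> (c powr E + c' powr E) * x powr E"
proof (cases "0 \<le> E")
  case True
  have "0 \<le> y" using assms mult_pos_pos[of c x] by linarith
  hence "y powr E \<le> (c' * x) powr E" using True assms by (intro powr_mono2) auto
  also have "\<dots> = c' powr E * x powr E" using assms by (simp add: powr_mult)
  also have "\<dots> \<le> (c powr E + c' powr E) * x powr E" by (intro mult_right_mono) auto
  finally show ?thesis .
next
  case False
  have "y powr E \<le> (c * x) powr E" using False assms by (intro powr_mono2') auto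
  also have "\<dots> = c powr E * x powr E" using assms by (simp add: powr_mult)
  also have "\<dots> \<le> (c powr E + c' powr E) * x powr E" by (intro mult_right_mono) auto
  finally show ?thesis .
qed

inductive_cases produces_PlusE: "produces G f (Plus A B) g"
inductive_cases produces_MinusE: "produces G f (Minus A B) g"
inductive_cases produces_GreedyE: "produces G f (Greedy p m A) g"
inductive_cases produces_Partial_SumE: "produces G f (Partial_Sum n) g"

text \<open>
  Up to logarithms, the layers below this level have at most \<open>sqrt m\<close> frequencies.
\<close>

definition low_level :: "nat \<Rightarrow> nat" where
  "low_level m = nat \<lfloor>log 2 (real m) / 2\<rfloor>"

text \<open>
  At this level the bound of \<open>W_tail\<close> is at most a multiple of \<open>m powr (- 3 / 4)\<close>. Both levels
  are proportional to \<open>log m\<close>, so all powers \<open>l powr E\<close> between them are comparable.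
\<close>

definition high_level :: "real \<Rightarrow> nat \<Rightarrow> nat" where
  "high_level p m = nat \<lceil>p * log 2 (real m)\<rceil>"

definition layered_greedy :: "real \<Rightarrow> nat \<Rightarrow> procedure" where
  "layered_greedy p m = Plus (Partial_Sum (low_level m))
     (Greedy p (m div 2) (Minus (Partial_Sum (high_level p m)) (Partial_Sum (low_level m))))"

lemma produces_layered_greedy:
  assumes "produces G f (layered_greedy p m) g"
  shows "g = (\<lambda>x. (\<Sum>l<low_level m. layer l f x) +
    G p (m div 2) (\<lambda>x. (\<Sum>l<high_level p m. layer l f x) - (\<Sum>l<low_level m. layer l f x)) x)"
  using assms unfolding layered_greedy_def
  by (auto elim!: produces_PlusE produces_MinusE produces_GreedyE produces_Partial_SumE)

lemma eventually_levels:
  assumes p: "2 < p"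
  shows "\<forall>\<^sub>F m in sequentially.
    2 \<le> m \<and> 1 \<le> ln (real m) \<and> low_level m \<le> high_level p m \<and> 1 \<le> low_level m \<and>
    ln (real m) / (4 * ln 2) \<le> real (low_level m) \<and>
    real (high_level p m) \<le> 2 * p / ln 2 * ln (real m) \<and>
    real (card (\<Union>l<low_level m. layer_freqs l :: (int^'d::finite) set)) \<le> real m / 2 \<and>
    2 powr (- 3 / (4 * p) * real (high_level p m)) \<le> real m powr (- 1 / 2) * ln (real m) powr E"
proof -
  have e1: "\<forall>\<^sub>F m::nat in sequentially. 2 \<le> m" by (rule eventually_ge_at_top)
  have e2: "\<forall>\<^sub>F m::nat in sequentially. 4 * ln 2 + 1 \<le> ln (real m)" by real_asymp
  have e3: "\<forall>\<^sub>F m::nat in sequentially. 2 ^ CARD('d) * real m powr (1 / 2) * (log 2 (real m) + 1) powr real CARD('d) \<le> real m / 2"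
    by real_asymp
  have e4: "\<forall>\<^sub>F m::nat in sequentially. real m powr (- 3 / 4) \<le> real m powr (- 1 / 2) * ln (real m) powr E"
    by real_asymp
  show ?thesis using e1 e2 e3 e4
  proof eventually_elim
    case (elim m)
    define x where "x = log 2 (real m)"
    have l2: "0 < ln (2::real)" by simp
    have xl: "ln (real m) = x * ln 2" using elim by (simp add: x_def log_def)
    have "4 * ln 2 \<le> x * ln 2" using elim(2) xl by linarith
    hence x4: "4 \<le> x" using l2 by (simp only: mult_le_cancel_right_pos)
    have n: "real (low_level m) \<le> x / 2" "x / 2 - 1 \<le> real (low_level m)"
      using x4 by (simp_all add: low_level_def x_def[symmetric]) linarith+
    have px: "2 * 4 \<le> p * x" using p x4 by (intro mult_mono) auto
    have px2: "2 * x \<le> p * x" using p x4 by (intro mult_right_mono) auto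
    have N: "p * x \<le> real (high_level p m)" "real (high_level p m) \<le> p * x + 1"
      using px by (simp_all add: high_level_def x_def[symmetric])
    have m2: "2 powr x = real m" using elim by (simp add: x_def)
    have c1: "real (low_level m) \<le> real (high_level p m)" using n N px2 x4 by linarith
    have c2: "1 \<le> real (low_level m)" using n x4 by linarith
    have c3: "ln (real m) / (4 * ln 2) \<le> real (low_level m)"
      unfolding xl using n x4 by simp
    have c4: "real (high_level p m) \<le> 2 * p / ln 2 * ln (real m)"
      unfolding xl using N px by simp
    have c5: "real (card (\<Union>l<low_level m. layer_freqs l :: (int^'d) set)) \<le> real m / 2"
    proof -
      have "real (card (\<Union>l<low_level m. layer_freqs l :: (int^'d) set)) \<le>
          2 ^ CARD('d) * 2 powr real (low_level m) * (real (low_level m) + 1) powr real CARD('d)"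
        by (rule card_hyperbolic_cross)
      also have "\<dots> \<le> 2 ^ CARD('d) * 2 powr (x / 2) * (x + 1) powr real CARD('d)"
        using n x4 by (intro mult_mono powr_mono powr_mono2) auto
      also have "2 powr (x / 2) = real m powr (1 / 2)" unfolding m2[symmetric] by (simp add: powr_powr)
      also have "2 ^ CARD('d) * real m powr (1 / 2) * (x + 1) powr real CARD('d) \<le> real m / 2"
        using elim by (simp add: x_def)
      finally show ?thesis .
    qed
    have c6: "2 powr (- 3 / (4 * p) * real (high_level p m)) \<le> real m powr (- 1 / 2) * ln (real m) powr E"
    proof -
      have "2 powr (- 3 / (4 * p) * real (high_level p m)) \<le> 2 powr (- 3 / (4 * p) * (p * x))"
        using N p by (intro powr_mono mult_left_mono_neg) auto
      also have "- 3 / (4 * p) * (p * x) = x * (- 3 / 4)" using p by simp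
      also have "2 powr (x * (- 3 / 4)) = real m powr (- 3 / 4)" unfolding m2[symmetric] by (simp add: powr_powr)
      also have "\<dots> \<le> real m powr (- 1 / 2) * ln (real m) powr E" using elim by simp
      finally show ?thesis .
    qed
    have "1 \<le> ln (real m)" using elim l2 by linarith
    thus ?case using elim c1 c2 c3 c4 c5 c6 by simp
  qed
qed

text \<open>
  The band between the two levels consists of at most a multiple of \<open>log m\<close> layers with \<open>A\<close>-norms
  of the order \<open>ln m powr E\<close>. The greedy method divides the total by \<open>sqrt m\<close>.
\<close>

theorem layered_greedy_upper_bound:
  fixes p q b :: real
  assumes q: "1 < q" "q \<le> 2" and p: "2 < p"
  defines "E \<equiv> (real CARD('d::finite) - 1) * (b + 1 - 1 / q)"
  assumes C1: "0 < C1"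
  shows "\<exists>C>0. \<forall>\<^sub>F m in sequentially.
    \<forall>(G :: real \<Rightarrow> nat \<Rightarrow> 'd tfun \<Rightarrow> 'd tfun) f g.
      greedy_methods C1 C2 G \<longrightarrow> f \<in> W_class (1 / q) b q \<longrightarrow> produces G f (layered_greedy p m) g \<longrightarrow>
        g \<in> trig_polys m \<and>
        Lp_norm p (\<lambda>x. f x - g x) \<le> ennreal (C * (real m powr (- 1 / 2) * ln (real m) powr (E + 1)))"
proof -
  obtain C where C: "0 < C" "\<And>f l. f \<in> (W_class (1 / q) b q :: 'd tfun set) \<Longrightarrow>
    (\<Sum>k\<in>layer_freqs l. cmod (fourier f k)) \<le> C * real (max l 1) powr E"
    using W_layer_A[OF q, where 'd='d, of b] unfolding E_def by blast
  obtain K where K: "0 < K" "\<And>f N. f \<in> (W_class (1 / q) b q :: 'd tfun set) \<Longrightarrow>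
    pint p (\<lambda>x. f x - (\<Sum>l<N. layer l f x)) \<le> ennreal ((K * 2 powr (- 3 / (4 * p) * real N)) powr p)"
    using W_tail[OF q p, where 'd='d, of b] by blast
  define u where "u = 1 / (4 * ln (2::real))"
  define v where "v = 2 * p / ln (2::real)"
  have uv: "0 < u" "0 < v" using p by (simp_all add: u_def v_def)
  define S where "S = v * (C * (u powr E + v powr E))"
  have S: "0 < S" using uv C by (simp add: S_def add_pos_pos)
  define T where "T = C1 * 2 * p powr (1 / 2) * S"
  have T: "0 < T" using C1 S p by (simp add: T_def)
  have "\<forall>\<^sub>F m in sequentially.
    \<forall>(G :: real \<Rightarrow> nat \<Rightarrow> 'd tfun \<Rightarrow> 'd tfun) f g.
      greedy_methods C1 C2 G \<longrightarrow> f \<in> W_class (1 / q) b q \<longrightarrow> produces G f (layered_greedy p m) g \<longrightarrow>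
        g \<in> trig_polys m \<and>
        Lp_norm p (\<lambda>x. f x - g x) \<le> ennreal ((K + T) * (real m powr (- 1 / 2) * ln (real m) powr (E + 1)))"
    using eventually_levels[OF p, where 'd='d, of "E + 1"]
  proof eventually_elim
    case (elim m)
    define n where "n = low_level m"
    define N where "N = high_level p m"
    define B where "B = real m powr (- 1 / 2) * ln (real m) powr (E + 1)"
    have m: "2 \<le> m" "1 \<le> ln (real m)" and nN: "n \<le> N" "1 \<le> n" "u * ln (real m) \<le> real n" "real N \<le> v * ln (real m)"
      and cd: "real (card (\<Union>l<n. layer_freqs l :: (int^'d) set)) \<le> real m / 2"
      and tail: "2 powr (- 3 / (4 * p) * real N) \<le> B"
      using elim by (simp_all add: n_def N_def u_def v_def B_def)
    have B: "0 < B" using m by (auto simp: B_def)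
    show ?case
    proof (intro allI impI)
      fix G :: "real \<Rightarrow> nat \<Rightarrow> 'd tfun \<Rightarrow> 'd tfun" and f g
      assume G: "greedy_methods C1 C2 G" and f: "f \<in> W_class (1 / q) b q" and g: "produces G f (layered_greedy p m) g"
      define Q where "Q = (\<Union>l\<in>{n..<N}. layer_freqs l :: (int^'d) set)"
      define h where "h = tpoly Q (fourier f)"
      define t where "t = G p (m div 2) h"
      have fi: "integrable torus f" using f by (simp add: W_class_def L1_torus_def)
      have fm: "f \<in> borel_measurable torus" using fi by simp
      have hx: "(\<Sum>l<N. layer l f x) - (\<Sum>l<n. layer l f x) = h x" for x
      proof -
        have "(\<Sum>l<N. layer l f x) - (\<Sum>l<n. layer l f x) = (\<Sum>l\<in>{n..<N}. layer l f x)"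
          using nN sum_diff_nat_ivl[of 0 n N "\<lambda>l. layer l f x"] by (simp add: atLeast0LessThan)
        thus ?thesis unfolding h_def Q_def by (simp add: sum_layers_eq)
      qed
      have gx: "g = (\<lambda>x. (\<Sum>l<n. layer l f x) + t x)"
        using produces_layered_greedy[OF g] by (simp add: hx t_def n_def[symmetric] N_def[symmetric])
      have "h \<in> L1_torus" unfolding h_def by (rule tpoly_L1)
      with G p have t1: "t \<in> trig_polys (m div 2)"
        and t2: "Lp_norm p (\<lambda>x. h x - t x) \<le> ennreal (C1 * real (max (m div 2) 1) powr (- 1 / 2) * p powr (1 / 2)) * A_norm h"
        unfolding greedy_methods_def t_def by auto
      have "g \<in> trig_polys m"
      proof -
        have "card (\<Union>l<n. layer_freqs l :: (int^'d) set) \<le> m - m div 2" using cd by linarith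
        hence "(\<lambda>x. \<Sum>l<n. layer l f x) \<in> trig_polys (m - m div 2)"
          by (simp add: sum_layers_eq trig_polysI)
        from trig_polys_add[OF this t1] show ?thesis unfolding gx by simp
      qed
      moreover have "Lp_norm p (\<lambda>x. f x - g x) \<le> ennreal ((K + T) * B)"
      proof -
        have "A_norm h = ennreal (\<Sum>k\<in>Q. cmod (fourier f k))"
          unfolding h_def by (rule A_norm_tpoly) (simp add: Q_def)
        also have "(\<Sum>k\<in>Q. cmod (fourier f k)) = (\<Sum>l\<in>{n..<N}. \<Sum>k\<in>layer_freqs l. cmod (fourier f k))"
          unfolding Q_def by (rule sum.UNION_disjoint) (auto dest: layer_freqs_disjoint)
        also have "\<dots> \<le> (\<Sum>l\<in>{n..<N}. C * ((u powr E + v powr E) * ln (real m) powr E))"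
        proof (rule sum_mono)
          fix l assume l: "l \<in> {n..<N}"
          hence "max l 1 = l" "u * ln (real m) \<le> real l" "real l \<le> v * ln (real m)" using nN by auto
          hence "real (max l 1) powr E \<le> (u powr E + v powr E) * ln (real m) powr E"
            using uv m by (intro powr_between) auto
          hence "C * real (max l 1) powr E \<le> C * ((u powr E + v powr E) * ln (real m) powr E)"
            using C by (intro mult_left_mono) auto
          thus "(\<Sum>k\<in>layer_freqs l. cmod (fourier f k)) \<le> C * ((u powr E + v powr E) * ln (real m) powr E)"
            using C(2)[OF f, of l] by linarith
        qed
        also have "\<dots> \<le> real N * (C * ((u powr E + v powr E) * ln (real m) powr E))"
          using C by (simp add: mult_right_mono add_nonneg_nonneg)
        also have "\<dots> \<le> v * ln (real m) * (C * ((u powr E + v powr E) * ln (real m) powr E))"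
          using nN C by (intro mult_right_mono) (auto intro!: mult_nonneg_nonneg add_nonneg_nonneg)
        also have "\<dots> = S * ln (real m) powr (E + 1)"
          using m by (simp add: S_def powr_add mult_ac)
        finally have An: "A_norm h \<le> ennreal (S * ln (real m) powr (E + 1))" by (simp add: ennreal_leI)
        have half: "real (max (m div 2) 1) powr (- 1 / 2) \<le> 2 * real m powr (- 1 / 2)"
        proof -
          have "real m / 4 \<le> real (max (m div 2) 1)" using m by linarith
          hence "real (max (m div 2) 1) powr (- 1 / 2) \<le> (real m / 4) powr (- 1 / 2)"
            using m by (intro powr_mono2') auto
          also have "\<dots> = real m powr (- 1 / 2) / 4 powr (- 1 / 2)" by (simp add: powr_divide)
          also have "4 powr (- 1 / 2) = (1 / 2 :: real)"
            by (simp add: powr_minus powr_half_sqrt)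
          finally show ?thesis by simp
        qed
        have "Lp_norm p (\<lambda>x. h x - t x) \<le> ennreal (C1 * real (max (m div 2) 1) powr (- 1 / 2) * p powr (1 / 2)) * ennreal (S * ln (real m) powr (E + 1))"
          by (rule order_trans[OF t2 mult_left_mono[OF An]]) simp
        also have "\<dots> = ennreal (C1 * real (max (m div 2) 1) powr (- 1 / 2) * p powr (1 / 2) * (S * ln (real m) powr (E + 1)))"
          using S C1 by (intro ennreal_mult[symmetric]) auto
        also have "\<dots> \<le> ennreal (C1 * (2 * real m powr (- 1 / 2)) * p powr (1 / 2) * (S * ln (real m) powr (E + 1)))"
          using S C1 by (intro ennreal_leI mult_right_mono mult_left_mono half) auto
        also have "C1 * (2 * real m powr (- 1 / 2)) * p powr (1 / 2) * (S * ln (real m) powr (E + 1)) = T * B"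
          by (simp add: T_def B_def mult_ac)
        finally have "pint p (\<lambda>x. h x - t x) \<le> ennreal ((T * B) powr p)"
          using T B p by (subst Lp_norm_le_iff[symmetric]) auto
        moreover have "pint p (\<lambda>x. f x - (\<Sum>l<N. layer l f x)) \<le> ennreal ((K * B) powr p)"
          using K(1) p tail
          by (intro order_trans[OF K(2)[OF f]] ennreal_leI powr_mono2 mult_left_mono) auto
        ultimately have "pint p (\<lambda>x. (f x - (\<Sum>l<N. layer l f x)) + (h x - t x)) \<le> ennreal ((K * B + T * B) powr p)"
          using p K T B fm trig_polys_measurable[OF t1]
          by (intro Minkowski_torus_add) (auto simp: sum_layers_eq h_def)
        also have "(\<lambda>x. (f x - (\<Sum>l<N. layer l f x)) + (h x - t x)) = (\<lambda>x. f x - g x)"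
          unfolding gx hx[symmetric] by (simp add: algebra_simps)
        finally show ?thesis
          using p K T B by (subst Lp_norm_le_iff) (auto simp: distrib_right)
      qed
      ultimately show "g \<in> trig_polys m \<and>
        Lp_norm p (\<lambda>x. f x - g x) \<le> ennreal ((K + T) * (real m powr (- 1 / 2) * ln (real m) powr (E + 1)))"
        by (simp add: B_def)
    qed
  qed
  moreover have "0 < K + T" using K T by simp
  ultimately show ?thesis by blast
qed

section \<open>Fejer kernels on dyadic blocks\<close>

definition fejer_box :: "nat^'d::finite \<Rightarrow> (int^'d) set" where
  "fejer_box s = {k. \<forall>j. k $ j \<in> {0..<2 ^ (s $ j - 2)}}"

definition block_center :: "nat^'d::finite \<Rightarrow> int^'d" where
  "block_center s = (\<chi> j. 3 * 2 ^ (s $ j - 2))"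

text \<open>
  The Fourier coefficients of a multivariate Fejer kernel, the squared modulus of the
  Dirichlet kernel of \<open>fejer_box s\<close> divided by the number of its terms, moved to the middle of
  the part of the block \<open>rho s\<close> with positive coordinates.
\<close>

definition fejer_weight :: "nat^'d::finite \<Rightarrow> int^'d \<Rightarrow> real" where
  "fejer_weight s k = real (card {ab \<in> fejer_box s \<times> fejer_box s. block_center s + fst ab - snd ab = k}) / real (card (fejer_box s))"

lemma finite_fejer_box [simp]: "finite (fejer_box s)"
  unfolding fejer_box_def by (rule finite_vec_set) simp

lemma card_fejer_box:
  fixes s :: "nat^'d::finite"
  assumes "s \<in> levels l" "\<forall>j. 2 \<le> s $ j"
  shows "real (card (fejer_box s)) = 2 ^ l / 4 ^ CARD('d)"
proof -
  have "4 * (2 ^ (s $ j - 2)) = (2 :: real) ^ (s $ j)" for j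
  proof -
    have "2 \<le> s $ j" using assms(2) by blast
    hence "s $ j = 2 + (s $ j - 2)" by linarith
    hence "(2 :: real) ^ (s $ j) = 2 ^ 2 * 2 ^ (s $ j - 2)" by (metis power_add)
    thus ?thesis by simp
  qed
  hence "(\<Prod>j\<in>(UNIV::'d set). 4 * 2 ^ (s $ j - 2)) = (\<Prod>j\<in>(UNIV::'d set). (2::real) ^ (s $ j))" by simp
  also have "\<dots> = 2 ^ l" by (rule prod_two_power_levels[OF assms(1)])
  finally have "4 ^ CARD('d) * (\<Prod>j\<in>(UNIV::'d set). (2::real) ^ (s $ j - 2)) = 2 ^ l" by (simp add: prod.distrib)
  moreover have "real (card (fejer_box s)) = (\<Prod>j\<in>(UNIV::'d set). (2::real) ^ (s $ j - 2))"
    unfolding fejer_box_def card_vec_set by (simp add: nat_power_eq)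
  ultimately show ?thesis by (simp add: field_simps)
qed

lemma card_fejer_box_pos: "0 < card (fejer_box s)"
proof -
  have "0 \<in> fejer_box s" by (simp add: fejer_box_def)
  thus ?thesis using card_gt_0_iff finite_fejer_box by blast
qed

lemma fejer_box_nonempty [simp]: "fejer_box s \<noteq> {}"
  using card_fejer_box_pos[of s] by auto

lemma fejer_shift_in_rho:
  assumes s: "\<forall>j. 2 \<le> s $ j" and "a \<in> fejer_box s" "b \<in> fejer_box s"
  shows "block_center s + a - b \<in> rho s"
  unfolding rho_iff
proof
  fix j
  obtain t where t: "s $ j = Suc (Suc t)" using s by (metis add_2_eq_Suc le_Suc_ex)
  have "0 \<le> a $ j" "a $ j < 2 ^ t" "0 \<le> b $ j" "b $ j < 2 ^ t"
    using assms t by (auto simp: fejer_box_def dest!: spec[of _ j])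
  moreover have "(block_center s + a - b) $ j = 3 * 2 ^ t + a $ j - b $ j"
    using t by (simp add: block_center_def)
  ultimately show "\<bar>(block_center s + a - b) $ j\<bar> < 2 ^ s $ j \<and>
      (s $ j = 0 \<or> 2 ^ (s $ j - 1) \<le> \<bar>(block_center s + a - b) $ j\<bar>)"
    unfolding t by simp
qed

lemma fejer_kernel:
  assumes s: "\<forall>j. 2 \<le> s $ j"
  shows "tpoly (rho s) (\<lambda>k. of_real (fejer_weight s k)) x =
    of_real (1 / card (fejer_box s)) * expo (block_center s) x *
      (tpoly (fejer_box s) (\<lambda>_. 1) x * cnj (tpoly (fejer_box s) (\<lambda>_. 1) x))"
proof -
  let ?R = "fejer_box s" and ?c = "block_center s"
  let ?g = "\<lambda>ab. ?c + fst ab - snd ab"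
  let ?w = "1 / card ?R"
  have "of_real ?w * expo ?c x * (tpoly ?R (\<lambda>_. 1) x * cnj (tpoly ?R (\<lambda>_. 1) x)) =
      (\<Sum>a\<in>?R. \<Sum>b\<in>?R. of_real ?w * expo (?c + a - b) x)"
  proof -
    have "tpoly ?R (\<lambda>_. 1) x * cnj (tpoly ?R (\<lambda>_. 1) x) = (\<Sum>a\<in>?R. \<Sum>b\<in>?R. expo a x * cnj (expo b x))"
      by (simp add: tpoly_def sum_product)
    thus ?thesis unfolding sum_distrib_left by (simp add: expo_diff expo_add mult.assoc sum_distrib_left)
  qed
  also have "\<dots> = (\<Sum>ab\<in>?R \<times> ?R. of_real ?w * expo (?g ab) x)"
    by (simp add: sum.cartesian_product case_prod_beta)
  also have "\<dots> = (\<Sum>k\<in>rho s. \<Sum>ab\<in>{ab \<in> ?R \<times> ?R. ?g ab = k}. of_real ?w * expo (?g ab) x)"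
    by (rule sum.group[symmetric]) (auto simp: finite_rho intro: fejer_shift_in_rho[OF s])
  also have "\<dots> = (\<Sum>k\<in>rho s. \<Sum>ab\<in>{ab \<in> ?R \<times> ?R. ?g ab = k}. of_real ?w * expo k x)"
    by (intro sum.cong refl) auto
  also have "\<dots> = tpoly (rho s) (\<lambda>k. of_real (fejer_weight s k)) x"
    by (simp add: tpoly_def fejer_weight_def)
  finally show ?thesis by simp
qed

text \<open>
  The modulus of the kernel is the squared modulus of a Dirichlet kernel divided by the
  number of its terms, so the \<open>L\<^sub>1\<close> norm is computed by Parseval's identity.
\<close>

lemma fejer_kernel_L1:
  assumes s: "\<forall>j. 2 \<le> s $ j"
  shows "pint 1 (tpoly (rho s) (\<lambda>k. of_real (fejer_weight s k))) = 1"
proof -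
  let ?R = "fejer_box s"
  have pos: "0 < real (card ?R)" using card_fejer_box_pos[of s] by simp
  have "pint 1 (tpoly (rho s) (\<lambda>k. of_real (fejer_weight s k))) =
      (\<integral>\<^sup>+x. ennreal (1 / card ?R) * ennreal (cmod (tpoly ?R (\<lambda>_. 1) x) powr 2) \<partial>torus)"
    unfolding pint_def fejer_kernel[OF s]
    by (simp add: norm_mult norm_divide ennreal_mult[symmetric] power2_eq_square)
  also have "\<dots> = ennreal (1 / card ?R) * pint 2 (tpoly ?R (\<lambda>_. 1))"
    unfolding pint_def by (rule nn_integral_cmult) measurable
  also have "\<dots> = ennreal (1 / card ?R) * ennreal (card ?R)" by (simp add: pint_two_tpoly)
  also have "\<dots> = 1" using pos by (simp add: ennreal_mult[symmetric])
  finally show ?thesis .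
qed

lemma fejer_weight_bounds: "0 \<le> fejer_weight s k" "fejer_weight s k \<le> 1"
proof -
  let ?R = "fejer_box s"
  let ?S = "{ab \<in> ?R \<times> ?R. block_center s + fst ab - snd ab = k}"
  have "inj_on fst ?S"
  proof (rule inj_onI)
    fix ab cd assume "ab \<in> ?S" "cd \<in> ?S" "fst ab = fst cd"
    moreover from this have "snd ab = snd cd" by (auto simp: algebra_simps)
    ultimately show "ab = cd" by (simp add: prod_eq_iff)
  qed
  hence "card ?S \<le> card ?R" by (rule card_inj_on_le) auto
  thus "fejer_weight s k \<le> 1" using card_fejer_box_pos[of s] by (simp add: fejer_weight_def)
qed (simp add: fejer_weight_def)

lemma sum_fejer_weight:
  assumes s: "\<forall>j. 2 \<le> s $ j"
  shows "(\<Sum>k\<in>rho s. fejer_weight s k) = card (fejer_box s)"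
proof -
  let ?R = "fejer_box s"
  let ?g = "\<lambda>ab. block_center s + fst ab - snd ab"
  have "(\<Sum>k\<in>rho s. card {ab \<in> ?R \<times> ?R. ?g ab = k}) = (\<Sum>k\<in>rho s. \<Sum>ab\<in>{ab \<in> ?R \<times> ?R. ?g ab = k}. 1)" by simp
  also have "\<dots> = (\<Sum>ab\<in>?R \<times> ?R. 1)"
    by (rule sum.group) (auto simp: finite_rho intro: fejer_shift_in_rho[OF s])
  also have "\<dots> = card ?R * card ?R" by simp
  finally have "real (\<Sum>k\<in>rho s. card {ab \<in> ?R \<times> ?R. ?g ab = k}) = real (card ?R * card ?R)" by (simp only:)
  thus ?thesis using card_fejer_box_pos[of s]
    by (simp add: fejer_weight_def sum_divide_distrib[symmetric])
qed

text \<open>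
  The weights sum up to the number of points of the box, a fixed fraction of the number of
  frequencies in the block; the Cauchy--Schwarz inequality does the rest.
\<close>

lemma sum_fejer_weight_square:
  fixes s :: "nat^'d::finite"
  assumes s: "s \<in> levels l" "\<forall>j. 2 \<le> s $ j"
  shows "2 ^ l / 32 ^ CARD('d) \<le> (\<Sum>k\<in>rho s. (fejer_weight s k)\<^sup>2)"
proof -
  let ?S = "\<Sum>k\<in>rho s. (fejer_weight s k)\<^sup>2"
  have "(\<Sum>k\<in>rho s. fejer_weight s k * 1)\<^sup>2 \<le> ?S * (\<Sum>k\<in>(rho s :: (int^'d) set). 1\<^sup>2)"
    by (rule Cauchy_Schwarz_ineq_sum)
  also have "\<dots> \<le> ?S * (2 ^ CARD('d) * 2 ^ l)"
  proof (rule mult_left_mono)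
    have "real (card (rho s :: (int^'d) set)) \<le> real (2 ^ CARD('d) * 2 ^ l)"
      using card_rho_le[OF s(1)] by (simp only: of_nat_le_iff)
    thus "(\<Sum>k\<in>(rho s :: (int^'d) set). 1\<^sup>2) \<le> (2 ^ CARD('d) * 2 ^ l :: real)" by simp
  qed (simp add: sum_nonneg)
  finally have "(2 ^ l / 4 ^ CARD('d))\<^sup>2 \<le> ?S * (2 ^ CARD('d) * 2 ^ l)"
    using sum_fejer_weight[OF s(2)] card_fejer_box[OF s] by simp
  hence "(2 ^ l / 4 ^ CARD('d))\<^sup>2 / (2 ^ CARD('d) * 2 ^ l) \<le> ?S" by (simp add: pos_divide_le_eq)
  moreover have "(2 ^ l / 4 ^ CARD('d))\<^sup>2 / (2 ^ CARD('d) * 2 ^ l) = (2 ^ l / 32 ^ CARD('d) :: real)"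
  proof -
    have "(32::real) ^ CARD('d) = 4 ^ CARD('d) * 4 ^ CARD('d) * 2 ^ CARD('d)"
      by (simp add: power_mult_distrib[symmetric])
    thus ?thesis by (simp add: power2_eq_square)
  qed
  ultimately show ?thesis by simp
qed

definition dyadic_index :: "int^'d::finite \<Rightarrow> nat^'d" where
  "dyadic_index k = (THE s. k \<in> rho s)"

lemma dyadic_index: "k \<in> rho s \<Longrightarrow> dyadic_index k = s"
  unfolding dyadic_index_def by (rule the_equality) (auto dest: rho_disjoint)

text \<open>
  The weights of the disjoint blocks \<open>s\<close> with all \<open>s $ j \<ge> 2\<close>, where \<open>fejer_box s\<close> and
  \<open>block_center s\<close> are meaningful, combined into one function of the frequency.
\<close>

definition kernel_weight :: "int^'d::finite \<Rightarrow> real" where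
  "kernel_weight k = (if \<forall>j. 2 \<le> dyadic_index k $ j then fejer_weight (dyadic_index k) k else 0)"

lemma kernel_weight_bounds: "0 \<le> kernel_weight k" "kernel_weight k \<le> 1"
  using fejer_weight_bounds by (auto simp: kernel_weight_def)

definition layer_kernel :: "nat \<Rightarrow> 'd::finite tfun" where
  "layer_kernel l = tpoly (layer_freqs l) (\<lambda>k. of_real (kernel_weight k))"

definition inner_levels :: "nat \<Rightarrow> (nat^'d::finite) set" where
  "inner_levels l = {s \<in> levels l. \<forall>j. 2 \<le> s $ j}"

lemma finite_inner_levels: "finite (inner_levels l)"
  unfolding inner_levels_def by (rule finite_subset[OF _ finite_levels]) auto

lemma layer_kernel_eq:
  fixes x :: "real^'d::finite"
  shows "layer_kernel l x = (\<Sum>s\<in>inner_levels l. tpoly (rho s) (\<lambda>k. of_real (fejer_weight s k)) x)"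
proof -
  have "layer_kernel l x = (\<Sum>s\<in>levels l. tpoly (rho s) (\<lambda>k. of_real (kernel_weight k)) x)"
    unfolding layer_kernel_def tpoly_def by (rule sum_layer_freqs)
  also have "\<dots> = (\<Sum>s\<in>inner_levels l. tpoly (rho s) (\<lambda>k. of_real (fejer_weight s k)) x)"
  proof (intro sum.mono_neutral_cong_right finite_levels ballI)
    fix s :: "nat^'d" assume "s \<in> levels l - inner_levels l"
    hence "\<not> (\<forall>j. 2 \<le> s $ j)" by (auto simp: inner_levels_def)
    hence "kernel_weight k = 0" if "k \<in> rho s" for k using dyadic_index[OF that] by (auto simp: kernel_weight_def)
    thus "tpoly (rho s) (\<lambda>k. of_real (kernel_weight k)) x = 0" by (simp add: tpoly_def)
  next
    fix s :: "nat^'d" assume "s \<in> inner_levels l"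
    hence "\<forall>j. 2 \<le> s $ j" by (auto simp: inner_levels_def)
    hence "kernel_weight k = fejer_weight s k" if "k \<in> rho s" for k using dyadic_index[OF that] by (auto simp: kernel_weight_def)
    thus "tpoly (rho s) (\<lambda>k. of_real (kernel_weight k)) x = tpoly (rho s) (\<lambda>k. of_real (fejer_weight s k)) x"
      by (simp add: tpoly_def)
  qed (auto simp: inner_levels_def)
  finally show ?thesis .
qed

lemma pint_layer_kernel_L1:
  "pint 1 (layer_kernel l :: 'd::finite tfun) \<le> ennreal (real (l + 1) ^ (CARD('d) - 1))"
proof -
  have "pint 1 (layer_kernel l :: 'd tfun) \<le>
      (\<integral>\<^sup>+x. (\<Sum>s\<in>inner_levels l. ennreal (cmod (tpoly (rho s) (\<lambda>k. of_real (fejer_weight s k)) x) powr 1)) \<partial>(torus :: (real^'d) measure))"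
    unfolding pint_def layer_kernel_eq
    by (intro nn_integral_mono) (simp add: sum_ennreal norm_sum ennreal_leI)
  also have "\<dots> = (\<Sum>s\<in>(inner_levels l :: (nat^'d) set). pint 1 (tpoly (rho s) (\<lambda>k. of_real (fejer_weight s k))))"
    unfolding pint_def by (rule nn_integral_sum) measurable
  also have "\<dots> = (\<Sum>s\<in>(inner_levels l :: (nat^'d) set). 1)"
    by (intro sum.cong refl fejer_kernel_L1) (simp add: inner_levels_def)
  also have "\<dots> = ennreal (real (card (inner_levels l :: (nat^'d) set)))" by (simp add: ennreal_of_nat_eq_real_of_nat)
  also have "\<dots> \<le> ennreal (real (l + 1) ^ (CARD('d) - 1))"
  proof (rule ennreal_leI)
    have "card (inner_levels l :: (nat^'d) set) \<le> card (levels l :: (nat^'d) set)"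
      by (rule card_mono[OF finite_levels]) (auto simp: inner_levels_def)
    also have "\<dots> \<le> (l + 1) ^ (CARD('d) - 1)" by (rule card_levels_le)
    finally have "real (card (inner_levels l :: (nat^'d) set)) \<le> real ((l + 1) ^ (CARD('d) - 1))"
      by (simp only: of_nat_le_iff)
    thus "real (card (inner_levels l :: (nat^'d) set)) \<le> real (l + 1) ^ (CARD('d) - 1)" by (simp only: of_nat_power)
  qed
  finally show ?thesis .
qed

lemma pint_layer_kernel_L2:
  "pint 2 (layer_kernel l :: 'd::finite tfun) \<le> ennreal (2 ^ CARD('d) * 2 powr real l * real (l + 1) ^ (CARD('d) - 1))"
  unfolding layer_kernel_def by (rule pint_two_layer_poly) (simp add: kernel_weight_bounds)

lemma layer_kernel_measurable [measurable]: "layer_kernel l \<in> borel_measurable torus"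
  unfolding layer_kernel_def by measurable

text \<open>
  Interpolation between \<open>L\<^sub>1\<close>, where every block contributes at most 1, and \<open>L\<^sub>2\<close>. The \<open>q\<close>-th power
  carries the factor \<open>(l + 1) ^ (d - 1)\<close>; the triangle inequality for the \<open>L\<^sub>q\<close> norms of the blocks
  would lead to the \<open>q\<close>-th power of this factor.
\<close>

lemma pint_layer_kernel_le:
  assumes q: "1 < q" "q \<le> 2"
  shows "pint q (layer_kernel l :: 'd::finite tfun) \<le>
    ennreal (2 ^ CARD('d) * 2 powr (real l * (q - 1)) * real (l + 1) ^ (CARD('d) - 1))"
proof (cases "q = 2")
  case True
  thus ?thesis using pint_layer_kernel_L2[of l] by simp
next
  case False
  define L where "L = real (l + 1) ^ (CARD('d) - 1)"
  have L: "0 < L" by (simp add: L_def)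
  have "pint q (layer_kernel l :: 'd tfun) \<le> ennreal (L powr (2 - q) * (2 ^ CARD('d) * 2 powr real l * L) powr (q - 1))"
    using q False L pint_layer_kernel_L1[of l, where 'd='d] pint_layer_kernel_L2[of l, where 'd='d]
    by (intro pint_interpolation[where ?r0.0 = 1 and ?r1.0 = 2]) (auto simp: L_def)
  also have "\<dots> \<le> ennreal (2 ^ CARD('d) * 2 powr (real l * (q - 1)) * L)"
  proof (rule ennreal_leI)
    have "L powr (2 - q) * (2 ^ CARD('d) * 2 powr real l * L) powr (q - 1) =
        (2 ^ CARD('d)) powr (q - 1) * 2 powr (real l * (q - 1)) * (L powr (2 - q) * L powr (q - 1))"
      using L by (simp add: powr_mult powr_powr)
    also have "L powr (2 - q) * L powr (q - 1) = L" using L by (simp add: powr_add[symmetric])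
    also have "(2 ^ CARD('d)) powr (q - 1) * 2 powr (real l * (q - 1)) * L \<le>
        (2 ^ CARD('d)) powr 1 * 2 powr (real l * (q - 1)) * L"
      using q L by (intro mult_right_mono powr_mono) auto
    finally show "L powr (2 - q) * (2 ^ CARD('d) * 2 powr real l * L) powr (q - 1) \<le> 2 ^ CARD('d) * 2 powr (real l * (q - 1)) * L"
      by simp
  qed
  finally show ?thesis by (simp add: L_def)
qed

text \<open>
  All coordinates but one may range over \<open>M \<approx> l / (2 d)\<close> values each; the last one is then
  determined and still at least 2.
\<close>

lemma card_inner_levels_ge:
  assumes l: "4 * CARD('d::finite) \<le> l"
  shows "(real l / (4 * CARD('d))) ^ (CARD('d) - 1) \<le> card (inner_levels l :: (nat^'d) set)"
proof -
  let ?D = "CARD('d)"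
  obtain i :: 'd where True by simp
  define M where "M = l div (2 * ?D)"
  have D: "0 < ?D" by simp
  have M: "real l / (4 * ?D) \<le> real M"
  proof -
    have "real l / real (2 * ?D) < real M + 1"
      unfolding M_def using floor_divide_of_nat_eq[of l "2 * ?D", where 'a=real] real_of_int_floor_add_one_gt[of "real l / real (2 * ?D)"]
      by simp
    moreover have "1 \<le> real l / (4 * ?D)" using l D by (simp add: le_divide_eq)
    moreover have "real l / real (2 * ?D) = 2 * (real l / (4 * ?D))" by (simp add: field_simps)
    ultimately show ?thesis by linarith
  qed
  have MD: "2 * (?D * M) \<le> l" unfolding M_def using div_times_less_eq_dividend[of l "2 * ?D"] by (simp add: mult_ac)
  let ?P = "PiE (UNIV - {i}) (\<lambda>_. {2..<M + 2})"
  let ?h = "\<lambda>v. \<chi> j. if j = i then l - (\<Sum>j\<in>UNIV - {i}. v j) else v j"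
  have bound: "(\<Sum>j\<in>UNIV - {i}. v j) + 2 \<le> l" if v: "v \<in> ?P" for v :: "'d \<Rightarrow> nat"
  proof -
    have "(\<Sum>j\<in>UNIV - {i}. v j) \<le> (\<Sum>j\<in>UNIV - {i}. M + 1)"
      using PiE_mem[OF v] by (intro sum_mono) fastforce
    also have "\<dots> = (?D - 1) * (M + 1)" by simp
    finally have "(\<Sum>j\<in>UNIV - {i}. v j) \<le> (?D - 1) * (M + 1)" .
    moreover have "(?D - 1) * (M + 1) \<le> ?D * M + (?D - 1)"
      by (simp add: algebra_simps)
    ultimately show ?thesis using MD l D by linarith
  qed
  have inj: "inj_on ?h ?P"
  proof (rule inj_onI)
    fix v w assume v: "v \<in> ?P" and w: "w \<in> ?P" and eq: "?h v = ?h w"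
    have "v j = w j" if "j \<in> UNIV - {i}" for j
      using arg_cong[OF eq, of "\<lambda>s. s $ j"] that by simp
    with v w show "v = w" by (rule PiE_ext)
  qed
  have "?h ` ?P \<subseteq> inner_levels l"
  proof (rule image_subsetI)
    fix v assume v: "v \<in> ?P"
    have "(\<Sum>j\<in>UNIV. ?h v $ j) = ?h v $ i + (\<Sum>j\<in>UNIV - {i}. ?h v $ j)" by (rule sum.remove) auto
    also have "(\<Sum>j\<in>UNIV - {i}. ?h v $ j) = (\<Sum>j\<in>UNIV - {i}. v j)" by (intro sum.cong) auto
    also have "?h v $ i + \<dots> = l" using bound[OF v] by simp
    finally have "?h v \<in> levels l" by (simp add: levels_def)
    moreover have "2 \<le> ?h v $ j" for j using bound[OF v] PiE_mem[OF v, of j] by (cases "j = i") auto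
    ultimately show "?h v \<in> inner_levels l" by (simp add: inner_levels_def)
  qed
  hence "card ?P \<le> card (inner_levels l :: (nat^'d) set)"
    using card_inj_on_le[OF inj _ finite_inner_levels] by blast
  hence "M ^ (?D - 1) \<le> card (inner_levels l :: (nat^'d) set)" by (simp add: card_PiE)
  hence "real (M ^ (?D - 1)) \<le> real (card (inner_levels l :: (nat^'d) set))" by (simp only: of_nat_le_iff)
  moreover have "(real l / (4 * ?D)) ^ (?D - 1) \<le> real M ^ (?D - 1)" using M by (intro power_mono) auto
  ultimately show ?thesis unfolding of_nat_power by linarith
qed

abbreviation kernel_mass :: "'d::finite itself \<Rightarrow> nat \<Rightarrow> real" where
  "kernel_mass _ l \<equiv> (\<Sum>k\<in>(layer_freqs l :: (int^'d) set). (kernel_weight k)\<^sup>2)"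

lemma kernel_mass_ge:
  "\<exists>c>0. \<forall>l\<ge>4 * CARD('d::finite). c * 2 ^ l * real l ^ (CARD('d) - 1) \<le> kernel_mass TYPE('d) l"
proof -
  let ?D = "CARD('d)"
  define c where "c = (1 / (4 * real ?D)) ^ (?D - 1) / 32 ^ ?D"
  have "c * 2 ^ l * real l ^ (?D - 1) \<le> kernel_mass TYPE('d) l" if l: "4 * ?D \<le> l" for l
  proof -
    have "c * 2 ^ l * real l ^ (?D - 1) = (real l / (4 * ?D)) ^ (?D - 1) * (2 ^ l / 32 ^ ?D)"
      by (simp add: c_def power_divide)
    also have "\<dots> \<le> real (card (inner_levels l :: (nat^'d) set)) * (2 ^ l / 32 ^ ?D)"
      by (intro mult_right_mono card_inner_levels_ge l) simp
    also have "\<dots> = (\<Sum>s\<in>(inner_levels l :: (nat^'d) set). 2 ^ l / 32 ^ ?D)" by simp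
    also have "\<dots> \<le> (\<Sum>s\<in>(inner_levels l :: (nat^'d) set). \<Sum>k\<in>rho s. (kernel_weight k)\<^sup>2)"
    proof (rule sum_mono)
      fix s :: "nat^'d" assume "s \<in> inner_levels l"
      hence s: "s \<in> levels l" "\<forall>j. 2 \<le> s $ j" by (auto simp: inner_levels_def)
      hence "kernel_weight k = fejer_weight s k" if "k \<in> rho s" for k using dyadic_index[OF that] by (auto simp: kernel_weight_def)
      thus "2 ^ l / 32 ^ ?D \<le> (\<Sum>k\<in>rho s. (kernel_weight k)\<^sup>2)" using sum_fejer_weight_square[OF s] by simp
    qed
    also have "\<dots> \<le> (\<Sum>s\<in>(levels l :: (nat^'d) set). \<Sum>k\<in>rho s. (kernel_weight k)\<^sup>2)"
      by (rule sum_mono2[OF finite_levels]) (auto simp: inner_levels_def intro!: sum_nonneg)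
    also have "\<dots> = kernel_mass TYPE('d) l" by (rule sum_layer_freqs[symmetric])
    finally show ?thesis .
  qed
  moreover have "0 < c" by (simp add: c_def)
  ultimately show ?thesis by blast
qed

section \<open>The lower bound\<close>

definition total_level :: "int^'d::finite \<Rightarrow> nat" where
  "total_level k = (\<Sum>j\<in>UNIV. dyadic_index k $ j)"

lemma total_level: "k \<in> layer_freqs l \<Longrightarrow> total_level k = l"
  by (auto simp: layer_freqs_def total_level_def levels_def dyadic_index)

definition cross_band :: "nat \<Rightarrow> nat \<Rightarrow> (int^'d::finite) set" where
  "cross_band n N = (\<Union>l\<in>{n..<N}. layer_freqs l)"

lemma finite_cross_band [simp]: "finite (cross_band n N)"
  by (simp add: cross_band_def)

lemma cross_band_iff:
  assumes k: "k \<in> layer_freqs l"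
  shows "k \<in> cross_band n N \<longleftrightarrow> n \<le> l \<and> l < N"
proof
  assume "k \<in> cross_band n N"
  then obtain l' where l': "n \<le> l'" "l' < N" "k \<in> layer_freqs l'" by (auto simp: cross_band_def)
  thus "n \<le> l \<and> l < N" using layer_freqs_disjoint[OF l'(3) k] by simp
qed (use k in \<open>auto simp: cross_band_def\<close>)

text \<open>
  Up to a constant, the largest multiple of \<open>layer_kernel l\<close> that the class admits: the
  quotient of \<open>2^(-l/q) l^((d-1)b)\<close> and of \<open>2^(l(1-1/q)) l^((d-1)/q)\<close>, the bound for its \<open>L\<^sub>q\<close> norm.
  The type argument carries the dimension.
\<close>

definition amplitude :: "'d::finite itself \<Rightarrow> real \<Rightarrow> real \<Rightarrow> nat \<Rightarrow> real" where
  "amplitude _ b q l = (1 / 4 ^ CARD('d)) * 2 powr (- real l) * real (max l 1) powr ((real CARD('d) - 1) * (b - 1 / q))"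

lemma amplitude_nonneg: "0 \<le> amplitude T b q l"
  by (simp add: amplitude_def)

definition extremal :: "real \<Rightarrow> real \<Rightarrow> nat \<Rightarrow> nat \<Rightarrow> 'd::finite tfun" where
  "extremal b q n N = tpoly (cross_band n N) (\<lambda>k. of_real (amplitude TYPE('d) b q (total_level k) * kernel_weight k))"

lemma layer_extremal:
  "layer l (extremal b q n N :: 'd::finite tfun) =
    (if n \<le> l \<and> l < N then (\<lambda>x. of_real (amplitude TYPE('d) b q l) * layer_kernel l x) else (\<lambda>x. 0))"
proof -
  have "fourier (extremal b q n N) k = (if n \<le> l \<and> l < N then of_real (amplitude TYPE('d) b q l) * of_real (kernel_weight k) else 0)"
    if "k \<in> layer_freqs l" for k :: "int^'d"
    using cross_band_iff[OF that] total_level[OF that] by (simp add: extremal_def fourier_tpoly)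
  thus ?thesis unfolding layer_eq layer_kernel_def by (auto simp: tpoly_def sum_distrib_left mult.assoc)
qed

lemma extremal_in_W:
  assumes q: "1 < q" "q \<le> 2"
  shows "extremal b q n N \<in> (W_class (1 / q) b q :: 'd::finite tfun set)"
proof -
  let ?f = "extremal b q n N :: 'd tfun"
  have "?f \<in> L1_torus" unfolding extremal_def by (rule tpoly_L1)
  moreover have "Lp_norm q (layer l ?f) \<le>
        ennreal (2 powr (- (1 / q) * real l) * real (max l 1) powr ((real CARD('d) - 1) * b))" for l
  proof -
    let ?D = "CARD('d)"
    define L where "L = real (max l 1)"
    have L: "1 \<le> L" "real (l + 1) \<le> 2 * L" by (auto simp: L_def)
    define M where "M = 2 powr (- (1 / q) * real l) * L powr ((real ?D - 1) * b)"
    have M0: "0 \<le> M" by (simp add: M_def)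
    have "pint q (layer l ?f) \<le> ennreal (M powr q)"
    proof (cases "n \<le> l \<and> l < N")
      case True
      define a where "a = amplitude TYPE('d) b q l"
      have a0: "0 \<le> a" by (simp add: a_def amplitude_nonneg)
      have "pint q (layer l ?f) = ennreal (a powr q) * pint q (layer_kernel l :: 'd tfun)"
        using True a0 by (simp add: layer_extremal a_def[symmetric] pint_cmult)
      also have "\<dots> \<le> ennreal (a powr q) * ennreal (2 ^ ?D * 2 powr (real l * (q - 1)) * real (l + 1) ^ (?D - 1))"
        by (intro mult_left_mono pint_layer_kernel_le q) simp
      also have "\<dots> = ennreal (a powr q * (2 ^ ?D * 2 powr (real l * (q - 1)) * real (l + 1) ^ (?D - 1)))"
        by (rule ennreal_mult[symmetric]) auto
      also have "\<dots> \<le> ennreal (M powr q)"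
      proof (rule ennreal_leI)
        have fq: "(1 / 4 ^ ?D) powr q \<le> 1 / (4 :: real) ^ ?D"
          using powr_mono'[of 1 q "1 / 4 ^ ?D"] q by (simp add: divide_le_eq)
        have lp: "real (l + 1) ^ (?D - 1) \<le> 2 ^ ?D * L powr (real ?D - 1)"
        proof -
          have "real (l + 1) ^ (?D - 1) \<le> (2 * L) ^ (?D - 1)" by (intro power_mono L) simp
          also have "\<dots> = 2 ^ (?D - 1) * L ^ (?D - 1)" by (rule power_mult_distrib)
          also have "L ^ (?D - 1) = L powr (real ?D - 1)"
            using L by (simp add: powr_realpow[symmetric] of_nat_diff Suc_leI)
          also have "2 ^ (?D - 1) * L powr (real ?D - 1) \<le> 2 ^ ?D * L powr (real ?D - 1)"
            by (intro mult_right_mono power_increasing) auto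
          finally show ?thesis .
        qed
        have aq: "a powr q = (1 / 4 ^ ?D) powr q * (2 powr (- real l * q) * L powr ((real ?D - 1) * (b - 1 / q) * q))"
          unfolding a_def amplitude_def L_def[symmetric] by (simp only: powr_mult powr_powr mult.assoc)
        have "a powr q * (2 ^ ?D * 2 powr (real l * (q - 1)) * real (l + 1) ^ (?D - 1)) \<le>
            (1 / 4 ^ ?D) * (2 powr (- real l * q) * L powr ((real ?D - 1) * (b - 1 / q) * q)) *
            (2 ^ ?D * 2 powr (real l * (q - 1)) * (2 ^ ?D * L powr (real ?D - 1)))"
          unfolding aq by (intro mult_mono fq lp mult_left_mono mult_right_mono order_refl) auto
        also have "\<dots> = (1 / 4 ^ ?D * (2 ^ ?D * 2 ^ ?D)) * (2 powr (- real l * q) * 2 powr (real l * (q - 1))) *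
            (L powr ((real ?D - 1) * (b - 1 / q) * q) * L powr (real ?D - 1))"
          by (simp only: mult_ac)
        also have "(1 / 4 ^ ?D * (2 ^ ?D * 2 ^ ?D)) = (1 :: real)" by (simp add: power_mult_distrib[symmetric])
        also have "2 powr (- real l * q) * 2 powr (real l * (q - 1)) = 2 powr (- real l)"
          by (simp add: powr_add[symmetric] algebra_simps)
        also have "L powr ((real ?D - 1) * (b - 1 / q) * q) * L powr (real ?D - 1) = L powr ((real ?D - 1) * b * q)"
          using q by (simp add: powr_add[symmetric] algebra_simps)
        also have "1 * 2 powr (- real l) * L powr ((real ?D - 1) * b * q) = M powr q"
          using q by (simp add: M_def powr_mult powr_powr)
        finally show "a powr q * (2 ^ ?D * 2 powr (real l * (q - 1)) * real (l + 1) ^ (?D - 1)) \<le> M powr q" .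
      qed
      finally show ?thesis .
    next
      case False
      thus ?thesis using q by (auto simp: layer_extremal pint_def)
    qed
    thus ?thesis using q M0 by (subst Lp_norm_le_iff) (auto simp: M_def L_def)
  qed
  ultimately show ?thesis unfolding W_class_def by blast
qed

text \<open>
  Powers of \<open>N\<close> may be wasted here: in the application \<open>2 powr (real N * (1 - 1 / r))\<close> is smaller
  than \<open>sqrt m\<close> by a power of \<open>m\<close>.
\<close>

lemma pint_band_kernel:
  assumes r: "1 < r" "r \<le> 2"
  shows "pint r (tpoly (cross_band n N) (\<lambda>k. of_real (kernel_weight k)) :: 'd::finite tfun) \<le>
    ennreal ((real N * (2 ^ CARD('d) * 2 powr (real N * (1 - 1 / r)) * (real N + 1) powr real CARD('d))) powr r)"
proof -
  let ?D = "CARD('d)"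
  define Z where "Z = 2 ^ ?D * 2 powr (real N * (1 - 1 / r)) * (real N + 1) powr real ?D"
  have Z: "0 < Z" by (simp add: Z_def)
  have big: "x \<le> x powr r" if "1 \<le> x" for x :: real
    using powr_mono[of 1 r x] that r by simp
  have bd: "pint r (layer_kernel l :: 'd tfun) \<le> ennreal (Z powr r)" if l: "l < N" for l
  proof -
    have "pint r (layer_kernel l :: 'd tfun) \<le> ennreal (2 ^ ?D * 2 powr (real l * (r - 1)) * real (l + 1) ^ (?D - 1))"
      by (rule pint_layer_kernel_le[OF r])
    also have "\<dots> \<le> ennreal ((2 ^ ?D) powr r * (2 powr (real N * (1 - 1 / r))) powr r * ((real N + 1) powr real ?D) powr r)"
    proof (intro ennreal_leI mult_mono)
      show "2 ^ ?D \<le> ((2::real) ^ ?D) powr r" by (intro big) simp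
      have "real l * (r - 1) \<le> real N * (r - 1)" using l r by (intro mult_right_mono) auto
      moreover have "real N * (r - 1) = real N * (1 - 1 / r) * r" using r by (simp add: algebra_simps)
      ultimately show "2 powr (real l * (r - 1)) \<le> (2 powr (real N * (1 - 1 / r))) powr r"
        unfolding powr_powr by (intro powr_mono) auto
      have "real (l + 1) ^ (?D - 1) \<le> (real N + 1) ^ (?D - 1)" using l by (intro power_mono) auto
      also have "\<dots> \<le> (real N + 1) ^ ?D" by (intro power_increasing) auto
      also have "\<dots> = (real N + 1) powr real ?D" by (simp add: powr_realpow)
      also have "\<dots> \<le> ((real N + 1) powr real ?D) powr r" by (intro big ge_one_powr_ge_zero) auto
      finally show "real (l + 1) ^ (?D - 1) \<le> ((real N + 1) powr real ?D) powr r" .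
    qed auto
    also have "(2 ^ ?D) powr r * (2 powr (real N * (1 - 1 / r))) powr r * ((real N + 1) powr real ?D) powr r = Z powr r"
      unfolding Z_def by (simp only: powr_mult)
    finally show ?thesis .
  qed
  have eq: "tpoly (cross_band n N) (\<lambda>k. of_real (kernel_weight k)) x = (\<Sum>l\<in>{n..<N}. layer_kernel l x)" for x :: "real^'d"
    unfolding cross_band_def layer_kernel_def by (rule tpoly_UNION[symmetric]) (auto dest: layer_freqs_disjoint)
  have "pint r (tpoly (cross_band n N) (\<lambda>k. of_real (kernel_weight k)) :: 'd tfun) = pint r (\<lambda>x::real^'d. \<Sum>l\<in>{n..<N}. layer_kernel l x)"
    unfolding pint_def eq ..
  also have "\<dots> \<le> ennreal ((\<Sum>l\<in>{n..<N}. Z) powr r)"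
    using r bd Z by (intro Minkowski_torus) auto
  also have "\<dots> \<le> ennreal ((real N * Z) powr r)"
    using r Z by (intro ennreal_leI powr_mono2) (auto intro!: mult_right_mono)
  finally show ?thesis by (simp add: Z_def)
qed

text \<open>
  The test polynomial is the sum of the layer kernels without the frequencies of \<open>t\<close>, so that \<open>t\<close>
  drops out of the pairing. The removed part has at most \<open>m\<close> coefficients of modulus at most 1:
  it contributes at most \<open>sqrt m\<close> to the norm of the test polynomial in the dual exponent, which
  is below 2, and it costs each layer at most the amount \<open>m\<close> of its mass.
\<close>

lemma duality_lower_bound:
  fixes t :: "'d::finite tfun"
  assumes t: "t \<in> trig_polys m" and m: "0 < m" and p: "2 < p"
    and A: "pint p (\<lambda>x. extremal b q n N x - t x) \<le> ennreal (A powr p)" "0 < A"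
    and N: "real N * (2 ^ CARD('d) * 2 powr (real N / p) * (real N + 1) powr real CARD('d)) \<le> sqrt m"
  shows "(\<Sum>l\<in>{n..<N}. amplitude TYPE('d) b q l * (kernel_mass TYPE('d) l - m)) \<le> A * (2 * sqrt m)"
proof -
  define r where "r = p / (p - 1)"
  have r: "1 < r" "r < 2" "1 / p + 1 / r = 1" "1 - 1 / r = 1 / p" using p by (simp_all add: r_def field_simps)
  obtain K c where K: "finite K" "card K \<le> m" "t = tpoly K c" using t by (rule trig_polysD)
  define \<Omega> where "\<Omega> = (cross_band n N :: (int^'d) set)"
  define \<omega> where "\<omega> = (\<lambda>k::int^'d. complex_of_real (kernel_weight k))"
  define a where "a = amplitude TYPE('d) b q"
  have fin: "finite \<Omega>" by (simp add: \<Omega>_def)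
  define F where "F = (\<lambda>x. extremal b q n N x - t x)"
  have Feq: "F = tpoly (\<Omega> \<union> K) (\<lambda>k. (if k \<in> \<Omega> then of_real (a (total_level k) * kernel_weight k) else 0) - (if k \<in> K then c k else 0))"
  proof
    fix x
    have "extremal b q n N = tpoly (\<Omega> \<union> K) (\<lambda>k. if k \<in> \<Omega> then of_real (a (total_level k) * kernel_weight k) else 0)"
      unfolding extremal_def \<Omega>_def[symmetric] a_def using fin K by (intro tpoly_mono) auto
    moreover have "t = tpoly (\<Omega> \<union> K) (\<lambda>k. if k \<in> K then c k else 0)"
      unfolding K(3) using fin K by (intro tpoly_mono) auto
    ultimately have "F x = tpoly (\<Omega> \<union> K) (\<lambda>k. if k \<in> \<Omega> then of_real (a (total_level k) * kernel_weight k) else 0) x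
        - tpoly (\<Omega> \<union> K) (\<lambda>k. if k \<in> K then c k else 0) x"
      unfolding F_def by (simp only:)
    thus "F x = tpoly (\<Omega> \<union> K) (\<lambda>k. (if k \<in> \<Omega> then of_real (a (total_level k) * kernel_weight k) else 0) - (if k \<in> K then c k else 0)) x"
      by (simp only: tpoly_diff)
  qed
  have Fint: "integrable torus F" and Fm: "F \<in> borel_measurable torus" unfolding Feq by (auto intro: integrable_tpoly)
  have Ff: "fourier F k = of_real (a (total_level k) * kernel_weight k)" if "k \<in> \<Omega> - K" for k
    unfolding Feq using that fin K by (subst fourier_tpoly) auto
  define h where "h = tpoly (\<Omega> - K) \<omega>"
  have heq: "h x = tpoly \<Omega> \<omega> x + - tpoly (\<Omega> \<inter> K) \<omega> x" for x
  proof -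
    have "tpoly \<Omega> \<omega> x = h x + tpoly (\<Omega> \<inter> K) \<omega> x"
      unfolding h_def tpoly_def using fin by (subst sum.Int_Diff[of \<Omega> _ K]) (auto simp: add.commute)
    thus ?thesis by simp
  qed
  have h1: "pint r (tpoly \<Omega> \<omega>) \<le> ennreal ((sqrt m) powr r)"
  proof -
    have "pint r (tpoly \<Omega> \<omega>) \<le> ennreal ((real N * (2 ^ CARD('d) * 2 powr (real N * (1 - 1 / r)) * (real N + 1) powr real CARD('d))) powr r)"
      unfolding \<Omega>_def \<omega>_def using r by (intro pint_band_kernel) auto
    also have "\<dots> \<le> ennreal ((sqrt m) powr r)"
      using r N by (intro ennreal_leI powr_mono2) (auto simp: r(4))
    finally show ?thesis .
  qed
  have h2: "pint r (\<lambda>x. - tpoly (\<Omega> \<inter> K) \<omega> x) \<le> ennreal ((sqrt m) powr r)"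
  proof -
    have "(\<Sum>k\<in>\<Omega> \<inter> K. (cmod (\<omega> k))\<^sup>2) \<le> (\<Sum>k\<in>\<Omega> \<inter> K. 1)"
      by (intro sum_mono) (auto simp: \<omega>_def power_le_one kernel_weight_bounds)
    also have "\<dots> \<le> real m" using K card_mono[of K "\<Omega> \<inter> K"] by simp
    finally have "pint 2 (tpoly (\<Omega> \<inter> K) \<omega>) \<le> ennreal m"
      using fin by (simp add: pint_two_tpoly ennreal_leI)
    hence "pint r (tpoly (\<Omega> \<inter> K) \<omega>) \<le> ennreal (real m powr (r / 2))"
      using r m by (intro pint_le_of_pint_two) auto
    also have "real m powr (r / 2) = (sqrt m) powr r" by (simp add: powr_half_sqrt[symmetric] powr_powr)
    finally show ?thesis by (simp add: pint_def)
  qed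
  have "pint r h \<le> ennreal ((2 * sqrt m) powr r)"
    using Minkowski_torus_add[OF _ _ _ h1 h2] r m by (simp add: heq[abs_def])
  hence H: "pint r (\<lambda>x. cnj (h x)) \<le> ennreal ((2 * sqrt m) powr r)" by (simp add: pint_def)
  have hm: "(\<lambda>x. cnj (h x)) \<in> borel_measurable torus" unfolding h_def cnj_tpoly by (rule tpoly_measurable)
  define S where "S = (\<Sum>k\<in>\<Omega> - K. a (total_level k) * (kernel_weight k)\<^sup>2)"
  have a0: "0 \<le> a l" for l by (simp add: a_def amplitude_nonneg)
  have "(LINT x|torus. F x * cnj (h x)) = (\<Sum>k\<in>\<Omega> - K. fourier F k * cnj (\<omega> k))"
    unfolding h_def using fin by (intro integral_mult_cnj_tpoly Fint) auto
  also have "\<dots> = of_real S"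
    unfolding S_def of_real_sum by (intro sum.cong refl) (simp add: Ff \<omega>_def power2_eq_square)
  finally have "cmod (of_real S) \<le> A * (2 * sqrt m)"
    using Hoelder_torus[OF Fm hm _ _ r(3) A(1)[folded F_def] A(2) H] p r m by simp
  hence S1: "S \<le> A * (2 * sqrt m)" by simp
  have "(\<Sum>l\<in>{n..<N}. a l * (kernel_mass TYPE('d) l - m)) \<le>
      (\<Sum>l\<in>{n..<N}. \<Sum>k\<in>layer_freqs l - K. a (total_level k) * (kernel_weight k)\<^sup>2)"
  proof (rule sum_mono)
    fix l
    let ?Q = "layer_freqs l :: (int^'d) set"
    have "(\<Sum>k\<in>?Q. (kernel_weight k)\<^sup>2) = (\<Sum>k\<in>?Q \<inter> K. (kernel_weight k)\<^sup>2) + (\<Sum>k\<in>?Q - K. (kernel_weight k)\<^sup>2)"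
      by (rule sum.Int_Diff) simp
    moreover have "(\<Sum>k\<in>?Q \<inter> K. (kernel_weight k)\<^sup>2) \<le> (\<Sum>k\<in>?Q \<inter> K. 1)"
      by (intro sum_mono) (auto simp: power_le_one kernel_weight_bounds)
    moreover have "(\<Sum>k\<in>?Q \<inter> K. 1) \<le> real m" using K card_mono[of K "?Q \<inter> K"] by simp
    ultimately have "(\<Sum>k\<in>?Q. (kernel_weight k)\<^sup>2) - m \<le> (\<Sum>k\<in>?Q - K. (kernel_weight k)\<^sup>2)" by linarith
    hence "a l * ((\<Sum>k\<in>?Q. (kernel_weight k)\<^sup>2) - m) \<le> a l * (\<Sum>k\<in>?Q - K. (kernel_weight k)\<^sup>2)"
      by (intro mult_left_mono a0)
    also have "\<dots> = (\<Sum>k\<in>?Q - K. a (total_level k) * (kernel_weight k)\<^sup>2)"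
      unfolding sum_distrib_left by (intro sum.cong) (auto simp: total_level)
    finally show "a l * ((\<Sum>k\<in>?Q. (kernel_weight k)\<^sup>2) - m) \<le> (\<Sum>k\<in>?Q - K. a (total_level k) * (kernel_weight k)\<^sup>2)" .
  qed
  also have "\<dots> = (\<Sum>k\<in>(\<Union>l\<in>{n..<N}. layer_freqs l - K). a (total_level k) * (kernel_weight k)\<^sup>2)"
    by (rule sum.UNION_disjoint[symmetric]) (auto dest: layer_freqs_disjoint)
  also have "(\<Union>l\<in>{n..<N}. layer_freqs l - K) = \<Omega> - K" by (auto simp: \<Omega>_def cross_band_def)
  finally show ?thesis using S1 by (simp add: S_def a_def)
qed

lemma powr_between_lower:
  fixes c c' x y E :: real
  assumes "0 < c" "0 < c'" "0 < x" "c * x \<le> y" "y \<le> c' * x"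
  shows "min (c powr E) (c' powr E) * x powr E \<le> y powr E"
proof -
  have y: "0 < y" using assms mult_pos_pos[of c x] by linarith
  show ?thesis
  proof (cases "0 \<le> E")
    case True
    have "min (c powr E) (c' powr E) * x powr E \<le> c powr E * x powr E" by (intro mult_right_mono) auto
    also have "\<dots> = (c * x) powr E" using assms by (simp add: powr_mult)
    also have "\<dots> \<le> y powr E" using True assms by (intro powr_mono2) auto
    finally show ?thesis .
  next
    case False
    have "min (c powr E) (c' powr E) * x powr E \<le> c' powr E * x powr E" by (intro mult_right_mono) auto
    also have "\<dots> = (c' * x) powr E" using assms by (simp add: powr_mult)
    also have "\<dots> \<le> y powr E" using False assms y by (intro powr_mono2') auto
    finally show ?thesis .
  qed
qed

theorem sigma_class_lower_bound:
  fixes p q b :: real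
  assumes q: "1 < q" "q \<le> 2" and p: "2 < p"
  defines "E \<equiv> (real CARD('d::finite) - 1) * (b + 1 - 1 / q)"
  shows "\<exists>c>0. \<forall>\<^sub>F m in sequentially.
    ennreal (c * (real m powr (- 1 / 2) * ln (real m) powr (E + 1))) \<le> sigma_class m (W_class (1 / q) b q :: 'd tfun set) p"
proof -
  let ?D = "CARD('d)"
  obtain c1 where c1: "0 < c1" "\<And>l. 4 * ?D \<le> l \<Longrightarrow>
      c1 * 2 ^ l * real l ^ (?D - 1) \<le> kernel_mass TYPE('d) l"
    using kernel_mass_ge[where 'd='d] by blast
  \<comment> \<open>The levels run from \<open>\<gamma> log\<^sub>2 m\<close> to \<open>\<kappa> log\<^sub>2 m\<close>, where \<open>1 < \<gamma> < \<kappa> < p / 2\<close>. From \<open>\<gamma> > 1\<close> the mass of each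
    layer exceeds \<open>2 * m\<close>, so that at most half of it is lost; from \<open>\<kappa> < p / 2\<close> the kernel norm stays
    below \<open>sqrt m\<close>; and \<open>(\<kappa> - \<gamma>) log\<^sub>2 m\<close> layers remain in between.\<close>
  define \<epsilon> where "\<epsilon> = (p - 2) / 8"
  define \<gamma> where "\<gamma> = 1 + \<epsilon>"
  define \<kappa> where "\<kappa> = 1 + 2 * \<epsilon>"
  define \<delta> where "\<delta> = (p - 2) / (4 * p)"
  have \<epsilon>: "0 < \<epsilon>" and \<delta>: "0 < \<delta>" using p by (simp_all add: \<epsilon>_def \<delta>_def)
  have \<gamma>: "0 < \<gamma>" "0 < \<kappa>" using \<epsilon> by (simp_all add: \<gamma>_def \<kappa>_def)
  have \<kappa>p: "\<kappa> / p = 1 / 2 - \<delta>" using p by (simp add: \<kappa>_def \<epsilon>_def \<delta>_def field_simps)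
  define w where "w = min (\<gamma> powr E) (\<kappa> powr E)"
  have w: "0 < w" using \<gamma> by (simp add: w_def)
  define c2 where "c2 = (\<epsilon> / 2) * (c1 / (2 * 4 ^ ?D) * w)"
  have c2: "0 < c2" using \<epsilon> c1 w by (simp add: c2_def)
  define c where "c = c2 / (2 * ln 2 powr (E + 1))"
  have c: "0 < c" using c2 by (simp add: c_def)
  have e1: "\<forall>\<^sub>F m::nat in sequentially. 2 \<le> m" by (rule eventually_ge_at_top)
  have e2: "\<forall>\<^sub>F m::nat in sequentially. 4 * real ?D + 4 / \<epsilon> + 1 \<le> log 2 (real m)" by real_asymp
  have e3: "\<forall>\<^sub>F m::nat in sequentially. 2 * real m \<le> c1 * real m powr (1 + \<epsilon>)"
    using \<epsilon> c1(1) by real_asymp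
  have e4: "\<forall>\<^sub>F m::nat in sequentially. \<kappa> * log 2 (real m) * (2 ^ ?D * real m powr (1 / 2 - \<delta>) * (\<kappa> * log 2 (real m) + 1) powr real ?D) \<le> real m powr (1 / 2)"
    using \<delta> \<gamma>(2) by real_asymp
  have "\<forall>\<^sub>F m in sequentially.
    ennreal (c * (real m powr (- 1 / 2) * ln (real m) powr (E + 1))) \<le> sigma_class m (W_class (1 / q) b q :: 'd tfun set) p"
    using e1 e2 e3 e4
  proof eventually_elim
    case (elim m)
    define x where "x = log 2 (real m)"
    have x: "4 * real ?D + 4 / \<epsilon> + 1 \<le> x" using elim by (simp add: x_def)
    have e4: "0 < 4 / \<epsilon>" using \<epsilon> by simp
    have x1: "1 \<le> x" "0 < x" using x e4 by linarith+
    have m2: "2 powr x = real m" using elim by (simp add: x_def)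
    have xl: "ln (real m) = x * ln 2" by (simp add: x_def log_def)
    define n where "n = nat \<lceil>\<gamma> * x\<rceil>"
    define N where "N = nat \<lfloor>\<kappa> * x\<rfloor>"
    have gx: "x \<le> \<gamma> * x" "0 \<le> \<kappa> * x" using \<epsilon> x1 \<gamma> by (simp_all add: \<gamma>_def)
    have n: "\<gamma> * x \<le> real n" "real n \<le> \<gamma> * x + 1" using gx x1 by (simp_all add: n_def)
    have N: "real N \<le> \<kappa> * x" "\<kappa> * x - 1 \<le> real N" using gx by (simp_all add: N_def)
    have xe: "4 \<le> \<epsilon> * x"
    proof -
      have "4 / \<epsilon> \<le> x" using x by linarith
      thus ?thesis using \<epsilon> by (simp add: pos_divide_le_eq mult.commute)
    qed
    have gap: "\<epsilon> / 2 * x \<le> real N - real n"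
    proof -
      have "\<kappa> * x = \<gamma> * x + \<epsilon> * x" by (simp add: \<kappa>_def \<gamma>_def algebra_simps)
      thus ?thesis using n N xe by simp
    qed
    have "0 \<le> \<epsilon> / 2 * x" using \<epsilon> x1 by simp
    hence nN: "n \<le> N" using gap by linarith
    have n4: "4 * ?D \<le> n"
    proof -
      have "4 * real ?D \<le> x" using x e4 by linarith
      hence "real (4 * ?D) \<le> real n" using gx n by simp
      thus ?thesis by (simp only: of_nat_le_iff)
    qed
    have lay: "c1 / (2 * 4 ^ ?D) * w * x powr E \<le> amplitude TYPE('d) b q l * (kernel_mass TYPE('d) l - m)" if l: "l \<in> {n..<N}" for l
    proof -
      have l4: "4 * ?D \<le> l" using n4 l by simp
      have l1: "1 \<le> l"
      proof -
        have "0 < ?D" by simp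
        thus ?thesis using l4 by linarith
      qed
      have mass: "c1 * 2 ^ l * real l ^ (?D - 1) \<le> kernel_mass TYPE('d) l" by (rule c1(2)[OF l4])
      have "real m powr (1 + \<epsilon>) = 2 powr (\<gamma> * x)"
        unfolding m2[symmetric] by (simp add: powr_powr \<gamma>_def mult.commute)
      also have "\<dots> \<le> 2 powr real l" using n l by (intro powr_mono) auto
      also have "\<dots> = 2 ^ l" by (simp add: powr_realpow)
      finally have "c1 * real m powr (1 + \<epsilon>) \<le> c1 * 2 ^ l * 1" using c1(1) by simp
      also have "c1 * 2 ^ l * 1 \<le> c1 * 2 ^ l * real l ^ (?D - 1)"
        using c1 l1 by (intro mult_left_mono one_le_power) auto
      finally have "2 * real m \<le> c1 * 2 ^ l * real l ^ (?D - 1)" using elim by linarith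
      hence half: "c1 * 2 ^ l * real l ^ (?D - 1) / 2 \<le> kernel_mass TYPE('d) l - m" using mass by linarith
      have lx: "\<gamma> * x \<le> real l" "real l \<le> \<kappa> * x" using n N l by auto
      have "c1 / (2 * 4 ^ ?D) * w * x powr E = c1 / (2 * 4 ^ ?D) * (w * x powr E)" by simp
      also have "\<dots> \<le> c1 / (2 * 4 ^ ?D) * real l powr E"
        unfolding w_def using \<gamma> x1 lx c1 by (intro mult_left_mono powr_between_lower) auto
      also have "\<dots> = amplitude TYPE('d) b q l * (c1 * 2 ^ l * real l ^ (?D - 1) / 2)"
      proof -
        have "real l powr ((real ?D - 1) * (b - 1 / q)) * real l ^ (?D - 1) = real l powr E"
        proof -
          have "real l ^ (?D - 1) = real l powr (real ?D - 1)"
            using l1 by (simp add: powr_realpow[symmetric] of_nat_diff Suc_leI)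
          thus ?thesis by (simp add: powr_add[symmetric] E_def algebra_simps)
        qed
        moreover have "2 powr (- real l) * 2 ^ l = (1 :: real)"
          by (simp add: powr_minus powr_realpow)
        moreover have "max l 1 = l" using l1 by simp
        moreover have "amplitude TYPE('d) b q l * (c1 * 2 ^ l * real l ^ (?D - 1) / 2) =
          c1 / (2 * 4 ^ ?D) * (2 powr (- real l) * 2 ^ l) * (real (max l 1) powr ((real ?D - 1) * (b - 1 / q)) * real l ^ (?D - 1))"
          unfolding amplitude_def by (simp add: mult_ac)
        ultimately show ?thesis by (simp only: mult_1_right)
      qed
      also have "\<dots> \<le> amplitude TYPE('d) b q l * (kernel_mass TYPE('d) l - m)" by (intro mult_left_mono half amplitude_nonneg)
      finally show ?thesis .
    qed
    have S: "c2 * x powr (E + 1) \<le> (\<Sum>l\<in>{n..<N}. amplitude TYPE('d) b q l * (kernel_mass TYPE('d) l - m))"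
    proof -
      have "c2 * x powr (E + 1) = (\<epsilon> / 2 * x) * (c1 / (2 * 4 ^ ?D) * w * x powr E)"
        using x1 by (simp add: c2_def powr_add)
      also have "\<dots> \<le> (real N - real n) * (c1 / (2 * 4 ^ ?D) * w * x powr E)"
        using gap c1 w by (intro mult_right_mono) auto
      also have "\<dots> = (\<Sum>l\<in>{n..<N}. c1 / (2 * 4 ^ ?D) * w * x powr E)" using nN by (simp add: of_nat_diff)
      also have "\<dots> \<le> (\<Sum>l\<in>{n..<N}. amplitude TYPE('d) b q l * (kernel_mass TYPE('d) l - m))" by (intro sum_mono lay)
      finally show ?thesis .
    qed
    have Ncond: "real N * (2 ^ ?D * 2 powr (real N / p) * (real N + 1) powr real ?D) \<le> sqrt m"
    proof -
      have "2 powr (real N / p) \<le> 2 powr (\<kappa> * x / p)" using N p by (intro powr_mono divide_right_mono) auto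
      also have "\<kappa> * x / p = x * (1 / 2 - \<delta>)" unfolding \<kappa>p[symmetric] by simp
      also have "2 powr (x * (1 / 2 - \<delta>)) = real m powr (1 / 2 - \<delta>)" unfolding m2[symmetric] by (simp add: powr_powr)
      finally have "real N * (2 ^ ?D * 2 powr (real N / p) * (real N + 1) powr real ?D) \<le>
          \<kappa> * x * (2 ^ ?D * real m powr (1 / 2 - \<delta>) * (\<kappa> * x + 1) powr real ?D)"
        using N gx by (intro mult_mono powr_mono2) auto
      also have "\<dots> \<le> real m powr (1 / 2)" using elim by (simp add: x_def)
      finally show ?thesis by (simp add: powr_half_sqrt)
    qed
    define V where "V = c2 * x powr (E + 1) / (2 * sqrt m)"
    have m0: "0 < m" using elim by simp
    have V: "0 < V" using c2 x1 m0 by (simp add: V_def)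
    have low: "ennreal V \<le> Lp_norm p (\<lambda>x. extremal b q n N x - t x)" if t: "t \<in> trig_polys m" for t :: "'d tfun"
    proof (rule ccontr)
      assume "\<not> ennreal V \<le> Lp_norm p (\<lambda>x. extremal b q n N x - t x)"
      hence lt: "Lp_norm p (\<lambda>x. extremal b q n N x - t x) < ennreal V" by simp
      then obtain a where a: "0 \<le> a" "Lp_norm p (\<lambda>x. extremal b q n N x - t x) = ennreal a" "a < V"
        by (cases "Lp_norm p (\<lambda>x. extremal b q n N x - t x)") (auto simp: ennreal_less_iff)
      \<comment> \<open>A bound strictly between \<open>a\<close> and \<open>V\<close>, positive even if \<open>a = 0\<close>.\<close>
      define A where "A = (a + V) / 2"
      have A: "a \<le> A" "0 < A" "A < V" using a V by (auto simp: A_def)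
      have "pint p (\<lambda>x. extremal b q n N x - t x) \<le> ennreal (A powr p)"
        using A p a by (subst Lp_norm_le_iff[symmetric]) (auto intro: ennreal_leI)
      from duality_lower_bound[OF t m0 p this A(2) Ncond] S
      have "c2 * x powr (E + 1) \<le> A * (2 * sqrt m)" by linarith
      also have "\<dots> < V * (2 * sqrt m)" using A m0 by (intro mult_strict_right_mono) auto
      also have "\<dots> = c2 * x powr (E + 1)" using m0 by (simp add: V_def)
      finally show False by simp
    qed
    have "c * (real m powr (- 1 / 2) * ln (real m) powr (E + 1)) = V"
    proof -
      have "real m powr (- 1 / 2) = 1 / sqrt m" using m0 by (simp add: powr_minus powr_half_sqrt inverse_eq_divide)
      moreover have "ln (real m) powr (E + 1) = x powr (E + 1) * ln 2 powr (E + 1)" unfolding xl using x1 by (intro powr_mult)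
      ultimately show ?thesis by (simp add: c_def V_def)
    qed
    hence "ennreal (c * (real m powr (- 1 / 2) * ln (real m) powr (E + 1))) = ennreal V" by simp
    also have "\<dots> \<le> sigma m (extremal b q n N :: 'd tfun) p"
      unfolding sigma_def by (intro INF_greatest low)
    also have "\<dots> \<le> sigma_class m (W_class (1 / q) b q :: 'd tfun set) p"
      unfolding sigma_class_def by (intro SUP_upper extremal_in_W q)
    finally show ?case .
  qed
  thus ?thesis using c by blast
qed

section \<open>The order of best sparse approximation\<close>

theorem theorem3p5:
  fixes q p b :: real
  assumes "1 < q" "q \<le> 2" "2 < p"
  shows
    "let W = (W_class (1 / q) b q :: 'd::finite tfun set);
         B = (\<lambda>m::nat. real m powr (- 1 / 2) *
                ln (real m) powr ((real CARD('d) - 1) * (b + 1 - 1 / q) + 1))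
     in
       (\<exists>c C. 0 < c \<and> c \<le> C \<and>
          (\<forall>\<^sub>F m in sequentially.
             ennreal (c * B m) \<le> sigma_class m W p \<and> sigma_class m W p \<le> ennreal (C * B m))) \<and>
       (\<exists>C1>0. \<exists>C2>0. \<exists>G :: real \<Rightarrow> nat \<Rightarrow> 'd tfun \<Rightarrow> 'd tfun. greedy_methods C1 C2 G) \<and>
       (\<exists>P :: nat \<Rightarrow> procedure. \<forall>C1>0. \<forall>C2>0. \<exists>C>0. \<forall>\<^sub>F m in sequentially.
          \<forall>(G :: real \<Rightarrow> nat \<Rightarrow> 'd tfun \<Rightarrow> 'd tfun) f g.
            greedy_methods C1 C2 G \<longrightarrow> f \<in> W \<longrightarrow> produces G f (P m) g \<longrightarrow>
              g \<in> trig_polys m \<and> Lp_norm p (\<lambda>x. f x - g x) \<le> ennreal (C * B m))"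
proof -
  define W where "W = (W_class (1 / q) b q :: 'd tfun set)"
  define B where "B = (\<lambda>m::nat. real m powr (- 1 / 2) *
                ln (real m) powr ((real CARD('d) - 1) * (b + 1 - 1 / q) + 1))"
  have up: "\<exists>C>0. \<forall>\<^sub>F m in sequentially. \<forall>(G :: real \<Rightarrow> nat \<Rightarrow> 'd tfun \<Rightarrow> 'd tfun) f g.
      greedy_methods C1 C2 G \<longrightarrow> f \<in> W \<longrightarrow> produces G f (layered_greedy p m) g \<longrightarrow>
        g \<in> trig_polys m \<and> Lp_norm p (\<lambda>x. f x - g x) \<le> ennreal (C * B m)" if "0 < C1" for C1 C2
    using layered_greedy_upper_bound[OF assms that, where 'd='d and b = b and ?C2.0 = C2] unfolding W_def B_def .
  obtain c where c: "0 < c" "\<forall>\<^sub>F m in sequentially. ennreal (c * B m) \<le> sigma_class m W p"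
    using sigma_class_lower_bound[OF assms, where 'd='d, of b] unfolding W_def B_def by blast
  obtain C1 C2 and G :: "real \<Rightarrow> nat \<Rightarrow> 'd tfun \<Rightarrow> 'd tfun" where G: "0 < C1" "0 < C2" "greedy_methods C1 C2 G"
    using greedy_methods_exist by blast
  obtain C where C: "0 < C" "\<forall>\<^sub>F m in sequentially. \<forall>(G :: real \<Rightarrow> nat \<Rightarrow> 'd tfun \<Rightarrow> 'd tfun) f g.
      greedy_methods C1 C2 G \<longrightarrow> f \<in> W \<longrightarrow> produces G f (layered_greedy p m) g \<longrightarrow>
        g \<in> trig_polys m \<and> Lp_norm p (\<lambda>x. f x - g x) \<le> ennreal (C * B m)"
    using up[OF G(1)] by blast
  have B0: "0 \<le> B m" for m by (simp add: B_def)
  have "\<forall>\<^sub>F m in sequentially. ennreal (c * B m) \<le> sigma_class m W p \<and> sigma_class m W p \<le> ennreal (max c C * B m)"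
    using c(2) C(2)
  proof eventually_elim
    case (elim m)
    have "sigma_class m W p \<le> ennreal (max c C * B m)"
      unfolding sigma_class_def
    proof (rule SUP_least)
      fix f assume f: "f \<in> W"
      obtain g where g: "produces G f (layered_greedy p m) g" using produces_total by blast
      have "sigma m f p \<le> Lp_norm p (\<lambda>x. f x - g x)"
        unfolding sigma_def using elim(2) G(3) f g by (intro INF_lower) blast
      also have "\<dots> \<le> ennreal (C * B m)" using elim(2) G(3) f g by blast
      also have "\<dots> \<le> ennreal (max c C * B m)" using B0 by (intro ennreal_leI mult_right_mono) auto
      finally show "sigma m f p \<le> ennreal (max c C * B m)" .
    qed
    thus ?case using elim(1) by simp
  qed
  hence 1: "\<exists>c C. 0 < c \<and> c \<le> C \<and> (\<forall>\<^sub>F m in sequentially.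
      ennreal (c * B m) \<le> sigma_class m W p \<and> sigma_class m W p \<le> ennreal (C * B m))"
    using c(1) by (intro exI[of _ c] exI[of _ "max c C"]) auto
  have 2: "\<exists>C1>0. \<exists>C2>0. \<exists>G :: real \<Rightarrow> nat \<Rightarrow> 'd tfun \<Rightarrow> 'd tfun. greedy_methods C1 C2 G"
    using G by blast
  have 3: "\<exists>P :: nat \<Rightarrow> procedure. \<forall>C1>0. \<forall>C2>0. \<exists>C>0. \<forall>\<^sub>F m in sequentially.
      \<forall>(G :: real \<Rightarrow> nat \<Rightarrow> 'd tfun \<Rightarrow> 'd tfun) f g.
        greedy_methods C1 C2 G \<longrightarrow> f \<in> W \<longrightarrow> produces G f (P m) g \<longrightarrow>
          g \<in> trig_polys m \<and> Lp_norm p (\<lambda>x. f x - g x) \<le> ennreal (C * B m)"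
    using up by (intro exI[of _ "layered_greedy p"]) blast
  show ?thesis unfolding Let_def W_def[symmetric] B_def[symmetric] using 1 2 3 by blast
qed

end
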